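(* Let $p,q\ge 1$ be natural numbers, $n=p+q$, and let $\alpha\in\mathbb{C}$ be such that $2k+p-q\pm\alpha\neq 0$ for all $k\in\mathbb{Z}$. Let $\mathcal{L}_\alpha=L+i\alpha U$ on the Heisenberg group $N(p,q,\mathbb{C})$. Then $$\langle \Phi_\alpha,f\rangle=\sum_{k\in\mathbb{Z}}\int_{-\infty}^{\infty}\frac{1}{-|\lambda|\,(2k+p-q-\alpha\,\mathrm{sgn}\,\lambda)}\,\langle S_{\lambda,k},f\rangle\,|\lambda|^{n}\,d\lambda,\qquad f\in\mathcal{S}(N(p,q,\mathbb{C})),$$ is a well defined tempered distribution on $N(p,q,\mathbb{C})$, and it is a fundamental solution for the operator $\mathcal{L}_\alpha$.
   Context: $N(p,q,\mathbb{C})=\mathbb{C}^n\times\mathbb{R}$ (identifying $\mathfrak{Im}\,\mathbb{C}$ with $\mathbb{R}$) with group law $(v,t)(v',t')=\left(v+v',\,t+t'-\tfrac12\mathfrak{Im}B(v,v')\right)$, where $B(v,w)=\sum_{j=1}^p v_j\overline{w_j}-\sum_{j=p+1}^n v_j\overline{w_j}$. $\mathcal{S}(N(p,q,\mathbb{C}))$ is the Schwartz space of $\mathbb{C}^n\times\mathbb{R}\cong\mathbb{R}^{2n+1}$. Write $v_j=x_j+iy_j$, $\varepsilon_j=1$ for $j\le p$ and $\varepsilon_j=-1$ for $j>p$. The left invariant vector fields are $X_j=\partial_{x_j}-\tfrac12\varepsilon_j y_j\partial_t$, $Y_j=\partial_{y_j}+\tfrac12\varepsilon_j x_j\partial_t$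 (up to interchanging $X_j$ and $Y_j$ for $j>p$, so that $[X_j,Y_j]=U$), and $U=\partial_t$. Put $L=\sum_{j=1}^p(X_j^2+Y_j^2)-\sum_{j=p+1}^n(X_j^2+Y_j^2)$. For $\lambda\in\mathbb{R}\setminus\{0\}$, $\pi_\lambda$ denotes the Schrödinger representation of $N(p,q,\mathbb{C})$ on $L^2(\mathbb{R}^n)$ (irreducible, unitary) with central character $\pi_\lambda(0,t)=e^{-i\lambda t}$, and $\{h_m\}_{m\in\mathbb{N}_0^n}$ is the (suitably $\lambda$-scaled) orthonormal Hermite basis, so that $d\pi_\lambda(X_j^2+Y_j^2)h_m=-|\lambda|(2m_j+1)h_m$ for each $j$. Let $E_\lambda(h,h')(z,t)=\langle\pi_\lambda(z,t)h,h'\rangle$ be the matrix entries. For $k\in\mathbb{Z}$, $$S_{\lambda,k}=\sum_{m\in\mathbb{N}_0^n,\ B(m)=k}E_\lambda(h_m,h_m),\qquad B(m)=\sum_{j=1}^p m_j-\sum_{j=p+1}^n m_j,$$ a (convergent) sum in the space of tempered distributions. The $S_{\lambda,k}$ satisfy $LS_{\lambda,k}=-|\lambda|(2k+p-q)S_{\lambda,k}$ and $iUS_{\lambda,k}=\lambda S_{\lambda,k}$. The Haar measure is normalized so that the inversion formula $f=\sum_{k\in\mathbb{Z}}\int_{-\infty}^\infty f*S_{\lambda,k}\,|\lambda|^n\,d\lambda$ holds for all $f\in\mathcal{S}(N(p,q,\mathbb{C}))$. A fundamental solution for a left invariant differential operator $\mathcal{L}$ is a tempered distribution $\Phi$ such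 that for all Schwartz $f$: $\mathcal{L}(f*\Phi)=(\mathcal{L}f)*\Phi=f*\mathcal{L}(\Phi)=f$. *)

theory Defs
  imports "HOL-Analysis.Analysis" "HOL-Computational_Algebra.Polynomial"
begin

section \<open>Schwartz functions and tempered distributions\<close>

primrec pderivs :: "'a::euclidean_space list \<Rightarrow> ('a \<Rightarrow> complex) \<Rightarrow> 'a \<Rightarrow> complex" where
  "pderivs [] f = f"
| "pderivs (b # bs) f = (\<lambda>x. frechet_derivative (pderivs bs f) (at x) b)"

text \<open>The differentiability requirement excludes the arbitrary values that
  \<^const>\<open>frechet_derivative\<close> takes at points of non-differentiability.\<close>

definition smooth :: "('a::euclidean_space \<Rightarrow> complex) \<Rightarrow> bool" where
  "smooth f \<longleftrightarrow> (\<forall>bs \<in> lists Basis. \<forall>x. pderivs bs f differentiable (at x))"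

definition schwartz_space :: "('a::euclidean_space \<Rightarrow> complex) set" where
  "schwartz_space = {f. smooth f \<and>
     (\<forall>N. \<forall>bs \<in> lists Basis. bdd_above (range (\<lambda>x. (1 + norm x) ^ N * norm (pderivs bs f x))))}"

definition schwartz_seminorm :: "nat \<Rightarrow> 'a::euclidean_space list \<Rightarrow> ('a \<Rightarrow> complex) \<Rightarrow> real" where
  "schwartz_seminorm N bs f = (SUP x. (1 + norm x) ^ N * norm (pderivs bs f x))"

text \<open>Distributions are functionals on all functions, of which only the values on
  \<^const>\<open>schwartz_space\<close> matter. Continuity for the locally convex topology given by the
  seminorms is domination by finitely many of them.\<close>

definition tempered_distribution :: "(('a::euclidean_space \<Rightarrow> complex) \<Rightarrow> complex) \<Rightarrow> bool" where
  "tempered_distribution T \<longleftrightarrow>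
     (\<forall>f \<in> schwartz_space. \<forall>g \<in> schwartz_space. T (\<lambda>x. f x + g x) = T f + T g) \<and>
     (\<forall>a. \<forall>f \<in> schwartz_space. T (\<lambda>x. a * f x) = a * T f) \<and>
     (\<exists>C N. \<forall>f \<in> schwartz_space.
        norm (T f) \<le> C * (\<Sum>bs \<in> {bs \<in> lists Basis. length bs \<le> N}. schwartz_seminorm N bs f))"

section \<open>The Heisenberg group $N(p,q,C)$\<close>

text \<open>The types \<^typ>\<open>'p\<close> and \<^typ>\<open>'q\<close> have $p$ and $q$ elements and index the first $p$ and the
  last $q$ coordinates. The vector space structure of the product type is that of $R^{2n+1}$;
  the group operation is \<open>heis_mult\<close>.\<close>

type_synonym ('p, 'q) heis = "(complex ^ ('p + 'q)) \<times> real"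

definition herm_form :: "complex ^ ('p::finite + 'q::finite) \<Rightarrow> complex ^ ('p + 'q) \<Rightarrow> complex" where
  "herm_form v w = (\<Sum>j\<in>UNIV. v $ Inl j * cnj (w $ Inl j)) - (\<Sum>j\<in>UNIV. v $ Inr j * cnj (w $ Inr j))"

definition heis_mult :: "('p::finite, 'q::finite) heis \<Rightarrow> ('p, 'q) heis \<Rightarrow> ('p, 'q) heis" where
  "heis_mult g g' = (fst g + fst g', snd g + snd g' - Im (herm_form (fst g) (fst g')) / 2)"

definition heis_inv :: "('p::finite, 'q::finite) heis \<Rightarrow> ('p, 'q) heis" where
  "heis_inv g = (- fst g, - snd g)"

text \<open>The Haar measures are the positive multiples of Lebesgue measure.\<close>

definition heis_haar :: "real \<Rightarrow> ('p::finite, 'q::finite) heis measure" where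
  "heis_haar c = density lborel (\<lambda>_. ennreal c)"

fun eps :: "'p + 'q \<Rightarrow> real" where
  "eps (Inl _) = 1"
| "eps (Inr _) = - 1"

section \<open>Left invariant differential operators\<close>

definition heis_U :: "(('p::finite, 'q::finite) heis \<Rightarrow> complex) \<Rightarrow> ('p, 'q) heis \<Rightarrow> complex" where
  "heis_U f g = frechet_derivative f (at g) (0, 1)"

text \<open>$X_j$ and $Y_j$ are not interchanged for $j > p$, so $[X_j, Y_j] = \varepsilon_j U$.
  Only $X_j^2 + Y_j^2$ is used below, which is unaffected.\<close>

definition heis_X :: "'p + 'q \<Rightarrow> (('p::finite, 'q::finite) heis \<Rightarrow> complex) \<Rightarrow> ('p, 'q) heis \<Rightarrow> complex" where
  "heis_X j f g = frechet_derivative f (at g) (axis j 1, 0)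
     - of_real (eps j * Im (fst g $ j) / 2) * heis_U f g"

definition heis_Y :: "'p + 'q \<Rightarrow> (('p::finite, 'q::finite) heis \<Rightarrow> complex) \<Rightarrow> ('p, 'q) heis \<Rightarrow> complex" where
  "heis_Y j f g = frechet_derivative f (at g) (axis j \<i>, 0)
     + of_real (eps j * Re (fst g $ j) / 2) * heis_U f g"

definition heis_L :: "(('p::finite, 'q::finite) heis \<Rightarrow> complex) \<Rightarrow> ('p, 'q) heis \<Rightarrow> complex" where
  "heis_L f g =
     (\<Sum>j\<in>UNIV. heis_X (Inl j) (heis_X (Inl j) f) g + heis_Y (Inl j) (heis_Y (Inl j) f) g)
   - (\<Sum>j\<in>UNIV. heis_X (Inr j) (heis_X (Inr j) f) g + heis_Y (Inr j) (heis_Y (Inr j) f) g)"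

definition heis_L_alpha ::
    "complex \<Rightarrow> (('p::finite, 'q::finite) heis \<Rightarrow> complex) \<Rightarrow> ('p, 'q) heis \<Rightarrow> complex" where
  "heis_L_alpha \<alpha> f g = heis_L f g + \<i> * \<alpha> * heis_U f g"

text \<open>The same operators on distributions. The vector fields are divergence free, so each of them
  is the negative of its transpose.\<close>

type_synonym ('p, 'q) heis_dist = "(('p, 'q) heis \<Rightarrow> complex) \<Rightarrow> complex"

definition dist_U :: "('p::finite, 'q::finite) heis_dist \<Rightarrow> ('p, 'q) heis_dist" where
  "dist_U T f = - T (heis_U f)"

definition dist_X :: "'p + 'q \<Rightarrow> ('p::finite, 'q::finite) heis_dist \<Rightarrow> ('p, 'q) heis_dist" where
  "dist_X j T f = - T (heis_X j f)"

definition dist_Y :: "'p + 'q \<Rightarrow> ('p::finite, 'q::finite) heis_dist \<Rightarrow> ('p, 'q) heis_dist" where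
  "dist_Y j T f = - T (heis_Y j f)"

definition dist_L :: "('p::finite, 'q::finite) heis_dist \<Rightarrow> ('p, 'q) heis_dist" where
  "dist_L T f =
     (\<Sum>j\<in>UNIV. dist_X (Inl j) (dist_X (Inl j) T) f + dist_Y (Inl j) (dist_Y (Inl j) T) f)
   - (\<Sum>j\<in>UNIV. dist_X (Inr j) (dist_X (Inr j) T) f + dist_Y (Inr j) (dist_Y (Inr j) T) f)"

definition dist_L_alpha :: "complex \<Rightarrow> ('p::finite, 'q::finite) heis_dist \<Rightarrow> ('p, 'q) heis_dist" where
  "dist_L_alpha \<alpha> T f = dist_L T f + \<i> * \<alpha> * dist_U T f"

text \<open>$(f * T)(x) = \int f(x y^{-1})\, dT(y)$, a function.\<close>

definition heis_conv ::
    "(('p::finite, 'q::finite) heis \<Rightarrow> complex) \<Rightarrow> ('p, 'q) heis_dist \<Rightarrow> ('p, 'q) heis \<Rightarrow> complex" where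
  "heis_conv f T x = T (\<lambda>y. f (heis_mult x (heis_inv y)))"

text \<open>\<open>D\<close> is the action of the differential operator on functions and \<open>D'\<close> its action on
  distributions. Smoothness of $f * \Phi$ gives a meaning to $D(f * \Phi)$.\<close>

definition fundamental_solution ::
    "((('p::finite, 'q::finite) heis \<Rightarrow> complex) \<Rightarrow> ('p, 'q) heis \<Rightarrow> complex)
     \<Rightarrow> (('p, 'q) heis_dist \<Rightarrow> ('p, 'q) heis_dist) \<Rightarrow> ('p, 'q) heis_dist \<Rightarrow> bool" where
  "fundamental_solution D D' \<Phi> \<longleftrightarrow> tempered_distribution \<Phi> \<and>
     (\<forall>f \<in> schwartz_space. smooth (heis_conv f \<Phi>) \<and>
        D (heis_conv f \<Phi>) = f \<and> heis_conv (D f) \<Phi> = f \<and> heis_conv f (D' \<Phi>) = f)"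

section \<open>Schroedinger representation and the distributions $S_{\lambda,k}$\<close>

text \<open>The realization on $L^2(R^n)$ with $d\pi_\lambda(X_j) = \partial_j$,
  $d\pi_\lambda(Y_j) = -i\lambda\varepsilon_j\xi_j$ and $d\pi_\lambda(U) = -i\lambda$.\<close>

definition schroedinger_rep ::
    "real \<Rightarrow> ('p::finite, 'q::finite) heis \<Rightarrow> (real ^ ('p + 'q) \<Rightarrow> complex) \<Rightarrow> real ^ ('p + 'q) \<Rightarrow> complex" where
  "schroedinger_rep lam g \<phi> \<xi> =
     cis (- lam * (snd g + (\<Sum>j\<in>UNIV. eps j *
            (Im (fst g $ j) * \<xi> $ j + Re (fst g $ j) * Im (fst g $ j) / 2))))
     * \<phi> (\<xi> + (\<chi> j. Re (fst g $ j)))"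

definition matrix_entry ::
    "real \<Rightarrow> (real ^ ('p::finite + 'q::finite) \<Rightarrow> complex) \<Rightarrow> (real ^ ('p + 'q) \<Rightarrow> complex)
     \<Rightarrow> ('p, 'q) heis \<Rightarrow> complex" where
  "matrix_entry lam h h' g = (LINT \<xi>|lborel. schroedinger_rep lam g h \<xi> * cnj (h' \<xi>))"

primrec hermite_poly :: "nat \<Rightarrow> real poly" where
  "hermite_poly 0 = 1"
| "hermite_poly (Suc m) = [:0, 2:] * hermite_poly m - pderiv (hermite_poly m)"

definition hermite_fun :: "nat \<Rightarrow> real \<Rightarrow> real" where
  "hermite_fun m s = poly (hermite_poly m) s * exp (- s\<^sup>2 / 2) / sqrt (2 ^ m * fact m * sqrt pi)"

definition hermite_basis :: "real \<Rightarrow> nat ^ 'n::finite \<Rightarrow> real ^ 'n \<Rightarrow> complex" where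
  "hermite_basis lam m \<xi> =
     of_real (\<Prod>j\<in>UNIV. \<bar>lam\<bar> powr (1/4) * hermite_fun (m $ j) (sqrt \<bar>lam\<bar> * \<xi> $ j))"

definition signed_degree :: "nat ^ ('p::finite + 'q::finite) \<Rightarrow> int" where
  "signed_degree m = (\<Sum>j\<in>UNIV. int (m $ Inl j)) - (\<Sum>j\<in>UNIV. int (m $ Inr j))"

text \<open>The parameter \<open>c\<close> is the constant in \<^const>\<open>heis_haar\<close>; the function
  $E_\lambda(h_m,h_m)$ is regarded as a distribution by means of that measure.\<close>

definition E_pairing ::
    "real \<Rightarrow> real \<Rightarrow> nat ^ ('p::finite + 'q::finite) \<Rightarrow> ('p, 'q) heis_dist" where
  "E_pairing c lam m f =
     (LINT g|heis_haar c. matrix_entry lam (hermite_basis lam m) (hermite_basis lam m) g * f g)"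

definition S_dist :: "real \<Rightarrow> real \<Rightarrow> int \<Rightarrow> ('p::finite, 'q::finite) heis_dist" where
  "S_dist c lam k f = (\<Sum>\<^sub>\<infinity>m | signed_degree m = k. E_pairing c lam m f)"

text \<open>This normalizes the Haar measure: it holds for exactly one \<open>c\<close>, namely
  $(2\pi)^{-(n+1)}$.\<close>

definition inversion_formula :: "real \<Rightarrow> ('p::finite) itself \<Rightarrow> ('q::finite) itself \<Rightarrow> bool" where
  "inversion_formula c _ _ \<longleftrightarrow>
     (\<forall>f \<in> (schwartz_space :: (('p, 'q) heis \<Rightarrow> complex) set). \<forall>x.
        ((\<lambda>k. LINT lam:-{0}|lborel. heis_conv f (S_dist c lam k) x * of_real (\<bar>lam\<bar> ^ CARD('p + 'q)))
           has_sum f x) (UNIV :: int set))"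

section \<open>The distribution $\Phi_\alpha$\<close>

definition Phi_integrand ::
    "real \<Rightarrow> complex \<Rightarrow> int \<Rightarrow> (('p::finite, 'q::finite) heis \<Rightarrow> complex) \<Rightarrow> real \<Rightarrow> complex" where
  "Phi_integrand c \<alpha> k f lam =
     1 / (- of_real \<bar>lam\<bar> *
            (2 * of_int k + of_nat CARD('p) - of_nat CARD('q) - \<alpha> * of_real (sgn lam)))
     * S_dist c lam k f * of_real (\<bar>lam\<bar> ^ CARD('p + 'q))"

definition Phi :: "real \<Rightarrow> complex \<Rightarrow> ('p::finite, 'q::finite) heis_dist" where
  "Phi c \<alpha> f = (\<Sum>\<^sub>\<infinity>k\<in>UNIV. LINT lam:-{0}|lborel. Phi_integrand c \<alpha> k f lam)"

definition Phi_converges :: "real \<Rightarrow> complex \<Rightarrow> (('p::finite, 'q::finite) heis \<Rightarrow> complex) \<Rightarrow> bool" where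
  "Phi_converges c \<alpha> f \<longleftrightarrow>
     (\<forall>lam k. lam \<noteq> 0 \<longrightarrow> (\<lambda>m. E_pairing c lam m f) summable_on {m. signed_degree m = k}) \<and>
     (\<forall>k. set_integrable lborel (-{0}) (Phi_integrand c \<alpha> k f)) \<and>
     (\<lambda>k. LINT lam:-{0}|lborel. Phi_integrand c \<alpha> k f lam) summable_on UNIV"

end

theory Submission
  imports Defs
begin

text \<open>Each matrix entry of the Schroedinger representation is a joint eigenfunction of \<open>L\<close> and \<open>U\<close>, from
  the left and from the right, and the denominators in \<open>\<Phi>\<close> are the eigenvalues of \<open>\<L>\<^sub>\<alpha>\<close>. Hence \<open>\<Phi>\<close>
  applied to \<open>\<L>\<^sub>\<alpha> f\<close> (or its transpose) is the right-hand side of the inversion formula at the identity.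

  For convergence, pairing a matrix entry with powers of \<open>1 - \<Sum> (X\<^sub>j\<^sup>2 + Y\<^sub>j\<^sup>2)\<close> applied to \<open>f\<close> gives
  decay in \<open>\<bar>\<lambda>\<bar> (2 \<bar>m\<bar> + n)\<close>. Summing over the hyperplane \<open>B(m) = k\<close>, which has dimension \<open>n - 1\<close>, costs
  \<open>\<bar>\<lambda>\<bar>\<^sup>1\<^sup>-\<^sup>n\<close>, just compensated by the density \<open>\<bar>\<lambda>\<bar>\<^sup>n\<close> divided by \<open>\<bar>\<lambda>\<bar>\<close>; the integral over \<open>\<lambda>\<close> is then
  \<open>O(1 / (1 + \<bar>k\<bar>))\<close>, and the denominator supplies the second power needed for the sum over \<open>k\<close>.

  Smoothness of \<open>f * \<Phi>\<close> follows from a second order expansion of left translations tested against the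
  bounded matrix entries.\<close>

section \<open>Schwartz functions\<close>

text \<open>The obstacle is that the eigenvalue of \<open>L\<close> is the same on a whole
  hyperplane of the lattice, so neither \<open>L\<close> nor the denominators give decay there; it
  must come from the full sub-Laplacian, whose eigenvalues see every coordinate. The entries are
  never differentiated. Invariant fields are moved by integration by parts onto the vector
  \<open>h_m\<close>, at a fixed point of R^n, where the eigenvalue equation is that of the harmonic
  oscillator; Fubini transfers it to the entry. Inversion on the group exchanges \<open>lam\<close>
  and \<open>- lam\<close>, which links the left and right equations: it reverses U but not the
  squares, so the operator composed with inversion and the transposed operator, with
  \<open>\<alpha>\<close> replaced by \<open>- \<alpha>\<close>, meet the same denominators. The
  remainder of the expansion of a translation satisfies the same decay estimate as a Schwartz
  function, with a constant quadratic in the increment. One bound for the series therefore yields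
  convergence, temperedness and differentiability of convolutions.\<close>

abbreviation ddir :: "'a::euclidean_space \<Rightarrow> ('a \<Rightarrow> complex) \<Rightarrow> 'a \<Rightarrow> complex" where
  "ddir v f \<equiv> (\<lambda>x. frechet_derivative f (at x) v)"

lemma pderivs_append: "pderivs (bs @ cs) f = pderivs bs (pderivs cs f)"
  by (induction bs) auto

lemma ddir_eq: "(f has_derivative f') (at x) \<Longrightarrow> ddir v f x = f' v"
  by (metis frechet_derivative_at)

text \<open>A family of differentiable functions closed under partial derivatives contains all
  iterated derivatives of its members. Later smoothness proofs only have to exhibit such an
  invariant family.\<close>

lemma smooth_coinduct:
  assumes "f \<in> S" "\<And>g x. g \<in> S \<Longrightarrow> g differentiable (at x)"
    and "\<And>g b. g \<in> S \<Longrightarrow> b \<in> Basis \<Longrightarrow> ddir b g \<in> S"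
  shows "smooth f"
proof -
  have "pderivs bs f \<in> S" if "bs \<in> lists Basis" for bs
    using that by (induction bs) (simp_all add: assms(1) assms(3))
  then show ?thesis by (simp add: smooth_def assms(2))
qed

definition rapid :: "('a::euclidean_space \<Rightarrow> complex) \<Rightarrow> bool" where
  "rapid f \<longleftrightarrow> (\<forall>N. \<exists>C. \<forall>x. (1 + norm x) ^ N * norm (f x) \<le> C)"

lemma schwartz_coinduct:
  assumes "f \<in> S" "\<And>g x. g \<in> S \<Longrightarrow> g differentiable (at x)"
    and "\<And>g b. g \<in> S \<Longrightarrow> b \<in> Basis \<Longrightarrow> ddir b g \<in> S"
    and "\<And>g. g \<in> S \<Longrightarrow> rapid g"
  shows "f \<in> schwartz_space"
proof -
  have "smooth f" by (rule smooth_coinduct[of f S, OF assms(1-3)])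
  moreover have "pderivs bs f \<in> S" if "bs \<in> lists Basis" for bs
    using that by (induction bs) (simp_all add: assms(1) assms(3))
  then have "rapid (pderivs bs f)" if "bs \<in> lists Basis" for bs
    using that assms(4) by simp
  ultimately show ?thesis
    unfolding schwartz_space_def rapid_def bdd_above_def by blast
qed

lemma schwartz_differentiable: "f \<in> schwartz_space \<Longrightarrow> f differentiable (at x)"
  unfolding schwartz_space_def smooth_def by (metis (mono_tags, lifting) lists.Nil mem_Collect_eq pderivs.simps(1))

lemma schwartz_has_derivative:
  "f \<in> schwartz_space \<Longrightarrow> (f has_derivative (\<lambda>v. ddir v f x)) (at x)"
  using schwartz_differentiable frechet_derivative_works by blast

lemma schwartz_bdd:
  "f \<in> schwartz_space \<Longrightarrow> bs \<in> lists Basis \<Longrightarrow> bdd_above (range (\<lambda>x. (1 + norm x) ^ N * norm (pderivs bs f x)))"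
  by (auto simp: schwartz_space_def)

lemma schwartz_seminorm_bound:
  "f \<in> schwartz_space \<Longrightarrow> bs \<in> lists Basis \<Longrightarrow>
    (1 + norm x) ^ N * norm (pderivs bs f x) \<le> schwartz_seminorm N bs f"
  unfolding schwartz_seminorm_def by (rule cSUP_upper[OF _ schwartz_bdd]) auto

lemma pderivs_differentiable:
  "f \<in> schwartz_space \<Longrightarrow> bs \<in> lists Basis \<Longrightarrow> pderivs bs f differentiable (at x)"
  by (auto simp: schwartz_space_def smooth_def)

lemma schwartz_rapid: "f \<in> schwartz_space \<Longrightarrow> rapid f"
  unfolding rapid_def using schwartz_seminorm_bound[of f "[]", unfolded pderivs.simps] by blast

lemma schwartz_ddir_Basis:
  assumes "f \<in> schwartz_space" "b \<in> Basis"
  shows "ddir b f \<in> schwartz_space"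
proof -
  have eq: "pderivs bs (ddir b f) = pderivs (bs @ [b]) f" for bs
    by (simp add: pderivs_append)
  have bs: "bs @ [b] \<in> lists Basis" if "bs \<in> lists Basis" for bs
    using that assms by auto
  have "pderivs bs (ddir b f) differentiable (at x)"
    "bdd_above (range (\<lambda>x. (1 + norm x) ^ N * norm (pderivs bs (ddir b f) x)))"
    if "bs \<in> lists Basis" for bs N x
    unfolding eq by (rule pderivs_differentiable[OF assms(1) bs[OF that]], rule schwartz_bdd[OF assms(1) bs[OF that]])
  then show ?thesis
    unfolding schwartz_space_def smooth_def by simp
qed

lemma rapid_add:
  assumes "rapid f" "rapid g" shows "rapid (\<lambda>x. f x + g x)"
  unfolding rapid_def
proof
  fix N
  obtain C D where "\<forall>x. (1 + norm x) ^ N * norm (f x) \<le> C" "\<forall>x. (1 + norm x) ^ N * norm (g x) \<le> D"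
    using assms unfolding rapid_def by metis
  moreover have "(1 + norm x) ^ N * norm (f x + g x) \<le> (1 + norm x) ^ N * norm (f x) + (1 + norm x) ^ N * norm (g x)" for x
    unfolding distrib_left[symmetric] by (intro mult_left_mono norm_triangle_ineq) auto
  ultimately have "\<forall>x. (1 + norm x) ^ N * norm (f x + g x) \<le> C + D"
    by (meson add_mono order_trans)
  then show "\<exists>C. \<forall>x. (1 + norm x) ^ N * norm (f x + g x) \<le> C" by blast
qed

lemma rapid_mult_growth:
  assumes "rapid f" and "\<And>x. norm (g x) \<le> K * (1 + norm x) ^ M * norm (f x)"
  shows "rapid g"
  unfolding rapid_def
proof
  fix N
  obtain C where C: "\<forall>x. (1 + norm x) ^ (N + M) * norm (f x) \<le> C"
    using assms unfolding rapid_def by metis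
  have "(1 + norm x) ^ N * norm (g x) \<le> \<bar>K\<bar> * \<bar>C\<bar>" for x
  proof -
    have "(1 + norm x) ^ N * norm (g x) \<le> (1 + norm x) ^ N * (\<bar>K\<bar> * (1 + norm x) ^ M * norm (f x))"
      by (intro mult_left_mono order_trans[OF assms(2)] mult_right_mono) auto
    also have "\<dots> = \<bar>K\<bar> * ((1 + norm x) ^ (N + M) * norm (f x))"
      by (simp add: power_add algebra_simps)
    also have "\<dots> \<le> \<bar>K\<bar> * \<bar>C\<bar>"
      using C by (intro mult_left_mono) (auto intro: order_trans)
    finally show ?thesis .
  qed
  then show "\<exists>C. \<forall>x. (1 + norm x) ^ N * norm (g x) \<le> C" by blast
qed

lemma schwartz_add:
  fixes f :: "'a::euclidean_space \<Rightarrow> complex"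
  assumes "f \<in> schwartz_space" "g \<in> schwartz_space"
  shows "(\<lambda>x. f x + g x) \<in> schwartz_space"
proof (rule schwartz_coinduct[where S = "{(\<lambda>x. f x + g x) | f g. f \<in> schwartz_space \<and> g \<in> schwartz_space}"])
  fix h :: "'a \<Rightarrow> complex" and b assume h: "h \<in> {(\<lambda>x. f x + g x) | f g. f \<in> schwartz_space \<and> g \<in> schwartz_space}" and b: "b \<in> (Basis :: 'a set)"
  then obtain f g where h': "h = (\<lambda>x. f x + g x)" "f \<in> schwartz_space" "g \<in> schwartz_space" by blast
  have "ddir b h = (\<lambda>x. ddir b f x + ddir b g x)"
    unfolding h' by (intro ext ddir_eq has_derivative_add schwartz_has_derivative h')
  then show "ddir b h \<in> {(\<lambda>x. f x + g x) | f g. f \<in> schwartz_space \<and> g \<in> schwartz_space}"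
    by (intro CollectI exI[of _ "ddir b f"] exI[of _ "ddir b g"] conjI schwartz_ddir_Basis h' b)
next
  show "(\<lambda>x. f x + g x) \<in> {(\<lambda>x. f x + g x) | f g. f \<in> schwartz_space \<and> g \<in> schwartz_space}"
    by (intro CollectI exI[of _ f] exI[of _ g] conjI refl assms)
qed (auto intro: rapid_add[OF schwartz_rapid schwartz_rapid] differentiable_add[OF schwartz_differentiable schwartz_differentiable])

lemma schwartz_cmult:
  fixes f :: "'a::euclidean_space \<Rightarrow> complex"
  assumes "f \<in> schwartz_space"
  shows "(\<lambda>x. c * f x) \<in> schwartz_space"
proof (rule schwartz_coinduct[where S = "{(\<lambda>x. c * f x) | f. f \<in> schwartz_space}"])
  fix h :: "'a \<Rightarrow> complex" and b assume h: "h \<in> {(\<lambda>x. c * f x) | f. f \<in> schwartz_space}" and b: "b \<in> (Basis :: 'a set)"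
  then obtain f where h': "h = (\<lambda>x. c * f x)" "f \<in> schwartz_space" by blast
  have "ddir b h = (\<lambda>x. c * ddir b f x)"
    unfolding h' by (intro ext ddir_eq has_derivative_mult_right schwartz_has_derivative h')
  then show "ddir b h \<in> {(\<lambda>x. c * f x) | f. f \<in> schwartz_space}"
    by (intro CollectI exI[of _ "ddir b f"] conjI schwartz_ddir_Basis h' b)
next
  fix h :: "'a \<Rightarrow> complex" assume "h \<in> {(\<lambda>x. c * f x) | f. f \<in> schwartz_space}"
  then show "rapid h"
    by (auto intro!: rapid_mult_growth[where K = "norm c" and M = 0, OF schwartz_rapid] simp: norm_mult)
next
  show "(\<lambda>x. c * f x) \<in> {(\<lambda>x. c * f x) | f. f \<in> schwartz_space}"
    by (intro CollectI exI[of _ f] conjI refl assms)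
qed (auto intro: differentiable_mult[OF differentiable_const schwartz_differentiable])

lemma schwartz_uminus: "f \<in> schwartz_space \<Longrightarrow> (\<lambda>x. - f x) \<in> schwartz_space"
  using schwartz_cmult[of f "-1"] by simp

lemma schwartz_diff:
  "f \<in> schwartz_space \<Longrightarrow> g \<in> schwartz_space \<Longrightarrow> (\<lambda>x. f x - g x) \<in> schwartz_space"
  using schwartz_add[OF _ schwartz_uminus, of f g] by simp

lemma schwartz_zero: "(\<lambda>x::'a::euclidean_space. 0) \<in> schwartz_space"
  by (rule schwartz_coinduct[where S = "{\<lambda>x. 0}"]) (auto simp: rapid_def)

lemma schwartz_sum:
  "(\<And>i. i \<in> I \<Longrightarrow> f i \<in> schwartz_space) \<Longrightarrow> (\<lambda>x. \<Sum>i\<in>I. f i x) \<in> schwartz_space"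
  by (induction I rule: infinite_finite_induct) (auto intro: schwartz_add schwartz_zero)

lemma ddir_expand:
  assumes "f differentiable (at x)"
  shows "ddir v f x = (\<Sum>b\<in>Basis. of_real (v \<bullet> b) * ddir b f x)"
proof -
  interpret linear "frechet_derivative f (at x)"
    using assms by (rule linear_frechet_derivative)
  have "ddir v f x = frechet_derivative f (at x) (\<Sum>b\<in>Basis. (v \<bullet> b) *\<^sub>R b)"
    by (simp add: euclidean_representation)
  also have "\<dots> = (\<Sum>b\<in>Basis. of_real (v \<bullet> b) * ddir b f x)"
    by (simp add: sum scaleR scaleR_conv_of_real)
  finally show ?thesis .
qed

lemma schwartz_ddir:
  assumes "f \<in> schwartz_space"
  shows "ddir v f \<in> schwartz_space"
  unfolding ddir_expand[OF schwartz_differentiable[OF assms], of _ v]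
  by (intro schwartz_sum schwartz_cmult schwartz_ddir_Basis assms)

lemma ddir_mult_linear:
  assumes "f \<in> schwartz_space" "linear (l :: 'a::euclidean_space \<Rightarrow> real)"
  shows "ddir b (\<lambda>x. of_real (l x) * f x) = (\<lambda>x. of_real (l b) * f x + of_real (l x) * ddir b f x)"
proof -
  have "bounded_linear l" using assms(2) linear_conv_bounded_linear by blast
  then have "((\<lambda>x. of_real (l x) * f x) has_derivative (\<lambda>v. of_real (l x) * ddir v f x + of_real (l v) * f x)) (at x)" for x
    by (intro has_derivative_mult has_derivative_of_real bounded_linear_imp_has_derivative
        schwartz_has_derivative assms(1))
  from ddir_eq[OF this] show ?thesis by (simp add: fun_eq_iff)
qed

lemma schwartz_mult_linear:
  assumes f: "f \<in> schwartz_space" and l: "linear (l :: 'a::euclidean_space \<Rightarrow> real)"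
  shows "(\<lambda>x. of_real (l x) * f x) \<in> schwartz_space"
proof -
  \<comment> \<open>Products with \<open>l\<close> alone are not closed under differentiation: the
    Leibniz term \<open>l b * f\<close> leaves the family, so a free Schwartz summand
    \<open>g\<close> is carried along.\<close>
  let ?S = "{(\<lambda>x. g x + of_real (l x) * f x) | f g. f \<in> schwartz_space \<and> g \<in> schwartz_space}"
  have bl: "bounded_linear l" using l linear_conv_bounded_linear by blast
  then obtain K where K: "\<And>x. \<bar>l x\<bar> \<le> norm x * K" using bounded_linear.bounded by fastforce
  have diff: "(\<lambda>x. of_real (l x) * f x) differentiable (at x)" if "f \<in> schwartz_space" for f :: "'a \<Rightarrow> complex" and x
    using that bl
    by (intro differentiable_mult differentiable_compose[of complex_of_real l] bounded_linear_imp_differentiable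
        schwartz_differentiable) (auto intro: bounded_linear_imp_differentiable bounded_linear_of_real)
  have rap: "rapid (\<lambda>x. of_real (l x) * f x)" if "f \<in> schwartz_space" for f
  proof (rule rapid_mult_growth[OF schwartz_rapid[OF that], where K="\<bar>K\<bar>" and M=1])
    fix x
    have "\<bar>l x\<bar> \<le> \<bar>K\<bar> * (1 + norm x)"
      using K[of x] by (smt (verit) mult.commute mult_left_mono norm_ge_zero)
    then show "norm (of_real (l x) * f x) \<le> \<bar>K\<bar> * (1 + norm x) ^ 1 * norm (f x)"
      by (simp add: norm_mult mult_right_mono)
  qed
  show ?thesis
  proof (rule schwartz_coinduct[where S = ?S])
    fix h b assume h: "h \<in> ?S" and b: "b \<in> (Basis :: 'a set)"
    then obtain f g where h': "h = (\<lambda>x. g x + of_real (l x) * f x)" "f \<in> schwartz_space" "g \<in> schwartz_space" by blast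
    have "ddir b h x = ddir b g x + ddir b (\<lambda>x. of_real (l x) * f x) x" for x
      unfolding h'(1)
      by (intro ddir_eq has_derivative_add schwartz_has_derivative h'(3)
          frechet_derivative_works[THEN iffD1] diff h'(2))
    then have "ddir b h = (\<lambda>x. (ddir b g x + of_real (l b) * f x) + of_real (l x) * ddir b f x)"
      by (simp add: fun_cong[OF ddir_mult_linear[OF h'(2) l]] fun_eq_iff add.assoc)
    then show "ddir b h \<in> ?S"
      by (intro CollectI exI[of _ "ddir b f"] exI[of _ "\<lambda>x. ddir b g x + of_real (l b) * f x"] conjI
          schwartz_ddir_Basis schwartz_add schwartz_cmult h' b)
  next
    show "(\<lambda>x. of_real (l x) * f x) \<in> ?S"
      by (intro CollectI exI[of _ f] exI[of _ "\<lambda>x. 0"] conjI schwartz_zero f) simp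
  qed (auto intro: rapid_add[OF schwartz_rapid rap] differentiable_add[OF schwartz_differentiable diff])
qed

lemma ddir_affine:
  assumes "f \<in> schwartz_space" "linear M"
  shows "ddir v (\<lambda>x. f (a + M x)) x = ddir (M v) f (a + M x)"
proof -
  have "bounded_linear M" using assms(2) linear_conv_bounded_linear by blast
  then have "((\<lambda>x. a + M x) has_derivative M) (at x)"
    by (auto intro!: derivative_eq_intros bounded_linear_imp_has_derivative)
  from has_derivative_compose[OF this schwartz_has_derivative[OF assms(1)]]
  show ?thesis by (rule ddir_eq)
qed

text \<open>The bound on \<open>norm y\<close> forces \<open>a + M y\<close> to grow at least
  linearly with \<open>y\<close>, which carries the decay of \<open>f\<close> over to the
  composition.\<close>

lemma schwartz_affine:
  fixes M :: "'a::euclidean_space \<Rightarrow> 'b::euclidean_space"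
  assumes f: "f \<in> schwartz_space" and M: "linear M"
    and K: "\<And>y. norm y \<le> K * (1 + norm (a + M y))"
  shows "(\<lambda>x. f (a + M x)) \<in> schwartz_space"
proof -
  let ?S = "{(\<lambda>x. f (a + M x)) | f. f \<in> schwartz_space}"
  have bl: "bounded_linear M" using M linear_conv_bounded_linear by blast
  show ?thesis
  proof (rule schwartz_coinduct[where S = ?S])
    fix h b assume h: "h \<in> ?S" and b: "b \<in> (Basis :: 'a set)"
    then obtain f where h': "h = (\<lambda>x. f (a + M x))" "f \<in> schwartz_space" by blast
    have "ddir b h = (\<lambda>x. ddir (M b) f (a + M x))"
      unfolding h' by (intro ext ddir_affine h' M)
    then show "ddir b h \<in> ?S"
      by (intro CollectI exI[of _ "ddir (M b) f"] conjI schwartz_ddir h')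
  next
    fix h x assume "h \<in> ?S"
    then show "h differentiable (at x)"
      by (auto intro!: differentiable_compose[OF schwartz_differentiable, of _ "\<lambda>x. a + M x"]
         differentiable_add[OF differentiable_const bounded_linear_imp_differentiable[OF bl]])
  next
    fix h assume "h \<in> ?S"
    then obtain f where h': "h = (\<lambda>x. f (a + M x))" "f \<in> schwartz_space" by blast
    show "rapid h" unfolding rapid_def
    proof
      fix N
      obtain C where C: "\<forall>x. (1 + norm x) ^ N * norm (f x) \<le> C"
        using schwartz_rapid[OF h'(2)] unfolding rapid_def by metis
      have "(1 + norm x) ^ N * norm (h x) \<le> (1 + \<bar>K\<bar>) ^ N * C" for x
      proof -
        have "norm x \<le> \<bar>K\<bar> * (1 + norm (a + M x))"
          using K[of x] by (smt (verit) mult_right_mono norm_ge_zero)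
        moreover have "(1 + \<bar>K\<bar>) * (1 + norm (a + M x)) = \<bar>K\<bar> * (1 + norm (a + M x)) + 1 + norm (a + M x)"
          by (simp add: algebra_simps)
        ultimately have "1 + norm x \<le> (1 + \<bar>K\<bar>) * (1 + norm (a + M x))"
          using norm_ge_zero[of "a + M x"] by linarith
        then have "(1 + norm x) ^ N \<le> (1 + \<bar>K\<bar>) ^ N * (1 + norm (a + M x)) ^ N"
          unfolding power_mult_distrib[symmetric] by (intro power_mono) auto
        then have "(1 + norm x) ^ N * norm (h x) \<le> (1 + \<bar>K\<bar>) ^ N * (1 + norm (a + M x)) ^ N * norm (f (a + M x))"
          unfolding h'(1) by (intro mult_right_mono) auto
        also have "\<dots> = (1 + \<bar>K\<bar>) ^ N * ((1 + norm (a + M x)) ^ N * norm (f (a + M x)))" by simp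
        also have "\<dots> \<le> (1 + \<bar>K\<bar>) ^ N * C" using C by (intro mult_left_mono) auto
        finally show ?thesis .
      qed
      then show "\<exists>C. \<forall>x. (1 + norm x) ^ N * norm (h x) \<le> C" by blast
    qed
  next
    show "(\<lambda>x. f (a + M x)) \<in> ?S"
      by (intro CollectI exI[of _ f] conjI refl f)
  qed
qed

lemma schwartz_continuous: "f \<in> schwartz_space \<Longrightarrow> continuous_on A f"
  by (meson continuous_at_imp_continuous_on differentiable_imp_continuous_within schwartz_differentiable)

lemma schwartz_measurable: "f \<in> schwartz_space \<Longrightarrow> f \<in> borel_measurable borel"
  by (intro borel_measurable_continuous_onI schwartz_continuous)

section \<open>Continuous operators on the Schwartz space\<close>

text \<open>The dominating sum of \<open>tempered_distribution\<close>, with one index for both the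
  weight and the order of differentiation. The family is increasing in \<open>N\<close>, so finitely
  many bounds merge into one.\<close>

definition schwartz_norm :: "nat \<Rightarrow> ('a::euclidean_space \<Rightarrow> complex) \<Rightarrow> real" where
  "schwartz_norm N f = (\<Sum>bs \<in> {bs \<in> lists Basis. length bs \<le> N}. schwartz_seminorm N bs f)"

lemma finite_lists_Basis: "finite {bs \<in> lists (Basis :: 'a::euclidean_space set). length bs \<le> N}"
  using finite_lists_length_le[OF finite_Basis, of N] by (simp add: lists_eq_set)

lemma schwartz_seminorm_nonneg:
  assumes "f \<in> schwartz_space" "bs \<in> lists Basis"
  shows "0 \<le> schwartz_seminorm N bs f"
  using schwartz_seminorm_bound[OF assms, of 0 N] by (smt (verit) norm_ge_zero mult_nonneg_nonneg zero_le_power)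

lemma schwartz_seminorm_least:
  "(\<And>x. (1 + norm x) ^ N * norm (pderivs bs f x) \<le> C) \<Longrightarrow> schwartz_seminorm N bs f \<le> C"
  unfolding schwartz_seminorm_def by (rule cSUP_least) auto

lemma schwartz_seminorm_mono:
  assumes "f \<in> schwartz_space" "bs \<in> lists Basis" "N \<le> M"
  shows "schwartz_seminorm N bs f \<le> schwartz_seminorm M bs f"
proof (rule schwartz_seminorm_least)
  fix x
  have "(1 + norm x) ^ N * norm (pderivs bs f x) \<le> (1 + norm x) ^ M * norm (pderivs bs f x)"
    using assms(3) by (intro mult_right_mono power_increasing) auto
  also have "\<dots> \<le> schwartz_seminorm M bs f" using assms by (intro schwartz_seminorm_bound)
  finally show "(1 + norm x) ^ N * norm (pderivs bs f x) \<le> schwartz_seminorm M bs f" .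
qed

lemma schwartz_norm_mono:
  assumes "f \<in> schwartz_space" "N \<le> M"
  shows "schwartz_norm N f \<le> schwartz_norm M f"
proof -
  have "schwartz_norm N f \<le> (\<Sum>bs \<in> {bs \<in> lists Basis. length bs \<le> N}. schwartz_seminorm M bs f)"
    unfolding schwartz_norm_def using assms by (intro sum_mono schwartz_seminorm_mono) auto
  also have "\<dots> \<le> schwartz_norm M f"
    unfolding schwartz_norm_def using assms finite_lists_Basis
    by (intro sum_mono2 schwartz_seminorm_nonneg) auto
  finally show ?thesis .
qed

lemma schwartz_seminorm_le_norm:
  assumes "f \<in> schwartz_space" "bs \<in> lists Basis"
  shows "schwartz_seminorm N bs f \<le> schwartz_norm (max N (length bs)) f"
proof -
  have "schwartz_seminorm N bs f \<le> schwartz_seminorm (max N (length bs)) bs f"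
    using assms by (intro schwartz_seminorm_mono) auto
  also have "\<dots> \<le> schwartz_norm (max N (length bs)) f"
    unfolding schwartz_norm_def using assms
    by (intro member_le_sum schwartz_seminorm_nonneg finite_lists_Basis) auto
  finally show ?thesis .
qed

definition op_bound :: "(('a::euclidean_space \<Rightarrow> complex) \<Rightarrow> 'a \<Rightarrow> complex) \<Rightarrow> nat \<Rightarrow> 'a list \<Rightarrow> real \<Rightarrow> nat \<Rightarrow> bool" where
  "op_bound A N bs C M \<longleftrightarrow> 0 \<le> C \<and>
     (\<forall>f\<in>schwartz_space. schwartz_seminorm N bs (A f) \<le> C * schwartz_norm M f)"

definition cont_op :: "(('a::euclidean_space \<Rightarrow> complex) \<Rightarrow> 'a \<Rightarrow> complex) \<Rightarrow> bool" where
  "cont_op A \<longleftrightarrow> (\<forall>f\<in>schwartz_space. A f \<in> schwartz_space) \<and>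
     (\<forall>N. \<forall>bs\<in>lists Basis. \<exists>C M. op_bound A N bs C M)"

lemma op_boundI:
  assumes "0 \<le> C"
    and "\<And>f x. f \<in> schwartz_space \<Longrightarrow> (1 + norm x) ^ N * norm (pderivs bs (A f) x) \<le> C * schwartz_norm M f"
  shows "op_bound A N bs C M"
  unfolding op_bound_def using assms(1) by (auto intro!: schwartz_seminorm_least assms(2))

lemma op_boundD:
  "op_bound A N bs C M \<Longrightarrow> f \<in> schwartz_space \<Longrightarrow> schwartz_seminorm N bs (A f) \<le> C * schwartz_norm M f"
  by (simp add: op_bound_def)

lemma op_bound_nonneg: "op_bound A N bs C M \<Longrightarrow> 0 \<le> C"
  by (simp add: op_bound_def)

lemma cont_opI:
  assumes "\<And>f. f \<in> schwartz_space \<Longrightarrow> A f \<in> schwartz_space"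
    and "\<And>N bs. bs \<in> lists Basis \<Longrightarrow> \<exists>C M. op_bound A N bs C M"
  shows "cont_op A"
  unfolding cont_op_def using assms(1) by (auto intro: assms(2))

lemma cont_opD: "cont_op A \<Longrightarrow> f \<in> schwartz_space \<Longrightarrow> A f \<in> schwartz_space"
  by (simp add: cont_op_def)

lemma cont_op_bound:
  assumes "cont_op A" "bs \<in> lists Basis" obtains C M where "op_bound A N bs C M"
  using assms unfolding cont_op_def by blast

lemma cont_op_norm:
  assumes "cont_op A"
  obtains C M where "0 \<le> C" "\<And>f. f\<in>schwartz_space \<Longrightarrow> schwartz_norm N (A f) \<le> C * schwartz_norm M f"
proof -
  let ?I = "{bs \<in> lists Basis. length bs \<le> N} :: 'a list set"
  have "\<forall>bs\<in>?I. \<exists>p. op_bound A N bs (fst p) (snd p)"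
    using assms unfolding cont_op_def by simp
  from bchoice[OF this] obtain p where p: "\<And>bs. bs \<in> ?I \<Longrightarrow> op_bound A N bs (fst (p bs)) (snd (p bs))"
    by blast
  define C M where "C bs = fst (p bs)" and "M bs = snd (p bs)" for bs
  have CM: "\<And>bs. bs \<in> ?I \<Longrightarrow> op_bound A N bs (C bs) (M bs)"
    unfolding C_def M_def by (rule p)
  have fin: "finite ?I" by (rule finite_lists_Basis)
  \<comment> \<open>Summing the orders \<open>M bs\<close> gives one index above all of
    them.\<close>
  have "schwartz_norm N (A f) \<le> (\<Sum>bs\<in>?I. C bs) * schwartz_norm (\<Sum>bs\<in>?I. M bs) f" if f: "f \<in> schwartz_space" for f
    unfolding sum_distrib_right schwartz_norm_def[of N]
  proof (rule sum_mono)
    fix bs assume bs: "bs \<in> ?I"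
    have "schwartz_seminorm N bs (A f) \<le> C bs * schwartz_norm (M bs) f"
      by (rule op_boundD[OF CM[OF bs] f])
    also have "\<dots> \<le> C bs * schwartz_norm (\<Sum>bs\<in>?I. M bs) f"
      by (intro mult_left_mono schwartz_norm_mono f op_bound_nonneg[OF CM[OF bs]] member_le_sum[OF bs _ fin]) simp
    finally show "schwartz_seminorm N bs (A f) \<le> C bs * schwartz_norm (\<Sum>bs\<in>?I. M bs) f" .
  qed
  moreover have "0 \<le> (\<Sum>bs\<in>?I. C bs)"
    by (rule sum_nonneg) (rule op_bound_nonneg[OF CM])
  ultimately show ?thesis using that by blast
qed

lemma cont_op_id: "cont_op (\<lambda>f. f)"
proof (rule cont_opI)
  fix N and bs :: "'a list" assume "bs \<in> lists Basis"
  then have "op_bound (\<lambda>f. f) N bs 1 (max N (length bs))"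
    unfolding op_bound_def by (simp del: in_lists_conv_set add: schwartz_seminorm_le_norm)
  then show "\<exists>C M. op_bound (\<lambda>f. f) N bs C M" by blast
qed

lemma cont_op_comp:
  assumes A: "cont_op A" and B: "cont_op B"
  shows "cont_op (\<lambda>f. A (B f))"
proof (rule cont_opI)
  fix N and bs :: "'a list" assume "bs \<in> lists Basis"
  then obtain C M where C: "op_bound A N bs C M"
    by (rule cont_op_bound[OF A])
  obtain D K where D: "0 \<le> D" "\<And>f. f\<in>schwartz_space \<Longrightarrow> schwartz_norm M (B f) \<le> D * schwartz_norm K f"
    by (rule cont_op_norm[OF B, where N = M]) blast
  have "op_bound (\<lambda>f. A (B f)) N bs (C * D) K"
    unfolding op_bound_def
  proof (intro conjI ballI)
    fix f :: "'a \<Rightarrow> complex" assume f: "f \<in> schwartz_space"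
    have "schwartz_seminorm N bs (A (B f)) \<le> C * schwartz_norm M (B f)"
      by (rule op_boundD[OF C cont_opD[OF B f]])
    also have "\<dots> \<le> C * (D * schwartz_norm K f)"
      by (rule mult_left_mono[OF D(2)[OF f] op_bound_nonneg[OF C]])
    finally show "schwartz_seminorm N bs (A (B f)) \<le> C * D * schwartz_norm K f" by simp
  qed (use op_bound_nonneg[OF C] D in simp)
  then show "\<exists>C M. op_bound (\<lambda>f. A (B f)) N bs C M" by blast
qed (rule cont_opD[OF A cont_opD[OF B]])

lemma pderivs_add:
  assumes "f \<in> schwartz_space" "g \<in> schwartz_space" "bs \<in> lists Basis"
  shows "pderivs bs (\<lambda>x. f x + g x) = (\<lambda>x. pderivs bs f x + pderivs bs g x)"
  using assms(3)
proof (induction bs)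
  case (Cons b bs)
  then have "bs \<in> lists Basis" by auto
  then show ?case
    using Cons.IH
    by (auto simp: fun_eq_iff intro!: ddir_eq has_derivative_add frechet_derivative_works[THEN iffD1]
        pderivs_differentiable assms)
qed auto

lemma pderivs_cmult:
  assumes "f \<in> schwartz_space" "bs \<in> lists Basis"
  shows "pderivs bs (\<lambda>x. c * f x) = (\<lambda>x. c * pderivs bs f x)"
  using assms(2)
proof (induction bs)
  case (Cons b bs)
  then have "bs \<in> lists Basis" by auto
  then show ?case
    using Cons.IH
    by (auto simp: fun_eq_iff intro!: ddir_eq has_derivative_mult_right frechet_derivative_works[THEN iffD1]
        pderivs_differentiable assms)
qed auto

lemma cont_op_add:
  assumes A: "cont_op A" and B: "cont_op B"
  shows "cont_op (\<lambda>f x. A f x + B f x)"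
proof (rule cont_opI)
  fix N and bs :: "'a list" assume bs: "bs \<in> lists Basis"
  obtain C M where C: "op_bound A N bs C M"
    by (rule cont_op_bound[OF A bs])
  obtain D K where D: "op_bound B N bs D K"
    by (rule cont_op_bound[OF B bs])
  note nn = op_bound_nonneg[OF C] op_bound_nonneg[OF D]
  have "op_bound (\<lambda>f x. A f x + B f x) N bs (C + D) (max M K)"
  proof (rule op_boundI)
    fix f :: "'a \<Rightarrow> complex" and x :: 'a assume f: "f \<in> schwartz_space"
    have "(1 + norm x) ^ N * norm (pderivs bs (\<lambda>x. A f x + B f x) x)
       \<le> (1 + norm x) ^ N * norm (pderivs bs (A f) x) + (1 + norm x) ^ N * norm (pderivs bs (B f) x)"
      unfolding distrib_left[symmetric] pderivs_add[OF cont_opD[OF A f] cont_opD[OF B f] bs]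
      by (intro mult_left_mono norm_triangle_ineq) auto
    also have "\<dots> \<le> schwartz_seminorm N bs (A f) + schwartz_seminorm N bs (B f)"
      by (intro add_mono schwartz_seminorm_bound cont_opD[OF A f] cont_opD[OF B f] bs)
    also have "\<dots> \<le> C * schwartz_norm M f + D * schwartz_norm K f"
      by (intro add_mono op_boundD[OF C] op_boundD[OF D] f)
    also have "\<dots> \<le> C * schwartz_norm (max M K) f + D * schwartz_norm (max M K) f"
      using nn f by (intro add_mono mult_left_mono schwartz_norm_mono) auto
    finally show "(1 + norm x) ^ N * norm (pderivs bs (\<lambda>x. A f x + B f x) x) \<le> (C + D) * schwartz_norm (max M K) f"
      by (simp add: algebra_simps)
  qed (use nn in simp)
  then show "\<exists>C M. op_bound (\<lambda>f x. A f x + B f x) N bs C M" by blast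
qed (intro schwartz_add cont_opD[OF A] cont_opD[OF B])

lemma cont_op_cmult:
  shows "cont_op (\<lambda>f x. c * f x)"
proof (rule cont_opI)
  fix N and bs :: "'a list" assume bs: "bs \<in> lists Basis"
  have "op_bound (\<lambda>f x. c * f x) N bs (norm c) (max N (length bs))"
  proof (rule op_boundI)
    fix f :: "'a \<Rightarrow> complex" and x :: 'a assume f: "f \<in> schwartz_space"
    have "(1 + norm x) ^ N * norm (pderivs bs (\<lambda>x. c * f x) x)
       = norm c * ((1 + norm x) ^ N * norm (pderivs bs f x))"
      unfolding pderivs_cmult[OF f bs] by (simp add: norm_mult)
    also have "\<dots> \<le> norm c * schwartz_norm (max N (length bs)) f"
      by (intro mult_left_mono order_trans[OF schwartz_seminorm_bound schwartz_seminorm_le_norm] f bs) auto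
    finally show "(1 + norm x) ^ N * norm (pderivs bs (\<lambda>x. c * f x) x) \<le> norm c * schwartz_norm (max N (length bs)) f" .
  qed simp
  then show "\<exists>C M. op_bound (\<lambda>f x. c * f x) N bs C M" by blast
qed (rule schwartz_cmult)

lemma cont_op_zero: "cont_op (\<lambda>f x. 0)"
  using cont_op_cmult[of 0] by simp

lemma cont_op_sum:
  "(\<And>i. i \<in> I \<Longrightarrow> cont_op (A i)) \<Longrightarrow> cont_op (\<lambda>f x. \<Sum>i\<in>I. A i f x)"
  by (induction I rule: infinite_finite_induct) (auto intro: cont_op_add cont_op_zero)

lemma cont_op_cong:
  assumes "cont_op A" "\<And>f. f \<in> schwartz_space \<Longrightarrow> B f = A f"
  shows "cont_op B"
  using assms unfolding cont_op_def op_bound_def by simp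

lemma cont_op_diff:
  assumes "cont_op A" "cont_op B" shows "cont_op (\<lambda>f x. A f x - B f x)"
  using cont_op_add[OF assms(1) cont_op_comp[OF cont_op_cmult[of "-1"] assms(2)]] by simp

lemma cont_op_ddir_Basis:
  assumes "b \<in> Basis" shows "cont_op (ddir b)"
proof (rule cont_opI)
  fix N and bs :: "'a list" assume bs: "bs \<in> lists Basis"
  have "schwartz_seminorm N bs (ddir b f) = schwartz_seminorm N (bs @ [b]) f" for f
    by (simp add: schwartz_seminorm_def pderivs_append)
  moreover have "bs @ [b] \<in> lists Basis" using bs assms by auto
  ultimately have "op_bound (ddir b) N bs 1 (max N (length (bs @ [b])))"
    unfolding op_bound_def by (simp del: in_lists_conv_set length_append add: schwartz_seminorm_le_norm)
  then show "\<exists>C M. op_bound (ddir b) N bs C M" by blast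
qed (rule schwartz_ddir_Basis[OF _ assms])

lemma cont_op_ddir: "cont_op (ddir v)"
  by (rule cont_op_cong[where A = "\<lambda>f x. \<Sum>b\<in>Basis. of_real (v \<bullet> b) * ddir b f x"])
    (auto intro!: cont_op_sum cont_op_comp[OF cont_op_cmult] cont_op_ddir_Basis
      simp: fun_eq_iff ddir_expand[OF schwartz_differentiable, of _ _ v])

lemma cont_op_mult_linear:
  assumes l: "linear (l :: 'a::euclidean_space \<Rightarrow> real)"
  shows "cont_op (\<lambda>f x. of_real (l x) * f x)"
proof (rule cont_opI)
  fix N and bs :: "'a list" assume bs: "bs \<in> lists Basis"
  let ?A = "\<lambda>(f :: 'a \<Rightarrow> complex) x. of_real (l x) * f x"
  from bs show "\<exists>C M. op_bound ?A N bs C M"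
  \<comment> \<open>\<open>pderivs\<close> applies the last list entry first, so peeling from the
    end exposes the derivative that falls directly on the product, where the Leibniz rule
    applies.\<close>
  proof (induction bs rule: rev_induct)
    case Nil
    have "bounded_linear l" using l linear_conv_bounded_linear by blast
    then obtain K where K: "\<And>x. \<bar>l x\<bar> \<le> norm x * K" "0 < K"
      using bounded_linear.pos_bounded by fastforce
    have "op_bound ?A N [] K (N + 1)"
    proof (rule op_boundI)
      fix f :: "'a \<Rightarrow> complex" and x :: 'a assume f: "f \<in> schwartz_space"
      have "\<bar>l x\<bar> \<le> K * (1 + norm x)"
        using K(1)[of x] K(2) by (smt (verit) mult.commute mult_left_mono norm_ge_zero)
      then have "(1 + norm x) ^ N * norm (pderivs [] (\<lambda>x. of_real (l x) * f x) x)
         \<le> (1 + norm x) ^ N * ((K * (1 + norm x)) * norm (f x))"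
        unfolding pderivs.simps norm_mult norm_of_real
        by (intro mult_left_mono mult_right_mono) auto
      also have "\<dots> = K * ((1 + norm x) ^ (N + 1) * norm (pderivs [] f x))" by simp
      also have "\<dots> \<le> K * schwartz_norm (max (N + 1) (length ([]::'a list))) f"
        using K(2) by (intro mult_left_mono order_trans[OF schwartz_seminorm_bound schwartz_seminorm_le_norm] f) auto
      finally show "(1 + norm x) ^ N * norm (pderivs [] (\<lambda>x. of_real (l x) * f x) x) \<le> K * schwartz_norm (N + 1) f"
        by simp
    qed (use K(2) in simp)
    then show ?case by blast
  next
    case (snoc b bs)
    then have bs: "bs \<in> lists Basis" and b: "b \<in> Basis" by auto
    obtain C M where C: "op_bound ?A N bs C M"
      using snoc.IH[OF bs] by blast
    obtain D K where D: "0 \<le> D" "\<And>f. f\<in>schwartz_space \<Longrightarrow> schwartz_norm M (ddir b f) \<le> D * schwartz_norm K f"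
      by (rule cont_op_norm[OF cont_op_ddir, where N = M]) blast
    obtain D' K' where D': "op_bound (\<lambda>f x. of_real (l b) * f x) N bs D' K'"
      by (rule cont_op_bound[OF cont_op_cmult bs])
    note nn = op_bound_nonneg[OF C] D(1) op_bound_nonneg[OF D']
    have "op_bound ?A N (bs @ [b]) (C * D + D') (max K K')"
    proof (rule op_boundI)
      fix f :: "'a \<Rightarrow> complex" and x :: 'a assume f: "f \<in> schwartz_space"
      have S: "(\<lambda>x. of_real (l b) * f x) \<in> schwartz_space" "(\<lambda>x. of_real (l x) * ddir b f x) \<in> schwartz_space"
        by (intro schwartz_cmult schwartz_mult_linear schwartz_ddir f l)+
      have "(1 + norm x) ^ N * norm (pderivs (bs @ [b]) (\<lambda>x. of_real (l x) * f x) x)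
       \<le> (1 + norm x) ^ N * norm (pderivs bs (\<lambda>x. of_real (l b) * f x) x) + (1 + norm x) ^ N * norm (pderivs bs (\<lambda>x. of_real (l x) * ddir b f x) x)"
        unfolding distrib_left[symmetric] pderivs_append pderivs.simps ddir_mult_linear[OF f l] pderivs_add[OF S bs]
        by (intro mult_left_mono norm_triangle_ineq) auto
      also have "\<dots> \<le> schwartz_seminorm N bs (\<lambda>x. of_real (l b) * f x) + schwartz_seminorm N bs (\<lambda>x. of_real (l x) * ddir b f x)"
        by (intro add_mono schwartz_seminorm_bound S bs)
      also have "\<dots> \<le> D' * schwartz_norm K' f + C * (D * schwartz_norm K f)"
        using nn by (intro add_mono op_boundD[OF D' f] order_trans[OF op_boundD[OF C schwartz_ddir[OF f]]] mult_left_mono D f)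
      also have "\<dots> \<le> D' * schwartz_norm (max K K') f + C * (D * schwartz_norm (max K K') f)"
        using nn by (intro add_mono mult_left_mono schwartz_norm_mono f) auto
      finally show "(1 + norm x) ^ N * norm (pderivs (bs @ [b]) (\<lambda>x. of_real (l x) * f x) x) \<le> (C * D + D') * schwartz_norm (max K K') f"
        by (simp add: algebra_simps)
    qed (use nn in simp)
    then show ?case by blast
  qed
qed (rule schwartz_mult_linear[OF _ l])

lemma cont_op_funpow: "cont_op A \<Longrightarrow> cont_op (A ^^ n)"
proof (induction n)
  case 0 then show ?case using cont_op_id by (simp add: id_def)
next
  case (Suc n) then show ?case using cont_op_comp[of A "A ^^ n"] by (simp add: o_def)
qed

section \<open>Integrability\<close>

text \<open>Cover the space by the balls of radius \<open>1 + k\<close>: where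
  \<open>k \<le> norm x < 1 + k\<close> the integrand is at most
  \<open>1 / (1 + k) ^ (n + 2)\<close>, and the ball has volume proportional to
  \<open>(1 + k) ^ n\<close>. What remains is a sum of inverse squares.\<close>

lemma integrable_inverse_power_norm:
  "integrable lborel (\<lambda>x::'a::euclidean_space. 1 / (1 + norm x) ^ (DIM('a) + 2))"
proof (rule integrableI_nonneg)
  let ?n = "DIM('a)"
  let ?V = "unit_ball_vol ?n"
  have meas: "(\<lambda>x::'a. 1 / (1 + norm x) ^ (?n + 2)) \<in> borel_measurable lborel"
    by measurable
  have "(\<integral>\<^sup>+(x::'a). ennreal (1 / (1 + norm x) ^ (?n + 2)) \<partial>lborel)
     \<le> (\<integral>\<^sup>+(x::'a). (\<Sum>k. ennreal (1 / (1 + real k) ^ (?n + 2)) * indicator (ball 0 (1 + real k)) x) \<partial>lborel)"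
  proof (rule nn_integral_mono)
    fix x :: 'a
    define k where "k = nat \<lfloor>norm x\<rfloor>"
    have "real k = of_int \<lfloor>norm x\<rfloor>" by (simp add: k_def)
    then have k: "real k \<le> norm x" "norm x < 1 + real k" by linarith+
    have "ennreal (1 / (1 + norm x) ^ (?n + 2)) \<le> ennreal (1 / (1 + real k) ^ (?n + 2)) * indicator (ball 0 (1 + real k)) x"
      using k by (auto simp: indicator_def simp del: power_add power_Suc power_Suc2 add_2_eq_Suc' intro!: ennreal_leI divide_left_mono power_mono mult_pos_pos zero_less_power)
    also have "\<dots> \<le> (\<Sum>k. ennreal (1 / (1 + real k) ^ (?n + 2)) * indicator (ball 0 (1 + real k)) x)"
      using sum_le_suminf[of F "{k}" for F :: "nat \<Rightarrow> ennreal"] by fastforce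
    finally show "ennreal (1 / (1 + norm x) ^ (?n + 2)) \<le> (\<Sum>k. ennreal (1 / (1 + real k) ^ (?n + 2)) * indicator (ball 0 (1 + real k)) x)" .
  qed
  also have "\<dots> = (\<Sum>k. \<integral>\<^sup>+(x::'a). ennreal (1 / (1 + real k) ^ (?n + 2)) * indicator (ball 0 (1 + real k)) x \<partial>lborel)"
    by (intro nn_integral_suminf borel_measurable_times_ennreal borel_measurable_const borel_measurable_indicator) auto
  also have "\<dots> = (\<Sum>k. ennreal (?V * (1 / (1 + real k) ^ 2)))"
  proof (intro suminf_cong)
    fix k
    have "(\<integral>\<^sup>+(x::'a). ennreal (1 / (1 + real k) ^ (?n + 2)) * indicator (ball 0 (1 + real k)) x \<partial>lborel)
        = ennreal (1 / (1 + real k) ^ (?n + 2)) * ennreal (?V * (1 + real k) ^ ?n)"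
      by (subst nn_integral_cmult_indicator) (auto simp: emeasure_ball)
    also have "\<dots> = ennreal (?V * (1 / (1 + real k) ^ 2))"
      by (subst ennreal_mult[symmetric]) (auto simp: power_add simp del: power_Suc add_2_eq_Suc')
    finally show "(\<integral>\<^sup>+(x::'a). ennreal (1 / (1 + real k) ^ (?n + 2)) * indicator (ball 0 (1 + real k)) x \<partial>lborel) = ennreal (?V * (1 / (1 + real k) ^ 2))" .
  qed
  also have "\<dots> < \<infinity>"
  proof -
    have "summable (\<lambda>k. 1 / (1 + real k) ^ 2)"
      using inverse_power_summable[of 2, where 'a = real] summable_Suc_iff[of "\<lambda>n. inverse (real n ^ 2)"]
      by (simp add: field_simps)
    then have "summable (\<lambda>k. ?V * (1 / (1 + real k) ^ 2))" by (rule summable_mult)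
    then show ?thesis by (subst suminf_ennreal2) auto
  qed
  finally show "(\<integral>\<^sup>+(x::'a). ennreal (1 / (1 + norm x) ^ (?n + 2)) \<partial>lborel) < \<infinity>" .
  show "AE x in lborel. 0 \<le> 1 / (1 + norm (x::'a)) ^ (?n + 2)" by simp
qed (measurable)

lemma schwartz_pointwise:
  assumes "f \<in> schwartz_space"
  shows "norm (f x) \<le> schwartz_seminorm N [] f * (1 / (1 + norm x) ^ N)"
proof -
  have "1 + norm x > 0" by (smt (verit) norm_ge_zero)
  then show ?thesis
    using schwartz_seminorm_bound[OF assms, of "[]" x N] by (simp add: pos_le_divide_eq mult.commute)
qed

lemma schwartz_integrable:
  fixes f :: "'a::euclidean_space \<Rightarrow> complex"
  assumes "f \<in> schwartz_space" shows "integrable lborel f"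
proof (rule Bochner_Integration.integrable_bound)
  show "integrable lborel (\<lambda>x::'a. schwartz_seminorm (DIM('a) + 2) [] f * (1 / (1 + norm x) ^ (DIM('a) + 2)))"
    by (intro integrable_mult_right integrable_inverse_power_norm)
  show "f \<in> borel_measurable lborel" using schwartz_measurable[OF assms] by simp
  show "AE x in lborel. norm (f x) \<le> norm (schwartz_seminorm (DIM('a) + 2) [] f * (1 / (1 + norm x) ^ (DIM('a) + 2)))"
    by (intro always_eventually allI order_trans[OF schwartz_pointwise[OF assms, of _ "DIM('a) + 2"]]) (simp only: real_norm_def abs_ge_self)
qed

definition L1 :: "('a::euclidean_space \<Rightarrow> complex) \<Rightarrow> real" where
  "L1 f = (LINT x|lborel. norm (f x))"

lemma L1_nonneg: "0 \<le> L1 f" unfolding L1_def by simp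

text \<open>The supremum with weight \<open>DIM('a) + 2\<close> controls the L1 norm, since the
  reciprocal weight is integrable.\<close>

lemma cont_op_L1:
  fixes A :: "('a::euclidean_space \<Rightarrow> complex) \<Rightarrow> 'a \<Rightarrow> complex"
  assumes "cont_op A"
  obtains C M where "0 \<le> C" "\<And>f. f \<in> schwartz_space \<Longrightarrow> L1 (A f) \<le> C * schwartz_norm M f"
proof -
  let ?N = "DIM('a) + 2"
  define K where "K = (LINT x::'a|lborel. 1 / (1 + norm x) ^ ?N)"
  have K: "0 \<le> K" unfolding K_def by (rule integral_nonneg_AE) simp
  obtain C M where C: "op_bound A ?N [] C M"
    by (rule cont_op_bound[OF assms lists.Nil])
  have "L1 (A f) \<le> (K * C) * schwartz_norm M f" if f: "f \<in> schwartz_space" for f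
  proof -
    note Af = cont_opD[OF assms f]
    have "L1 (A f) \<le> (LINT x::'a|lborel. schwartz_seminorm ?N [] (A f) * (1 / (1 + norm x) ^ ?N))"
      unfolding L1_def
      by (rule Bochner_Integration.integral_mono[OF integrable_norm[OF schwartz_integrable[OF Af]]
         integrable_mult_right[OF integrable_inverse_power_norm] schwartz_pointwise[OF Af]])
    also have "\<dots> = K * schwartz_seminorm ?N [] (A f)" unfolding K_def by (simp only: integral_mult_right_zero mult.commute)
    also have "\<dots> \<le> K * (C * schwartz_norm M f)" by (rule mult_left_mono[OF op_boundD[OF C f] K])
    finally show ?thesis by simp
  qed
  then show ?thesis using that[of "K * C" M] op_bound_nonneg[OF C] K by simp
qed

lemma L1_triangle:
  "f \<in> schwartz_space \<Longrightarrow> g \<in> schwartz_space \<Longrightarrow> L1 (\<lambda>x. f x + g x) \<le> L1 f + L1 g"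
  unfolding L1_def
  by (subst Bochner_Integration.integral_add[symmetric])
    (auto intro!: Bochner_Integration.integral_mono integrable_norm schwartz_integrable schwartz_add norm_triangle_ineq)

lemma L1_cmult: "L1 (\<lambda>x. c * f x) = norm c * L1 f"
  unfolding L1_def by (simp add: norm_mult)

lemma L1_zero: "L1 (\<lambda>x. 0) = 0" unfolding L1_def by simp

lemma L1_sum:
  "(\<And>i. i \<in> I \<Longrightarrow> f i \<in> schwartz_space) \<Longrightarrow> L1 (\<lambda>x. \<Sum>i\<in>I. f i x) \<le> (\<Sum>i\<in>I. L1 (f i))"
proof (induction I rule: infinite_finite_induct)
  case (insert i I)
  then have "L1 (\<lambda>x. f i x + (\<Sum>i\<in>I. f i x)) \<le> L1 (f i) + L1 (\<lambda>x. \<Sum>i\<in>I. f i x)"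
    by (intro L1_triangle schwartz_sum) auto
  then show ?case using insert by auto
qed (auto simp: L1_zero)

section \<open>The group\<close>

lemma sum_UNIV_Plus:
  "(\<Sum>j\<in>UNIV. f j) = (\<Sum>j\<in>UNIV. f (Inl j)) + (\<Sum>j\<in>UNIV. f (Inr j))"
  for f :: "'p::finite + 'q::finite \<Rightarrow> 'a::comm_monoid_add"
  using sum.Plus[of "UNIV :: 'p set" "UNIV :: 'q set" f] by simp

text \<open>The symplectic form that twists the group law. It is bilinear over the reals only, and
  \<open>om_self\<close> is what makes the lines through 0 one-parameter subgroups.\<close>

definition om :: "complex ^ ('p::finite + 'q::finite) \<Rightarrow> complex ^ ('p + 'q) \<Rightarrow> real" where
  "om v w = Im (herm_form v w)"

lemma om_eq: "om v w = (\<Sum>j\<in>UNIV. eps j * (Im (v $ j) * Re (w $ j) - Re (v $ j) * Im (w $ j)))"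
  unfolding om_def herm_form_def sum_UNIV_Plus
  by (simp add: sum_negf sum_subtractf algebra_simps)

lemma om_add_left: "om (v + v') w = om v w + om v' w"
  unfolding om_eq by (simp add: algebra_simps sum.distrib sum_subtractf)

lemma om_add_right: "om v (w + w') = om v w + om v w'"
  unfolding om_eq by (simp add: algebra_simps sum.distrib sum_subtractf)

lemma om_scaleR_left: "om (s *\<^sub>R v) w = s * om v w"
  unfolding om_eq by (simp add: algebra_simps sum_distrib_left)

lemma om_scaleR_right: "om v (s *\<^sub>R w) = s * om v w"
  unfolding om_eq by (simp add: algebra_simps sum_distrib_left)

lemma om_skew: "om v w = - om w v"
  unfolding om_eq by (simp add: algebra_simps sum_negf flip: sum_negf)

lemma om_self: "om v v = 0"
  using om_skew[of v v] by simp

lemma om_minus_left: "om (- v) w = - om v w"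
  using om_scaleR_left[of "-1" v w] by simp

lemma om_minus_right: "om v (- w) = - om v w"
  using om_scaleR_right[of v "-1" w] by simp

lemma om_zero_left: "om 0 w = 0"
  using om_scaleR_left[of 0 0 w] by simp

lemma om_zero_right: "om v 0 = 0"
  using om_scaleR_right[of v 0 0] by simp

lemmas om_simps = om_add_left om_add_right om_scaleR_left om_scaleR_right om_minus_left om_minus_right
  om_self om_zero_left om_zero_right

lemma linear_om_left: "linear (\<lambda>v. om v w)"
  by (rule linearI) (simp_all add: om_simps)

lemma linear_om_right: "linear (\<lambda>w. om v w)"
  by (rule linearI) (simp_all add: om_simps)

lemma om_axis_right: "om v (axis j (complex_of_real r)) = eps j * Im (v $ j) * r"
proof -
  have "om v (axis j (complex_of_real r)) = (\<Sum>i\<in>UNIV. if i = j then eps j * Im (v $ j) * r else 0)"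
    unfolding om_eq by (intro sum.cong) (auto simp: axis_def)
  then show ?thesis by simp
qed

lemma om_axis_i_right: "om v (axis j \<i>) = - eps j * Re (v $ j)"
proof -
  have "om v (axis j \<i>) = (\<Sum>i\<in>UNIV. if i = j then - eps j * Re (v $ j) else 0)"
    unfolding om_eq by (intro sum.cong) (auto simp: axis_def)
  then show ?thesis by simp
qed

lemma heis_mult_eq: "heis_mult g g' = (fst g + fst g', snd g + snd g' - om (fst g) (fst g') / 2)"
  by (simp add: heis_mult_def om_def)

lemma heis_inv_eq: "heis_inv = uminus"
  by (simp add: heis_inv_def fun_eq_iff uminus_prod_def)

lemma heis_mult_assoc: "heis_mult (heis_mult x y) z = heis_mult x (heis_mult y z)"
  by (simp add: heis_mult_eq om_simps field_simps)

lemma heis_mult_0_left [simp]: "heis_mult 0 g = g"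
  by (simp add: heis_mult_eq om_simps)

lemma heis_mult_0_right [simp]: "heis_mult g 0 = g"
  by (simp add: heis_mult_eq om_simps)

lemma heis_mult_minus [simp]: "heis_mult g (- g) = 0" "heis_mult (- g) g = 0"
  by (auto simp: heis_mult_eq om_simps prod_eq_iff)

lemma minus_heis_mult: "- heis_mult x y = heis_mult (- y) (- x)"
  using om_skew[of "fst x" "fst y"] by (simp add: heis_mult_eq om_simps prod_eq_iff)

lemma heis_mult_scaleR_scaleR: "heis_mult (s *\<^sub>R u) (s' *\<^sub>R u) = (s + s') *\<^sub>R u"
  by (simp add: heis_mult_eq om_simps prod_eq_iff algebra_simps)

text \<open>The one-parameter subgroups are the lines \<open>s u\<close>, and the curves \<open>g (s u)\<close> and \<open>(s u) g\<close>
  are straight lines with velocities \<open>ldir u g\<close> and \<open>rdir u g\<close>.\<close>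

definition ldir :: "('p::finite, 'q::finite) heis \<Rightarrow> ('p, 'q) heis \<Rightarrow> ('p, 'q) heis" where
  "ldir u g = (fst u, snd u - om (fst g) (fst u) / 2)"

definition rdir :: "('p::finite, 'q::finite) heis \<Rightarrow> ('p, 'q) heis \<Rightarrow> ('p, 'q) heis" where
  "rdir u g = (fst u, snd u - om (fst u) (fst g) / 2)"

lemma heis_mult_ldir: "heis_mult g (s *\<^sub>R u) = g + s *\<^sub>R ldir u g"
  by (simp add: heis_mult_eq om_simps prod_eq_iff ldir_def algebra_simps)

lemma heis_mult_rdir: "heis_mult (s *\<^sub>R u) g = g + s *\<^sub>R rdir u g"
  by (simp add: heis_mult_eq om_simps prod_eq_iff rdir_def algebra_simps)

text \<open>Differentiation along \<open>g (s u)\<close>, hence invariant under left translations;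
  \<open>rvf\<close> below differentiates along \<open>(s u) g\<close>. X, Y and U are the instances
  \<open>(axis j 1, 0)\<close>, \<open>(axis j \<i>, 0)\<close> and \<open>(0, 1)\<close>.\<close>

definition lvf :: "('p::finite, 'q::finite) heis \<Rightarrow> (('p, 'q) heis \<Rightarrow> complex) \<Rightarrow> ('p, 'q) heis \<Rightarrow> complex" where
  "lvf u f g = frechet_derivative f (at g) (ldir u g)"

definition rvf :: "('p::finite, 'q::finite) heis \<Rightarrow> (('p, 'q) heis \<Rightarrow> complex) \<Rightarrow> ('p, 'q) heis \<Rightarrow> complex" where
  "rvf u f g = frechet_derivative f (at g) (rdir u g)"

lemma frechet_derivative_add_scaleR:
  assumes "f differentiable (at g)"
  shows "frechet_derivative f (at g) (a + s *\<^sub>R b) = frechet_derivative f (at g) a + of_real s * frechet_derivative f (at g) b"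
proof -
  interpret linear "frechet_derivative f (at g)"
    using assms by (rule linear_frechet_derivative)
  show ?thesis by (simp add: add scaleR scaleR_conv_of_real)
qed

lemma lvf_expand:
  assumes "f differentiable (at g)"
  shows "lvf u f g = ddir u f g - of_real (om (fst g) (fst u) / 2) * heis_U f g"
  using frechet_derivative_add_scaleR[OF assms, of u "- om (fst g) (fst u) / 2" "(0, 1)"]
  by (simp add: lvf_def ldir_def heis_U_def scaleR_prod_def plus_prod_def)

lemma rvf_expand:
  assumes "f differentiable (at g)"
  shows "rvf u f g = ddir u f g - of_real (om (fst u) (fst g) / 2) * heis_U f g"
  using frechet_derivative_add_scaleR[OF assms, of u "- om (fst u) (fst g) / 2" "(0, 1)"]
  by (simp add: rvf_def rdir_def heis_U_def scaleR_prod_def plus_prod_def)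

lemma heis_U_lvf: "heis_U f = lvf (0, 1) f"
  by (simp add: heis_U_def lvf_def ldir_def om_simps fun_eq_iff)

lemma heis_X_lvf:
  assumes "f \<in> schwartz_space"
  shows "heis_X j f = lvf (axis j 1, 0) f"
  using om_axis_right[of _ j 1]
  by (simp add: fun_eq_iff heis_X_def lvf_expand[OF schwartz_differentiable[OF assms]])

lemma heis_Y_lvf:
  assumes "f \<in> schwartz_space"
  shows "heis_Y j f = lvf (axis j \<i>, 0) f"
  by (simp add: fun_eq_iff heis_Y_def lvf_expand[OF schwartz_differentiable[OF assms]] om_axis_i_right)

text \<open>Pointwise variant for convolutions, which are smooth but need not be Schwartz
  functions.\<close>

lemma heis_X_differentiable:
  assumes "f differentiable (at g)"
  shows "heis_X j f g = lvf (axis j 1, 0) f g"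
  using om_axis_right[of _ j 1]
  by (simp add: heis_X_def lvf_expand[OF assms])

lemma heis_Y_differentiable:
  assumes "f differentiable (at g)"
  shows "heis_Y j f g = lvf (axis j \<i>, 0) f g"
  by (simp add: heis_Y_def lvf_expand[OF assms] om_axis_i_right)

lemma linear_om_fst_left: "linear (\<lambda>g :: ('p::finite, 'q::finite) heis. om (fst g) w / 2)"
  by (rule linearI) (simp_all add: om_simps field_simps)

lemma linear_om_fst_right: "linear (\<lambda>g :: ('p::finite, 'q::finite) heis. om w (fst g) / 2)"
  by (rule linearI) (simp_all add: om_simps field_simps)

lemma cont_op_lvf: "cont_op (lvf u)"
proof (rule cont_op_cong)
  show "cont_op (\<lambda>f g. ddir u f g - of_real (om (fst g) (fst u) / 2) * heis_U f g)"
    unfolding heis_U_def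
    by (intro cont_op_diff cont_op_ddir cont_op_comp[OF cont_op_mult_linear[OF linear_om_fst_left] cont_op_ddir])
qed (simp add: fun_eq_iff lvf_expand[OF schwartz_differentiable])

lemma cont_op_rvf: "cont_op (rvf u)"
proof (rule cont_op_cong)
  show "cont_op (\<lambda>f g. ddir u f g - of_real (om (fst u) (fst g) / 2) * heis_U f g)"
    unfolding heis_U_def
    by (intro cont_op_diff cont_op_ddir cont_op_comp[OF cont_op_mult_linear[OF linear_om_fst_right] cont_op_ddir])
qed (simp add: fun_eq_iff rvf_expand[OF schwartz_differentiable])

lemmas schwartz_lvf = cont_opD[OF cont_op_lvf]
lemmas schwartz_rvf = cont_opD[OF cont_op_rvf]

lemma schwartz_heis_U: "f \<in> schwartz_space \<Longrightarrow> heis_U f \<in> schwartz_space"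
  unfolding heis_U_lvf by (rule schwartz_lvf)

section \<open>Flows of the invariant fields\<close>

lemma lvf_flow_0:
  assumes "f differentiable (at g)"
  shows "((\<lambda>s. f (heis_mult g (s *\<^sub>R u))) has_vector_derivative lvf u f g) (at 0)"
proof -
  have 1: "((\<lambda>s. g + s *\<^sub>R ldir u g) has_vector_derivative ldir u g) (at 0)"
    by (auto intro!: derivative_eq_intros)
  have 2: "(f has_derivative (\<lambda>v. ddir v f g)) (at (g + 0 *\<^sub>R ldir u g))"
    using assms by (simp add: frechet_derivative_works[symmetric])
  from vector_derivative_diff_chain_within[OF 1 has_derivative_at_withinI[OF 2]]
  show ?thesis unfolding heis_mult_ldir lvf_def o_def .
qed

lemma rvf_flow_0:
  assumes "f differentiable (at g)"
  shows "((\<lambda>s. f (heis_mult (s *\<^sub>R u) g)) has_vector_derivative rvf u f g) (at 0)"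
proof -
  have 1: "((\<lambda>s. g + s *\<^sub>R rdir u g) has_vector_derivative rdir u g) (at 0)"
    by (auto intro!: derivative_eq_intros)
  have 2: "(f has_derivative (\<lambda>v. ddir v f g)) (at (g + 0 *\<^sub>R rdir u g))"
    using assms by (simp add: frechet_derivative_works[symmetric])
  from vector_derivative_diff_chain_within[OF 1 has_derivative_at_withinI[OF 2]]
  show ?thesis unfolding heis_mult_rdir rvf_def o_def .
qed

lemma has_vector_derivative_shift_0:
  "((\<lambda>r. f (s + r)) has_vector_derivative D) (at 0) \<Longrightarrow> (f has_vector_derivative D) (at (s::real))"
  using vector_diff_chain_at[of "\<lambda>r. r - s" 1 s "\<lambda>r. f (s + r)" D]
  by (simp add: o_def has_vector_derivative_diff_const)

text \<open>A derivative at time 0 from every base point is enough, because the flow line through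
  \<open>g\<close>, from time \<open>s\<close> on, is the flow line through
  \<open>heis_mult g (s *\<^sub>R u)\<close> from time 0 on.\<close>

lemma lvf_flow:
  assumes "\<And>g. ((\<lambda>s. f (heis_mult g (s *\<^sub>R u))) has_vector_derivative f' g) (at 0)"
  shows "((\<lambda>s. f (heis_mult g (s *\<^sub>R u))) has_vector_derivative f' (heis_mult g (s *\<^sub>R u))) (at s)"
  by (rule has_vector_derivative_shift_0)
    (use assms[of "heis_mult g (s *\<^sub>R u)"] in \<open>simp add: heis_mult_assoc heis_mult_scaleR_scaleR\<close>)

lemma rvf_flow:
  assumes "\<And>g. ((\<lambda>s. f (heis_mult (s *\<^sub>R u) g)) has_vector_derivative f' g) (at 0)"
  shows "((\<lambda>s. f (heis_mult (s *\<^sub>R u) g)) has_vector_derivative f' (heis_mult (s *\<^sub>R u) g)) (at s)"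
  by (rule has_vector_derivative_shift_0)
    (use assms[of "heis_mult (s *\<^sub>R u) g"] in \<open>simp add: heis_mult_assoc[symmetric] heis_mult_scaleR_scaleR add.commute\<close>)

section \<open>Left translation and inversion\<close>

definition ltrans :: "('p::finite, 'q::finite) heis \<Rightarrow> (('p, 'q) heis \<Rightarrow> complex) \<Rightarrow> ('p, 'q) heis \<Rightarrow> complex" where
  "ltrans x f y = f (heis_mult x y)"

text \<open>Negation is the group inverse, so \<open>reflect (ltrans x f)\<close> is the function of
  \<open>y\<close> whose value is \<open>f\<close> at \<open>x\<close> times the inverse of
  \<open>y\<close>, to which a convolution at \<open>x\<close> applies its distribution.\<close>

definition reflect :: "(('p::finite, 'q::finite) heis \<Rightarrow> complex) \<Rightarrow> ('p, 'q) heis \<Rightarrow> complex" where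
  "reflect f y = f (- y)"

lemma reflect_reflect [simp]: "reflect (reflect f) = f"
  by (simp add: reflect_def fun_eq_iff)

lemma ltrans_ltrans: "ltrans u (ltrans x f) = ltrans (heis_mult x u) f"
  by (simp add: ltrans_def fun_eq_iff heis_mult_assoc)

lemma schwartz_reflect: "f \<in> schwartz_space \<Longrightarrow> reflect f \<in> schwartz_space"
  using schwartz_affine[of f uminus 1 0]
  by (simp add: reflect_def[abs_def] linear_uminus)

text \<open>Left multiplication by \<open>x\<close> is affine with linear part \<open>M x\<close>.
  Multiplying back by \<open>- x\<close> expresses \<open>y\<close> through
  \<open>heis_mult x y\<close> with at most linear growth, as \<open>schwartz_affine\<close>
  requires.\<close>

lemma schwartz_ltrans:
  assumes "f \<in> schwartz_space" shows "ltrans x f \<in> schwartz_space"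
proof -
  define M :: "('a, 'b) heis \<Rightarrow> ('a, 'b) heis \<Rightarrow> ('a, 'b) heis" where
    "M x y = (fst y, snd y - om (fst x) (fst y) / 2)" for x y
  have lin: "linear (M x)" for x
    by (rule linearI) (simp_all add: M_def om_simps prod_eq_iff field_simps)
  have eq: "heis_mult x y = x + M x y" for x y
    by (simp add: M_def heis_mult_eq prod_eq_iff)
  obtain B where B: "\<And>y. norm (M (- x) y) \<le> norm y * B" "0 < B"
    using lin[of "- x"] linear_conv_bounded_linear bounded_linear.pos_bounded by metis
  have "(\<lambda>y. f (x + M x y)) \<in> schwartz_space"
  proof (rule schwartz_affine[OF assms lin])
    fix y
    have "y = - x + M (- x) (x + M x y)"
      unfolding eq[symmetric] by (simp add: heis_mult_assoc[symmetric])
    then have "norm y \<le> norm x + norm (M (- x) (x + M x y))"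
      by (metis norm_minus_cancel norm_triangle_ineq)
    also have "\<dots> \<le> norm x * (1 + norm (x + M x y)) + B * (1 + norm (x + M x y))"
    proof -
      have "0 \<le> norm x * norm (x + M x y)" by simp
      moreover have "norm (M (- x) (x + M x y)) \<le> B * norm (x + M x y)"
        using B(1)[of "x + M x y"] by (simp add: mult.commute)
      ultimately show ?thesis
        using B(2) unfolding distrib_left mult_1_right by linarith
    qed
    finally show "norm y \<le> (norm x + B) * (1 + norm (x + M x y))" by (simp add: algebra_simps)
  qed
  then show ?thesis unfolding ltrans_def[abs_def] eq .
qed

lemma lvf_ltrans:
  assumes "f \<in> schwartz_space"
  shows "lvf u (ltrans x f) = ltrans x (lvf u f)"
proof
  fix g
  have "((\<lambda>s. ltrans x f (heis_mult g (s *\<^sub>R u))) has_vector_derivative lvf u f (heis_mult x g)) (at 0)"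
    using lvf_flow_0[OF schwartz_differentiable[OF assms], of "heis_mult x g" u]
    by (simp add: ltrans_def heis_mult_assoc)
  from vector_derivative_unique_at[OF lvf_flow_0[OF schwartz_differentiable[OF schwartz_ltrans[OF assms]]] this]
  show "lvf u (ltrans x f) g = ltrans x (lvf u f) g" by (simp add: ltrans_def)
qed

text \<open>Inversion turns \<open>(s u) g\<close> into \<open>(- g) (- s u)\<close>, so it
  exchanges the two kinds of flow and reverses time.\<close>

lemma rvf_reflect:
  assumes "f \<in> schwartz_space"
  shows "rvf u (reflect f) = (\<lambda>g. - reflect (lvf u f) g)"
proof
  fix g
  have "((\<lambda>s. f (heis_mult (- g) (s *\<^sub>R u))) \<circ> uminus has_vector_derivative (-1) *\<^sub>R lvf u f (- g)) (at 0)"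
    by (rule vector_diff_chain_at)
      (use lvf_flow_0[OF schwartz_differentiable[OF assms], of "- g" u] in \<open>auto intro!: derivative_eq_intros\<close>)
  then have "((\<lambda>s. reflect f (heis_mult (s *\<^sub>R u) g)) has_vector_derivative - lvf u f (- g)) (at 0)"
    by (simp add: reflect_def minus_heis_mult o_def)
  from vector_derivative_unique_at[OF rvf_flow_0[OF schwartz_differentiable[OF schwartz_reflect[OF assms]]] this]
  show "rvf u (reflect f) g = - reflect (lvf u f) g" by (simp add: reflect_def)
qed

text \<open>Moving \<open>x\<close> past \<open>s u\<close> conjugates \<open>u\<close>, and in a
  two-step nilpotent group conjugation changes only the central component, here by
  \<open>- om (fst x) (fst u)\<close>.\<close>

lemma rvf_ltrans:
  assumes "f \<in> schwartz_space"
  shows "rvf u (ltrans x f) = ltrans x (rvf (fst u, snd u - om (fst x) (fst u)) f)"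
proof
  fix g
  let ?u = "(fst u, snd u - om (fst x) (fst u))"
  have eq: "heis_mult x (heis_mult (s *\<^sub>R u) g) = heis_mult (s *\<^sub>R ?u) (heis_mult x g)" for s
    using om_skew[of "fst u" "fst x"]
    by (simp add: heis_mult_eq om_simps prod_eq_iff field_simps)
  have "((\<lambda>s. ltrans x f (heis_mult (s *\<^sub>R u) g)) has_vector_derivative rvf ?u f (heis_mult x g)) (at 0)"
    using rvf_flow_0[OF schwartz_differentiable[OF assms], where g = "heis_mult x g" and u = ?u]
    by (simp only: ltrans_def eq)
  from vector_derivative_unique_at[OF rvf_flow_0[OF schwartz_differentiable[OF schwartz_ltrans[OF assms]]] this]
  show "rvf u (ltrans x f) g = ltrans x (rvf ?u f) g" by (simp add: ltrans_def)
qed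

section \<open>Invariance of Lebesgue measure and integration along flows\<close>

text \<open>For a fixed first coordinate the map translates the second one; afterwards the first is
  translated. Multiplications of the Heisenberg group on either side are such shears.\<close>

lemma distr_lborel_shear:
  fixes b :: "'a::euclidean_space \<Rightarrow> 'b::euclidean_space"
  assumes [measurable]: "b \<in> borel_measurable borel"
  shows "distr lborel borel (\<lambda>z. (a + fst z, b (fst z) + snd z)) = lborel"
proof (rule measure_eqI)
  fix A :: "('a \<times> 'b) set" assume "A \<in> sets (distr lborel borel (\<lambda>z. (a + fst z, b (fst z) + snd z)))"
  then have A: "A \<in> sets borel" by simp
  then have A'[measurable]: "A \<in> sets (borel \<Otimes>\<^sub>M borel)" unfolding borel_prod .
  have m: "(\<lambda>z::'a \<times> 'b. (a + fst z, b (fst z) + snd z)) \<in> borel \<Otimes>\<^sub>M borel \<rightarrow>\<^sub>M borel \<Otimes>\<^sub>M borel"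
    by measurable
  then have m': "(\<lambda>z::'a \<times> 'b. (a + fst z, b (fst z) + snd z)) \<in> borel \<rightarrow>\<^sub>M borel"
    unfolding borel_prod .
  have "emeasure (distr lborel borel (\<lambda>z. (a + fst z, b (fst z) + snd z))) A
      = (\<integral>\<^sup>+z. indicator A (a + fst z, b (fst z) + snd z) \<partial>(lborel \<Otimes>\<^sub>M lborel))"
    using A m' by (simp add: lborel_prod nn_integral_distr flip: nn_integral_indicator)
  also have "\<dots> = (\<integral>\<^sup>+v. \<integral>\<^sup>+t. indicator A (a + v, b v + t) \<partial>lborel \<partial>lborel)"
    by (subst lborel.nn_integral_fst[symmetric]) simp_all
  also have "\<dots> = (\<integral>\<^sup>+v. \<integral>\<^sup>+t. indicator A (a + v, t) \<partial>lborel \<partial>lborel)"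
  proof (rule nn_integral_cong)
    fix v
    have "(\<integral>\<^sup>+t. indicator A (a + v, t) \<partial>lborel) = (\<integral>\<^sup>+t. indicator A (a + v, t) \<partial>distr lborel borel ((+) (b v)))"
      by (simp add: lborel_distr_plus)
    also have "\<dots> = (\<integral>\<^sup>+t. indicator A (a + v, b v + t) \<partial>lborel)"
      by (rule nn_integral_distr) measurable
    finally show "(\<integral>\<^sup>+t. indicator A (a + v, b v + t) \<partial>lborel) = (\<integral>\<^sup>+t. indicator A (a + v, t) \<partial>lborel)" by simp
  qed
  also have "\<dots> = (\<integral>\<^sup>+v. \<integral>\<^sup>+t. indicator A (v, t) \<partial>lborel \<partial>distr lborel borel ((+) a))"
    by (rule nn_integral_distr[symmetric]) measurable
  also have "\<dots> = (\<integral>\<^sup>+z. indicator A z \<partial>(lborel \<Otimes>\<^sub>M lborel))"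
    unfolding lborel_distr_plus by (subst lborel.nn_integral_fst[symmetric]) (auto simp: split_beta)
  also have "\<dots> = emeasure lborel A"
    using A by (simp add: lborel_prod)
  finally show "emeasure (distr lborel borel (\<lambda>z. (a + fst z, b (fst z) + snd z))) A = emeasure lborel A" .
qed simp

lemma om_measurable: "(\<lambda>v. om w v) \<in> borel_measurable borel" "(\<lambda>v. om v w) \<in> borel_measurable borel"
  by (auto intro!: borel_measurable_continuous_onI linear_continuous_on
      simp: linear_conv_bounded_linear[symmetric] linear_om_left linear_om_right)

lemma distr_heis_mult_left: "distr lborel borel (heis_mult x) = lborel"
proof -
  have "heis_mult x = (\<lambda>z. (fst x + fst z, (snd x - om (fst x) (fst z) / 2) + snd z))"
    by (simp add: fun_eq_iff heis_mult_eq)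
  moreover have "(\<lambda>v. snd x - om (fst x) v / 2) \<in> borel_measurable borel"
    using om_measurable(1)[of "fst x"] by measurable
  ultimately show ?thesis using distr_lborel_shear[of "\<lambda>v. snd x - om (fst x) v / 2" "fst x"] by simp
qed

lemma distr_heis_mult_right: "distr lborel borel (\<lambda>y. heis_mult y x) = lborel"
proof -
  have "(\<lambda>y. heis_mult y x) = (\<lambda>z. (fst x + fst z, (snd x - om (fst z) (fst x) / 2) + snd z))"
    by (simp add: fun_eq_iff heis_mult_eq)
  moreover have "(\<lambda>v. snd x - om v (fst x) / 2) \<in> borel_measurable borel"
    using om_measurable(2)[of "fst x"] by measurable
  ultimately show ?thesis using distr_lborel_shear[of "\<lambda>v. snd x - om v (fst x) / 2" "fst x"] by simp
qed

lemma distr_lborel_uminus: "distr lborel borel uminus = (lborel :: 'a::euclidean_space measure)"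
  using lborel_affine[of "-1" "0 :: 'a"] by (simp add: density_1)

lemma continuous_heis_mult: "continuous_on UNIV (\<lambda>p. heis_mult (fst p) (snd p))"
  unfolding heis_mult_eq om_eq by (intro continuous_intros) auto

lemma measurable_heis_mult [measurable (raw)]:
  assumes "f \<in> borel_measurable M" "g \<in> borel_measurable M"
  shows "(\<lambda>z. heis_mult (f z) (g z)) \<in> borel_measurable M"
  using borel_measurable_continuous_Pair[OF assms continuous_heis_mult] .

lemma lborel_transform:
  fixes f :: "'a::euclidean_space \<Rightarrow> 'b::{banach, second_countable_topology}"
  assumes "distr lborel borel \<theta> = lborel" and [measurable]: "\<theta> \<in> borel_measurable borel" "f \<in> borel_measurable borel"
  shows "(LINT x|lborel. f (\<theta> x)) = (LINT x|lborel. f x)"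
    and "integrable lborel (\<lambda>x. f (\<theta> x)) \<longleftrightarrow> integrable lborel f"
proof -
  show "(LINT x|lborel. f (\<theta> x)) = (LINT x|lborel. f x)"
    using integral_distr[of \<theta> lborel borel f] by (simp add: assms(1))
  show "integrable lborel (\<lambda>x. f (\<theta> x)) \<longleftrightarrow> integrable lborel f"
    using integrable_distr_eq[of \<theta> lborel borel f] by (simp add: assms(1))
qed

text \<open>Fundamental theorem of calculus on each orbit, then Fubini over the unit interval;
  measure preservation bounds every slice by \<open>B * L1 f'\<close>. The kernel \<open>K\<close>
  is merely bounded and measurable, so a matrix entry can take its place without being
  differentiated.\<close>

lemma flow_integral:
  fixes f :: "'a::euclidean_space \<Rightarrow> complex"
  assumes mp: "\<And>s. distr lborel borel (\<theta> s) = lborel"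
    and \<theta>[measurable]: "(\<lambda>(s, y). \<theta> s y) \<in> borel_measurable (borel \<Otimes>\<^sub>M borel)"
    and \<theta>0: "\<And>y. \<theta> 0 y = y"
    and f: "integrable lborel f" and f': "integrable lborel f'"
    and deriv: "\<And>s y. ((\<lambda>s. f (\<theta> s y)) has_vector_derivative f' (\<theta> s y)) (at s)"
    and cont: "\<And>y. continuous_on UNIV (\<lambda>s. f' (\<theta> s y))"
    and K[measurable]: "K \<in> borel_measurable borel" and KB: "\<And>y. norm (K y) \<le> B"
  shows "(LINT y|lborel. K y * (f (\<theta> 1 y) - f y)) = (LINT s|lborel. indicator {0..1} s *\<^sub>R (LINT y|lborel. K y * f' (\<theta> s y)))"
proof -
  have [measurable]: "f \<in> borel_measurable borel" "f' \<in> borel_measurable borel"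
    using f f' by auto
  have [measurable]: "\<theta> s \<in> borel_measurable borel" for s
    using measurable_Pair2[OF \<theta>, of s] by simp
  have B: "0 \<le> B" using KB[of 0] norm_ge_zero by (rule order_trans[rotated])
  have "(LINT y|lborel. K y * (f (\<theta> 1 y) - f y)) = (LINT y|lborel. LINT s|lborel. indicator {0..1} s *\<^sub>R (K y * f' (\<theta> s y)))"
  proof (rule Bochner_Integration.integral_cong[OF refl])
    fix y
    have "(LINT s|lborel. indicator {0..1} s *\<^sub>R f' (\<theta> s y)) = f (\<theta> 1 y) - f (\<theta> 0 y)"
      by (rule integral_FTC_Icc) (auto intro: has_vector_derivative_at_within deriv continuous_on_subset[OF cont])
    then have "K y * (f (\<theta> 1 y) - f y) = K y * (LINT s|lborel. indicator {0..1} s *\<^sub>R f' (\<theta> s y))"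
      by (simp only: \<theta>0)
    also have "\<dots> = (LINT s|lborel. K y * (indicator {0..1} s *\<^sub>R f' (\<theta> s y)))"
      by (simp only: integral_mult_right_zero)
    finally show "K y * (f (\<theta> 1 y) - f y) = (LINT s|lborel. indicator {0..1} s *\<^sub>R (K y * f' (\<theta> s y)))"
      by (simp only: mult_scaleR_right)
  qed
  also have "\<dots> = (LINT s|lborel. LINT y|lborel. indicator {0..1} s *\<^sub>R (K y * f' (\<theta> s y)))"
  proof (rule lborel_pair.Fubini_integral)
    have int: "integrable lborel (\<lambda>y. norm (K y * f' (\<theta> s y)))" for s
    proof (rule Bochner_Integration.integrable_bound)
      show "integrable lborel (\<lambda>y. B * norm (f' (\<theta> s y)))"
        using f' by (intro integrable_mult_right integrable_norm) (simp add: lborel_transform[OF mp])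
      show "AE y in lborel. norm (norm (K y * f' (\<theta> s y))) \<le> norm (B * norm (f' (\<theta> s y)))"
        using KB B by (auto simp: norm_mult abs_mult intro!: mult_right_mono)
    qed measurable
    have bound: "(LINT y|lborel. norm (K y * f' (\<theta> s y))) \<le> B * L1 f'" for s
    proof -
      have "(LINT y|lborel. norm (K y * f' (\<theta> s y))) \<le> (LINT y|lborel. B * norm (f' (\<theta> s y)))"
        using f' KB by (intro Bochner_Integration.integral_mono int integrable_mult_right integrable_norm)
          (auto simp: norm_mult lborel_transform[OF mp] intro!: mult_right_mono)
      also have "\<dots> = B * L1 f'"
        using lborel_transform(1)[OF mp, where f = "\<lambda>y. norm (f' y)"] by (simp add: L1_def)
      finally show ?thesis .
    qed
    have m: "(\<lambda>(s, y). indicator {0..1} s *\<^sub>R (K y * f' (\<theta> s y))) \<in> borel_measurable (lborel \<Otimes>\<^sub>M lborel)"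
    proof -
      have "(\<lambda>p. \<theta> (fst p) (snd p)) \<in> borel_measurable (borel \<Otimes>\<^sub>M borel)"
        using \<theta> by (simp add: split_beta')
      then show ?thesis unfolding split_beta' by measurable
    qed
    show "integrable (lborel \<Otimes>\<^sub>M lborel) (\<lambda>(s, y). indicator {0..1} s *\<^sub>R (K y * f' (\<theta> s y)))"
    proof (rule lborel_pair.Fubini_integrable[OF m])
      show "AE s in lborel. integrable lborel (\<lambda>y. case (s, y) of (s, y) \<Rightarrow> indicator {0..1} s *\<^sub>R (K y * f' (\<theta> s y)))"
        using int[THEN integrable_norm_cancel] by (auto intro!: integrable_scaleR_right)
      show "integrable lborel (\<lambda>s. LINT y|lborel. norm (case (s, y) of (s, y) \<Rightarrow> indicator {0..1} s *\<^sub>R (K y * f' (\<theta> s y))))"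
      proof (rule Bochner_Integration.integrable_bound)
        show "integrable lborel (\<lambda>s::real. indicator {0..1} s *\<^sub>R (B * L1 f'))" by simp
        show "AE s in lborel. norm (LINT y|lborel. norm (case (s, y) of (s, y) \<Rightarrow> indicator {0..1} s *\<^sub>R (K y * f' (\<theta> s y)))) \<le> norm (indicator {0..1} s *\<^sub>R (B * L1 f'))"
          using bound B by (auto simp: indicator_def L1_nonneg)
        show "(\<lambda>s. LINT y|lborel. norm (case (s, y) of (s, y) \<Rightarrow> indicator {0..1} s *\<^sub>R (K y * f' (\<theta> s y)))) \<in> borel_measurable lborel"
          using measurable_compose[OF m borel_measurable_norm] by (intro lborel.borel_measurable_lebesgue_integral) (simp add: split_beta')
      qed
    qed
  qed
  also have "\<dots> = (LINT s|lborel. indicator {0..1} s *\<^sub>R (LINT y|lborel. K y * f' (\<theta> s y)))"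
    by simp
  finally show ?thesis .
qed

text \<open>With \<open>K = 1\<close> the left side of \<open>flow_integral\<close> vanishes by
  invariance of the measure. Applied to a product, this is integration by parts along the
  flow.\<close>

lemma flow_integral_derivative:
  fixes f :: "'a::euclidean_space \<Rightarrow> complex"
  assumes mp: "\<And>s. distr lborel borel (\<theta> s) = lborel"
    and \<theta>: "(\<lambda>(s, y). \<theta> s y) \<in> borel_measurable (borel \<Otimes>\<^sub>M borel)"
    and \<theta>0: "\<And>y. \<theta> 0 y = y"
    and f: "integrable lborel f" and f': "integrable lborel f'"
    and deriv: "\<And>s y. ((\<lambda>s. f (\<theta> s y)) has_vector_derivative f' (\<theta> s y)) (at s)"
    and cont: "\<And>y. continuous_on UNIV (\<lambda>s. f' (\<theta> s y))"
  shows "(LINT y|lborel. f' y) = 0"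
proof -
  have m: "f \<in> borel_measurable borel" "f' \<in> borel_measurable borel"
    using f f' by auto
  have \<theta>s: "\<theta> s \<in> borel_measurable borel" for s
    using measurable_Pair2[OF \<theta>, of s] by simp
  have "(LINT y|lborel. 1 * (f (\<theta> 1 y) - f y)) = (LINT s|lborel. indicator {0..1} s *\<^sub>R (LINT y|lborel. 1 * f' (\<theta> s y)))"
    by (rule flow_integral[OF assms, where K = "\<lambda>_. 1" and B = 1]) auto
  moreover have "(LINT y|lborel. f (\<theta> 1 y) - f y) = 0"
    using f by (subst Bochner_Integration.integral_diff) (simp_all add: lborel_transform[OF mp \<theta>s m(1)])
  ultimately show ?thesis
    by (simp add: lborel_transform[OF mp \<theta>s m(2)])
qed

lemma L1_ltrans:
  assumes "f \<in> schwartz_space" shows "L1 (ltrans x f) = L1 f"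
  unfolding L1_def ltrans_def
  using schwartz_measurable[OF assms]
  by (intro lborel_transform(1)[OF distr_heis_mult_left, where f = "\<lambda>y. norm (f y)"]) measurable

section \<open>Hermite functions\<close>

text \<open>The class is closed under multiplication by \<open>s\<close> and under differentiation,
  which sends the polynomial factor \<open>p\<close> to \<open>pderiv p - pCons 0 p\<close>.
  Calculus with Hermite functions thus becomes polynomial algebra.\<close>

definition poly_gauss :: "real poly \<Rightarrow> real \<Rightarrow> real" where
  "poly_gauss p s = poly p s * exp (- s\<^sup>2 / 2)"

lemma poly_gauss_pCons: "poly_gauss (pCons 0 p) s = s * poly_gauss p s"
  by (simp add: poly_gauss_def)

lemma poly_gauss_deriv:
  "(poly_gauss p has_real_derivative poly_gauss (pderiv p - pCons 0 p) s) (at s)"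
  unfolding poly_gauss_def[abs_def]
  by (auto intro!: derivative_eq_intros poly_DERIV simp: algebra_simps)

lemma poly_gauss_continuous: "continuous_on UNIV (poly_gauss p)"
  unfolding poly_gauss_def[abs_def] by (intro continuous_intros) auto

lemma poly_gauss_measurable [measurable]: "poly_gauss p \<in> borel_measurable borel"
  by (intro borel_measurable_continuous_onI poly_gauss_continuous)

lemma power_gauss_bounded: "\<exists>B. \<forall>s::real. \<bar>s\<bar> ^ n * exp (- s\<^sup>2 / 2) \<le> B"
proof (cases "n = 0")
  case False
  have "\<bar>s\<bar> ^ n * exp (- s\<^sup>2 / 2) \<le> 1 + (2 * real n) ^ n" for s :: real
  proof -
    \<comment> \<open>The inequality x \<le> exp x at \<open>s\<^sup>2 / (2 n)\<close>: the n-th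
      power of the right side is exactly the reciprocal of the Gaussian.\<close>
    have "s\<^sup>2 / (2 * real n) \<le> exp (s\<^sup>2 / (2 * real n))"
      using exp_ge_add_one_self[of "s\<^sup>2 / (2 * real n)"] by linarith
    then have "(s\<^sup>2 / (2 * real n)) ^ n \<le> exp (s\<^sup>2 / (2 * real n)) ^ n"
      by (intro power_mono) auto
    also have "\<dots> = exp (s\<^sup>2 / 2)"
      using False by (simp add: exp_of_nat_mult[symmetric])
    finally have "(s\<^sup>2) ^ n \<le> (2 * real n) ^ n * exp (s\<^sup>2 / 2)"
      using False by (simp add: power_divide field_simps)
    moreover have "\<bar>s\<bar> ^ n \<le> 1 + (s\<^sup>2) ^ n"
    proof (cases "\<bar>s\<bar> \<le> 1")
      case True
      then have "\<bar>s\<bar> ^ n \<le> 1" by (simp add: power_le_one)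
      then show ?thesis by (smt (verit) zero_le_power zero_le_power2)
    next
      case False
      then have "\<bar>s\<bar> ^ n \<le> \<bar>s\<bar> ^ (2 * n)" by (intro power_increasing) auto
      then show ?thesis by (simp add: power_mult)
    qed
    moreover have "1 \<le> exp (s\<^sup>2 / 2)" by simp
    ultimately have "\<bar>s\<bar> ^ n \<le> exp (s\<^sup>2 / 2) + (2 * real n) ^ n * exp (s\<^sup>2 / 2)"
      by linarith
    then have "\<bar>s\<bar> ^ n \<le> (1 + (2 * real n) ^ n) * exp (s\<^sup>2 / 2)"
      by (simp add: algebra_simps)
    then show ?thesis by (simp add: exp_minus field_simps)
  qed
  then show ?thesis by blast
qed (auto intro!: exI[of _ 1])

lemma poly_gauss_bounded: "\<exists>B. \<forall>s. \<bar>poly_gauss p s\<bar> \<le> B"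
proof -
  obtain B where B: "\<And>n (s::real). \<bar>s\<bar> ^ n * exp (- s\<^sup>2 / 2) \<le> B n"
    using power_gauss_bounded by metis
  have "\<bar>poly_gauss p s\<bar> \<le> (\<Sum>i\<le>degree p. \<bar>coeff p i\<bar> * B i)" for s
  proof -
    have "\<bar>poly_gauss p s\<bar> \<le> (\<Sum>i\<le>degree p. \<bar>coeff p i * s ^ i * exp (- s\<^sup>2 / 2)\<bar>)"
      unfolding poly_gauss_def poly_altdef sum_distrib_right by (rule sum_abs)
    also have "\<dots> \<le> (\<Sum>i\<le>degree p. \<bar>coeff p i\<bar> * B i)"
    proof (rule sum_mono)
      fix i
      have "\<bar>coeff p i * s ^ i * exp (- s\<^sup>2 / 2)\<bar> = \<bar>coeff p i\<bar> * (\<bar>s\<bar> ^ i * exp (- s\<^sup>2 / 2))"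
        by (simp add: abs_mult power_abs)
      also have "\<dots> \<le> \<bar>coeff p i\<bar> * B i" by (intro mult_left_mono B) simp
      finally show "\<bar>coeff p i * s ^ i * exp (- s\<^sup>2 / 2)\<bar> \<le> \<bar>coeff p i\<bar> * B i" .
    qed
    finally show ?thesis .
  qed
  then show ?thesis by blast
qed

lemma poly_gauss_integrable: "integrable lborel (\<lambda>s. poly_gauss p s)"
proof -
  \<comment> \<open>Boundedness with the extra factor \<open>(1 + s\<^sup>2)\<^sup>2\<close> bounds
    \<open>poly_gauss p\<close> by a multiple of the integrable function
    \<open>1 / (1 + \<bar>s\<bar>) ^ 3\<close>.\<close>
  let ?q = "p * [:1, 0, 1:] * [:1, 0, 1:]"
  obtain B where B: "\<And>s. \<bar>poly_gauss ?q s\<bar> \<le> B" using poly_gauss_bounded by metis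
  show ?thesis
  proof (rule Bochner_Integration.integrable_bound)
    show "integrable lborel (\<lambda>s::real. (4 * B) * (1 / (1 + norm s) ^ (DIM(real) + 2)))"
      by (intro integrable_mult_right integrable_inverse_power_norm)
    show "AE s in lborel. norm (poly_gauss p s) \<le> norm ((4 * B) * (1 / (1 + norm s) ^ (DIM(real) + 2)))"
    proof (intro always_eventually allI)
      fix s :: real
      have B0: "0 \<le> B" using B[of 0] by linarith
      have "poly_gauss ?q s = poly_gauss p s * (1 + s\<^sup>2)\<^sup>2"
        by (simp add: poly_gauss_def power2_eq_square algebra_simps)
      then have 1: "\<bar>poly_gauss p s\<bar> * (1 + s\<^sup>2)\<^sup>2 \<le> B"
        using B[of s] by (simp add: abs_mult)
      have "(1 + \<bar>s\<bar>)\<^sup>2 \<le> 2 * (1 + s\<^sup>2)"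
        using zero_le_power2[of "\<bar>s\<bar> - 1"] by (simp add: power2_eq_square algebra_simps)
      then have "((1 + \<bar>s\<bar>)\<^sup>2)\<^sup>2 \<le> (2 * (1 + s\<^sup>2))\<^sup>2" by (intro power_mono) auto
      moreover have "((1 + \<bar>s\<bar>)\<^sup>2)\<^sup>2 = (1 + \<bar>s\<bar>) ^ 4" by (simp flip: power_mult)
      moreover have "(2 * (1 + s\<^sup>2))\<^sup>2 = 4 * (1 + s\<^sup>2)\<^sup>2" unfolding power_mult_distrib by simp
      ultimately have "(1 + \<bar>s\<bar>) ^ 4 \<le> 4 * (1 + s\<^sup>2)\<^sup>2" by simp
      moreover have "(1 + \<bar>s\<bar>) ^ 3 \<le> (1 + \<bar>s\<bar>) ^ 4" by (intro power_increasing) auto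
      ultimately have "\<bar>poly_gauss p s\<bar> * (1 + \<bar>s\<bar>) ^ 3 \<le> \<bar>poly_gauss p s\<bar> * (4 * (1 + s\<^sup>2)\<^sup>2)"
        by (intro mult_left_mono) auto
      also have "\<dots> \<le> 4 * B" using 1 by simp
      finally have "\<bar>poly_gauss p s\<bar> \<le> 4 * B / (1 + \<bar>s\<bar>) ^ 3"
        by (subst pos_le_divide_eq) (auto intro!: zero_less_power)
      then show "norm (poly_gauss p s) \<le> norm ((4 * B) * (1 / (1 + norm s) ^ (DIM(real) + 2)))"
        using B0 by (simp add: numeral_3_eq_3)
    qed
  qed measurable
qed

lemma poly_gauss_mult_integrable: "integrable lborel (\<lambda>s. poly_gauss p s * poly_gauss q s)"
proof -
  obtain B where B: "\<And>s. \<bar>poly_gauss q s\<bar> \<le> B" using poly_gauss_bounded by metis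
  have B0: "0 \<le> B" using B[of 0] by linarith
  show ?thesis
  proof (rule Bochner_Integration.integrable_bound)
    show "integrable lborel (\<lambda>s. B * poly_gauss p s)"
      by (intro integrable_mult_right poly_gauss_integrable)
    show "AE s in lborel. norm (poly_gauss p s * poly_gauss q s) \<le> norm (B * poly_gauss p s)"
      using B B0 by (intro always_eventually allI) (simp add: abs_mult mult.commute[of _ "\<bar>poly_gauss q _\<bar>"] mult_right_mono)
  qed measurable
qed

lemma poly_gauss_integral_by_parts:
  "(LINT s|lborel. poly_gauss (pderiv p - pCons 0 p) s * poly_gauss q s)
     = - (LINT s|lborel. poly_gauss p s * poly_gauss (pderiv q - pCons 0 q) s)"
proof -
  let ?f' = "\<lambda>s. poly_gauss (pderiv p - pCons 0 p) s * poly_gauss q s + poly_gauss p s * poly_gauss (pderiv q - pCons 0 q) s"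
  let ?f = "\<lambda>s. poly_gauss p s * poly_gauss q s"
  have "(LINT s|lborel. complex_of_real (?f' s)) = 0"
  proof (rule flow_integral_derivative[where \<theta> = "\<lambda>s y. s + y" and f = "\<lambda>s. of_real (?f s)"])
    show "distr lborel borel ((+) s) = lborel" for s :: real by (rule lborel_distr_plus)
    show "((\<lambda>s. complex_of_real (?f (s + y))) has_vector_derivative complex_of_real (?f' (s + y))) (at s)" for s y
    proof -
      have "(?f has_real_derivative ?f' s) (at s)" for s
        by (auto intro!: derivative_eq_intros poly_gauss_deriv)
      from DERIV_shift[THEN iffD1, OF this[of "s + y"]]
      have "((\<lambda>s. ?f (s + y)) has_vector_derivative ?f' (s + y)) (at s)"
        by (simp add: has_real_derivative_iff_has_vector_derivative)
      then show ?thesis by (rule bounded_linear.has_vector_derivative[OF bounded_linear_of_real])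
    qed
    show "continuous_on UNIV (\<lambda>s. complex_of_real (?f' (s + y)))" for y
      by (intro continuous_intros continuous_on_compose2[OF poly_gauss_continuous]) auto
    show "integrable lborel (\<lambda>s. complex_of_real (?f s))"
      by (intro integrable_of_real poly_gauss_mult_integrable)
    show "integrable lborel (\<lambda>s. complex_of_real (?f' s))"
      by (intro integrable_of_real Bochner_Integration.integrable_add poly_gauss_mult_integrable)
  qed auto
  then have "(LINT s|lborel. ?f' s) = 0"
    by (simp only: integral_complex_of_real of_real_eq_0_iff)
  then show ?thesis
    by (subst (asm) Bochner_Integration.integral_add) (auto intro: poly_gauss_mult_integrable)
qed

lemma pderiv_hermite_poly_Suc: "pderiv (hermite_poly (Suc n)) = smult (2 * real (Suc n)) (hermite_poly n)"
proof (induction n)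
  case 0 then show ?case by (simp add: pderiv_pCons)
next
  case (Suc n)
  let ?H = "hermite_poly (Suc n)"
  have X: "[:0, 2:] * p = pCons 0 (smult 2 p)" for p :: "real poly" by simp
  have "pderiv (hermite_poly (Suc (Suc n))) = pderiv (pCons 0 (smult 2 ?H)) - pderiv (pderiv ?H)"
    by (simp only: hermite_poly.simps(2)[of "Suc n"] X pderiv_diff)
  also have "pderiv (pderiv ?H) = smult (2 * real (Suc n)) (pderiv (hermite_poly n))"
    by (simp only: Suc.IH pderiv_smult)
  also have "pderiv (hermite_poly n) = pCons 0 (smult 2 (hermite_poly n)) - ?H"
    by simp
  also have "pderiv (pCons 0 (smult 2 ?H)) = smult 2 ?H + pCons 0 (smult 2 (pderiv ?H))"
    by (simp only: pderiv_pCons pderiv_smult)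
  also have "pderiv ?H = smult (2 * real (Suc n)) (hermite_poly n)" by (rule Suc.IH)
  finally show ?case
    by (simp only: poly_eq_poly_eq_iff[symmetric] fun_eq_iff) (simp add: algebra_simps)
qed

lemma pderiv_hermite_poly_eq: "pderiv (hermite_poly n) = pCons 0 (smult 2 (hermite_poly n)) - hermite_poly (Suc n)"
  by simp

text \<open>As \<open>pderiv p - pCons 0 p\<close> is differentiation on the polynomial factor, this
  is the harmonic oscillator equation: the second derivative equals
  \<open>s\<^sup>2 - (2 n + 1)\<close> times the function.\<close>

lemma hermite_ode:
  "poly_gauss (pderiv (pderiv (hermite_poly n) - pCons 0 (hermite_poly n))
      - pCons 0 (pderiv (hermite_poly n) - pCons 0 (hermite_poly n))) s
    = (s\<^sup>2 - (2 * real n + 1)) * poly_gauss (hermite_poly n) s"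
proof -
  let ?H = "hermite_poly n"
  have "pderiv (hermite_poly (Suc n)) = pderiv (pCons 0 (smult 2 ?H) - pderiv ?H)" by simp
  also have "\<dots> = smult 2 ?H + pCons 0 (smult 2 (pderiv ?H)) - pderiv (pderiv ?H)"
    by (simp only: pderiv_diff pderiv_pCons pderiv_smult)
  finally have "pderiv (pderiv ?H) = smult 2 ?H + pCons 0 (smult 2 (pderiv ?H)) - smult (2 * real (Suc n)) ?H"
    unfolding pderiv_hermite_poly_Suc by (simp add: algebra_simps)
  from arg_cong[where f = "\<lambda>p. poly p s", OF this]
  have "poly (pderiv (pderiv ?H)) s = 2 * s * poly (pderiv ?H) s - 2 * real n * poly ?H s"
    by (simp add: algebra_simps)
  moreover have "poly_gauss (pderiv (pderiv ?H - pCons 0 ?H) - pCons 0 (pderiv ?H - pCons 0 ?H)) s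
      = (poly (pderiv (pderiv ?H)) s - 2 * s * poly (pderiv ?H) s + s\<^sup>2 * poly ?H s - poly ?H s) * exp (- s\<^sup>2 / 2)"
    by (simp add: poly_gauss_def pderiv_diff pderiv_pCons power2_eq_square algebra_simps)
  ultimately show ?thesis
    by (simp only:) (simp add: poly_gauss_def algebra_simps)
qed

text \<open>This constant is 1, but only its independence of the degree of the Hermite functions matters.\<close>

definition gauss_const :: real where
  "gauss_const = (LINT s|lborel. (poly_gauss 1 s)\<^sup>2) / sqrt pi"

lemma gauss_const_nonneg: "0 \<le> gauss_const"
  unfolding gauss_const_def by simp

text \<open>Ladder operators: before normalization, \<open>s - d/ds\<close> raises the n-th Hermite
  function to the next one, and its adjoint \<open>s + d/ds\<close> lowers that one to
  \<open>2 (n + 1)\<close> times the n-th. Each step thus multiplies the square integral by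
  \<open>2 (n + 1)\<close>.\<close>

lemma hermite_square_integral:
  "(LINT s|lborel. (poly_gauss (hermite_poly n) s)\<^sup>2) = 2 ^ n * fact n * (LINT s|lborel. (poly_gauss 1 s)\<^sup>2)"
proof (induction n)
  case (Suc n)
  let ?H = "hermite_poly n" and ?H' = "hermite_poly (Suc n)"
  let ?D = "\<lambda>p::real poly. pderiv p - pCons 0 p"
  have 1: "poly_gauss ?H' s = poly_gauss (pCons 0 ?H) s - poly_gauss (?D ?H) s" for s
    by (simp add: poly_gauss_def pderiv_hermite_poly_eq algebra_simps del: hermite_poly.simps)
  have 2: "poly_gauss (pCons 0 ?H') s + poly_gauss (?D ?H') s = 2 * real (Suc n) * poly_gauss ?H s" for s
    by (simp add: poly_gauss_def pderiv_hermite_poly_Suc algebra_simps del: hermite_poly.simps of_nat_Suc)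
  have "(LINT s|lborel. (poly_gauss ?H' s)\<^sup>2) = (LINT s|lborel. poly_gauss ?H' s * poly_gauss (pCons 0 ?H) s - poly_gauss ?H' s * poly_gauss (?D ?H) s)"
    by (intro Bochner_Integration.integral_cong refl) (simp only: power2_eq_square right_diff_distrib[symmetric] 1[symmetric])
  also have "\<dots> = (LINT s|lborel. poly_gauss ?H' s * poly_gauss (pCons 0 ?H) s) - (LINT s|lborel. poly_gauss ?H' s * poly_gauss (?D ?H) s)"
    by (intro Bochner_Integration.integral_diff poly_gauss_mult_integrable)
  also have "\<dots> = (LINT s|lborel. poly_gauss (pCons 0 ?H') s * poly_gauss ?H s) + (LINT s|lborel. poly_gauss (?D ?H') s * poly_gauss ?H s)"
    unfolding poly_gauss_integral_by_parts by (simp add: poly_gauss_pCons mult_ac)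
  also have "\<dots> = (LINT s|lborel. poly_gauss (pCons 0 ?H') s * poly_gauss ?H s + poly_gauss (?D ?H') s * poly_gauss ?H s)"
    by (intro Bochner_Integration.integral_add[symmetric] poly_gauss_mult_integrable)
  also have "\<dots> = (LINT s|lborel. 2 * real (Suc n) * (poly_gauss ?H s)\<^sup>2)"
    by (intro Bochner_Integration.integral_cong refl) (simp only: power2_eq_square distrib_right[symmetric] 2 mult.assoc)
  also have "\<dots> = 2 * real (Suc n) * (LINT s|lborel. (poly_gauss ?H s)\<^sup>2)" by simp
  finally show ?case unfolding Suc.IH by simp
qed simp

lemma hermite_fun_eq: "hermite_fun n s = poly_gauss (hermite_poly n) s / sqrt (2 ^ n * fact n * sqrt pi)"
  by (simp add: hermite_fun_def poly_gauss_def)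

lemma hermite_fun_square_integral: "(LINT s|lborel. (hermite_fun n s)\<^sup>2) = gauss_const"
proof -
  have "(LINT s|lborel. (hermite_fun n s)\<^sup>2) = (LINT s|lborel. (poly_gauss (hermite_poly n) s)\<^sup>2) / (2 ^ n * fact n * sqrt pi)"
    by (simp add: hermite_fun_eq power_divide)
  then show ?thesis unfolding hermite_square_integral gauss_const_def by simp
qed

lemma hermite_fun_square_integrable: "integrable lborel (\<lambda>s. (hermite_fun n s)\<^sup>2)"
  using poly_gauss_mult_integrable[of "hermite_poly n" "hermite_poly n"]
  by (simp add: hermite_fun_eq power_divide power2_eq_square)

section \<open>Rescaled Hermite functions in one and several variables\<close>

definition shermite :: "real \<Rightarrow> nat \<Rightarrow> real \<Rightarrow> real" where
  "shermite lam n s = \<bar>lam\<bar> powr (1/4) * hermite_fun n (sqrt \<bar>lam\<bar> * s)"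

lemma hermite_basis_eq: "hermite_basis lam m \<xi> = of_real (\<Prod>j\<in>UNIV. shermite lam (m $ j) (\<xi> $ j))"
  by (simp add: hermite_basis_def shermite_def)

definition poly_gauss_scaled :: "real \<Rightarrow> real \<Rightarrow> real poly \<Rightarrow> real \<Rightarrow> real" where
  "poly_gauss_scaled a b p s = b * poly_gauss p (a * s)"

lemma shermite_poly_gauss:
  "shermite lam n = poly_gauss_scaled (sqrt \<bar>lam\<bar>) (\<bar>lam\<bar> powr (1/4) / sqrt (2 ^ n * fact n * sqrt pi)) (hermite_poly n)"
  by (simp add: fun_eq_iff shermite_def hermite_fun_eq poly_gauss_scaled_def)

definition tame :: "(real \<Rightarrow> real) \<Rightarrow> bool" where
  "tame \<phi> \<longleftrightarrow> continuous_on UNIV \<phi> \<and> (\<exists>B. \<forall>s. \<bar>\<phi> s\<bar> \<le> B)"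

lemma tame_poly_gauss_scaled: "tame (poly_gauss_scaled a b p)"
  unfolding tame_def
proof
  show "continuous_on UNIV (poly_gauss_scaled a b p)"
    unfolding poly_gauss_scaled_def[abs_def]
    by (intro continuous_intros continuous_on_compose2[OF poly_gauss_continuous]) auto
  obtain B where B: "\<And>s. \<bar>poly_gauss p s\<bar> \<le> B" using poly_gauss_bounded by metis
  have "\<bar>poly_gauss_scaled a b p s\<bar> \<le> \<bar>b\<bar> * B" for s
    unfolding poly_gauss_scaled_def abs_mult by (intro mult_left_mono B) simp
  then show "\<exists>B. \<forall>s. \<bar>poly_gauss_scaled a b p s\<bar> \<le> B" by blast
qed

lemma poly_gauss_scaled_deriv:
  "(poly_gauss_scaled a b p has_real_derivative poly_gauss_scaled a (a * b) (pderiv p - pCons 0 p) s) (at s)"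
  unfolding poly_gauss_scaled_def[abs_def]
  by (auto intro!: derivative_eq_intros DERIV_chain2[OF poly_gauss_deriv])

text \<open>The oscillator equation at frequency \<open>\<bar>lam\<bar>\<close>. The two derivatives
  are returned as tame functions so that they can replace a factor of
  \<open>prod_fun\<close>.\<close>

lemma shermite_ode:
  obtains \<phi>1 \<phi>2 where "tame \<phi>1" "tame \<phi>2"
    "\<And>s. (shermite lam n has_real_derivative \<phi>1 s) (at s)"
    "\<And>s. (\<phi>1 has_real_derivative \<phi>2 s) (at s)"
    "\<And>s. \<phi>2 s = (lam\<^sup>2 * s\<^sup>2 - \<bar>lam\<bar> * (2 * real n + 1)) * shermite lam n s"
proof -
  define a b where "a = sqrt \<bar>lam\<bar>" and "b = \<bar>lam\<bar> powr (1/4) / sqrt (2 ^ n * fact n * sqrt pi)"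
  let ?D = "\<lambda>p::real poly. pderiv p - pCons 0 p"
  have a2: "a\<^sup>2 = \<bar>lam\<bar>" by (simp add: a_def)
  then have a4: "a\<^sup>2 * a\<^sup>2 = lam\<^sup>2" by (simp add: power2_eq_square)
  have sh: "shermite lam n = poly_gauss_scaled a b (hermite_poly n)"
    unfolding shermite_poly_gauss a_def b_def ..
  have "poly_gauss_scaled a (a * (a * b)) (?D (?D (hermite_poly n))) s = (lam\<^sup>2 * s\<^sup>2 - \<bar>lam\<bar> * (2 * real n + 1)) * shermite lam n s" for s
  proof -
    have "poly_gauss_scaled a (a * (a * b)) (?D (?D (hermite_poly n))) s = a\<^sup>2 * b * (((a * s)\<^sup>2 - (2 * real n + 1)) * poly_gauss (hermite_poly n) (a * s))"
      unfolding poly_gauss_scaled_def hermite_ode by (simp add: power2_eq_square)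
    also have "\<dots> = ((a\<^sup>2 * a\<^sup>2) * s\<^sup>2 - a\<^sup>2 * (2 * real n + 1)) * (b * poly_gauss (hermite_poly n) (a * s))"
      by (simp add: power_mult_distrib algebra_simps)
    finally show ?thesis unfolding a2 a4 sh poly_gauss_scaled_def[symmetric] by (simp add: a4[symmetric] a2)
  qed
  then show ?thesis
    by (rule that[OF tame_poly_gauss_scaled tame_poly_gauss_scaled
        poly_gauss_scaled_deriv[of a b "hermite_poly n", folded sh] poly_gauss_scaled_deriv])
qed

lemma tame_shermite: "tame (shermite lam n)"
  unfolding shermite_poly_gauss by (rule tame_poly_gauss_scaled)

lemma tame_mult_shermite: "tame (\<lambda>s. s * shermite lam n s)"
proof -
  define a b where "a = sqrt \<bar>lam\<bar>" and "b = \<bar>lam\<bar> powr (1/4) / sqrt (2 ^ n * fact n * sqrt pi)"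
  have sh: "shermite lam n = poly_gauss_scaled a b (hermite_poly n)"
    unfolding shermite_poly_gauss a_def b_def ..
  show ?thesis
  proof (cases "lam = 0")
    \<comment> \<open>At \<open>lam = 0\<close> the amplitude is \<open>0 powr (1/4) = 0\<close>, so
      the function vanishes; the other case divides by \<open>a\<close>.\<close>
    case True
    then have "b = 0" by (simp add: b_def)
    then show ?thesis unfolding sh by (auto simp: poly_gauss_scaled_def tame_def)
  next
    case False
    then have "a \<noteq> 0" by (simp add: a_def)
    then have "(\<lambda>s. s * shermite lam n s) = poly_gauss_scaled a (b / a) (pCons 0 (hermite_poly n))"
      by (simp add: fun_eq_iff sh poly_gauss_scaled_def poly_gauss_pCons field_simps)
    then show ?thesis using tame_poly_gauss_scaled by simp
  qed
qed

lemma tame_mult2_shermite: "tame (\<lambda>s. s * (s * shermite lam n s))"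
proof -
  define a b where "a = sqrt \<bar>lam\<bar>" and "b = \<bar>lam\<bar> powr (1/4) / sqrt (2 ^ n * fact n * sqrt pi)"
  have sh: "shermite lam n = poly_gauss_scaled a b (hermite_poly n)"
    unfolding shermite_poly_gauss a_def b_def ..
  show ?thesis
  proof (cases "lam = 0")
    case True
    then have "b = 0" by (simp add: b_def)
    then show ?thesis unfolding sh by (auto simp: poly_gauss_scaled_def tame_def)
  next
    case False
    then have "a \<noteq> 0" by (simp add: a_def)
    then have "(\<lambda>s. s * (s * shermite lam n s)) = poly_gauss_scaled a (b / a / a) (pCons 0 (pCons 0 (hermite_poly n)))"
      by (simp add: fun_eq_iff sh poly_gauss_scaled_def poly_gauss_pCons field_simps)
    then show ?thesis using tame_poly_gauss_scaled by simp
  qed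
qed

text \<open>The amplitude \<open>\<bar>lam\<bar> powr (1/4)\<close> squares to
  \<open>sqrt \<bar>lam\<bar>\<close>, which is the Jacobian of the rescaling.\<close>

lemma shermite_square:
  assumes "lam \<noteq> 0"
  shows "integrable lborel (\<lambda>s. (shermite lam n s)\<^sup>2)" "(LINT s|lborel. (shermite lam n s)\<^sup>2) = gauss_const"
proof -
  let ?a = "sqrt \<bar>lam\<bar>"
  have a: "?a > 0" using assms by simp
  have "(\<bar>lam\<bar> powr (1/4))\<^sup>2 = ?a"
    using assms by (simp add: power2_eq_square powr_half_sqrt flip: powr_add)
  then have eq: "(shermite lam n s)\<^sup>2 = ?a * (hermite_fun n (0 + ?a * s))\<^sup>2" for s
    by (simp add: shermite_def power_mult_distrib)
  show "integrable lborel (\<lambda>s. (shermite lam n s)\<^sup>2)" unfolding eq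
    using a by (intro integrable_mult_right lborel_integrable_real_affine hermite_fun_square_integrable) auto
  have "(LINT s|lborel. (shermite lam n s)\<^sup>2) = ?a * (LINT s|lborel. (hermite_fun n (0 + ?a * s))\<^sup>2)"
    unfolding eq by (rule integral_mult_right_zero)
  also have "\<dots> = (LINT s|lborel. (hermite_fun n s)\<^sup>2)"
    using lborel_integral_real_affine[of ?a "\<lambda>s. (hermite_fun n s)\<^sup>2" 0] a by simp
  finally show "(LINT s|lborel. (shermite lam n s)\<^sup>2) = gauss_const" by (simp add: hermite_fun_square_integral)
qed

text \<open>Lebesgue measure on \<open>real ^ 'n\<close> is a product over \<open>Basis\<close>,
  whose elements are the vectors \<open>axis j 1\<close>; \<open>\<psi>\<close> reindexes the
  factors accordingly.\<close>

lemma prod_vec_integral: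
  fixes \<phi> :: "'n::finite \<Rightarrow> real \<Rightarrow> real"
  assumes "\<And>j. integrable lborel (\<phi> j)"
  shows "integrable lborel (\<lambda>\<xi>::real^'n. \<Prod>j\<in>UNIV. \<phi> j (\<xi> $ j))"
    and "(LINT \<xi>|lborel. (\<Prod>j\<in>UNIV. \<phi> j ((\<xi>::real^'n) $ j))) = (\<Prod>j\<in>UNIV. (LINT s|lborel. \<phi> j s))"
proof -
  interpret product_sigma_finite "\<lambda>b :: real^'n. lborel :: real measure" by standard
  let ?B = "Basis :: (real^'n) set"
  let ?ax = "\<lambda>j::'n. axis j (1::real)"
  have B: "?B = range ?ax" by (auto simp: Basis_vec_def)
  have inj: "inj ?ax" by (auto simp: inj_def axis_eq_axis)
  define \<psi> where "\<psi> b = \<phi> (inv ?ax b)" for b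
  have \<psi>: "\<psi> (?ax j) = \<phi> j" for j by (simp add: \<psi>_def inv_f_f[OF inj])
  have comp: "(\<Sum>b\<in>?B. f b *\<^sub>R b) $ j = f (?ax j)" for f :: "real^'n \<Rightarrow> real" and j
  proof -
    have "(\<Sum>b\<in>?B. f b *\<^sub>R b) $ j = (\<Sum>i\<in>UNIV. f (?ax i) * (?ax i $ j))"
      unfolding B by (subst sum.reindex[OF inj]) simp
    also have "\<dots> = (\<Sum>i\<in>UNIV. if i = j then f (?ax i) else 0)"
      by (intro sum.cong) (auto simp: axis_def)
    finally show ?thesis by simp
  qed
  have [measurable]: "\<phi> j \<in> borel_measurable borel" for j
    using assms[of j] by auto
  have P: "(\<Prod>j\<in>UNIV. \<phi> j ((\<Sum>b\<in>?B. f b *\<^sub>R b) $ j)) = (\<Prod>b\<in>?B. \<psi> b (f b))" for f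
    unfolding comp unfolding B by (simp add: prod.reindex[OF inj] \<psi>)
  have int\<psi>: "integrable lborel (\<psi> b)" for b unfolding \<psi>_def by (rule assms)
  have m: "(\<lambda>f. \<Sum>b\<in>?B. f b *\<^sub>R b) \<in> (\<Pi>\<^sub>M b\<in>?B. lborel) \<rightarrow>\<^sub>M borel" by measurable
  have m': "(\<lambda>\<xi>::real^'n. \<Prod>j\<in>UNIV. \<phi> j (\<xi> $ j)) \<in> borel_measurable borel"
    by measurable
  show "integrable lborel (\<lambda>\<xi>::real^'n. \<Prod>j\<in>UNIV. \<phi> j (\<xi> $ j))"
    using product_integrable_prod[of ?B \<psi>] int\<psi>
    by (subst lborel_eq, subst integrable_distr_eq[OF m m'], unfold P) simp
  have "(LINT \<xi>|lborel. (\<Prod>j\<in>UNIV. \<phi> j ((\<xi>::real^'n) $ j))) = (\<Prod>b\<in>?B. (LINT s|lborel. \<psi> b s))"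
    using product_integral_prod[of ?B \<psi>] int\<psi>
    by (subst lborel_eq, subst integral_distr[OF m m'], unfold P) simp
  then show "(LINT \<xi>|lborel. (\<Prod>j\<in>UNIV. \<phi> j ((\<xi>::real^'n) $ j))) = (\<Prod>j\<in>UNIV. (LINT s|lborel. \<phi> j s))"
    unfolding B by (simp add: prod.reindex[OF inj] \<psi>)
qed

lemma hermite_basis_square:
  fixes m :: "nat ^ 'n::finite"
  assumes "lam \<noteq> 0"
  shows "integrable lborel (\<lambda>\<xi>. (norm (hermite_basis lam m \<xi>))\<^sup>2)"
    and "(LINT \<xi>|lborel. (norm (hermite_basis lam m \<xi>))\<^sup>2) = gauss_const ^ CARD('n)"
proof -
  have eq: "(norm (hermite_basis lam m \<xi>))\<^sup>2 = (\<Prod>j\<in>UNIV. (shermite lam (m $ j) (\<xi> $ j))\<^sup>2)" for \<xi>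
    unfolding hermite_basis_eq norm_of_real power2_abs by (simp add: prod_power_distrib)
  show "integrable lborel (\<lambda>\<xi>. (norm (hermite_basis lam m \<xi>))\<^sup>2)"
    unfolding eq by (intro prod_vec_integral shermite_square assms)
  show "(LINT \<xi>|lborel. (norm (hermite_basis lam m \<xi>))\<^sup>2) = gauss_const ^ CARD('n)"
    unfolding eq by (subst prod_vec_integral) (simp_all add: shermite_square assms)
qed

text \<open>Factors are indexed by coordinates, so a partial derivative or a multiplication by a
  coordinate is a function update of one factor.\<close>

definition prod_fun :: "('n::finite \<Rightarrow> real \<Rightarrow> real) \<Rightarrow> real ^ 'n \<Rightarrow> complex" where
  "prod_fun \<phi> \<xi> = of_real (\<Prod>j\<in>UNIV. \<phi> j (\<xi> $ j))"

lemma prod_fun_upd: "prod_fun (\<phi>(j := \<psi>)) \<xi> = of_real (\<psi> (\<xi> $ j)) * of_real (\<Prod>i\<in>UNIV-{j}. \<phi> i (\<xi> $ i))"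
  unfolding prod_fun_def by (subst prod.remove[of _ j]) (auto intro!: arg_cong[where f = of_real] prod.cong)

lemma prod_fun_same: "prod_fun \<phi> \<xi> = of_real (\<phi> j (\<xi> $ j)) * of_real (\<Prod>i\<in>UNIV-{j}. \<phi> i (\<xi> $ i))"
  using prod_fun_upd[of \<phi> j "\<phi> j"] by simp

definition bcont :: "('a::topological_space \<Rightarrow> complex) \<Rightarrow> bool" where
  "bcont h \<longleftrightarrow> continuous_on UNIV h \<and> (\<exists>B. \<forall>x. norm (h x) \<le> B)"

lemma bcont_cmult: "bcont h \<Longrightarrow> bcont (\<lambda>x. c * h x)"
  unfolding bcont_def
  by (auto intro!: continuous_intros exI[of _ "norm c * B" for B] mult_left_mono simp: norm_mult)

lemma bcont_prod_fun:
  assumes "\<And>j. tame (\<phi> j)" shows "bcont (prod_fun \<phi>)"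
  unfolding bcont_def
proof
  have c: "continuous_on UNIV (\<phi> j)" for j using assms by (simp add: tame_def)
  show "continuous_on UNIV (prod_fun \<phi>)"
    unfolding prod_fun_def[abs_def]
    by (intro continuous_intros continuous_on_compose2[OF c]) auto
  obtain B where B: "\<And>j s. \<bar>\<phi> j s\<bar> \<le> B j" using assms unfolding tame_def by metis
  have "norm (prod_fun \<phi> \<xi>) \<le> (\<Prod>j\<in>UNIV. B j)" for \<xi>
    unfolding prod_fun_def norm_of_real abs_prod by (intro prod_mono) (auto intro: B)
  then show "\<exists>B. \<forall>\<xi>. norm (prod_fun \<phi> \<xi>) \<le> B" by blast
qed

lemma prod_fun_deriv:
  assumes "\<And>s. (\<phi> j has_real_derivative \<psi> s) (at s)"
  shows "((\<lambda>s. prod_fun \<phi> (\<xi> + s *\<^sub>R axis j 1)) has_vector_derivative prod_fun (\<phi>(j := \<psi>)) \<xi>) (at 0)"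
proof -
  let ?c = "\<Prod>i\<in>UNIV-{j}. \<phi> i (\<xi> $ i)"
  have "(\<Prod>i\<in>UNIV-{j}. \<phi> i ((\<xi> + s *\<^sub>R axis j 1) $ i)) = ?c" for s
    by (intro prod.cong) (auto simp: axis_def)
  then have eq: "prod_fun \<phi> (\<xi> + s *\<^sub>R axis j 1) = of_real (\<phi> j (\<xi> $ j + s) * ?c)" for s
    unfolding prod_fun_same[of \<phi> _ j] by (simp add: axis_def)
  have "((\<lambda>s. \<phi> j (\<xi> $ j + s)) has_real_derivative \<psi> (\<xi> $ j)) (at 0)"
    using DERIV_shift[of "\<phi> j" "\<psi> (\<xi> $ j)" 0 "\<xi> $ j"] assms[of "\<xi> $ j"] by (simp add: add.commute)
  then have "((\<lambda>s. \<phi> j (\<xi> $ j + s) * ?c) has_real_derivative \<psi> (\<xi> $ j) * ?c) (at 0)"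
    by (rule DERIV_cmult_right)
  then have "((\<lambda>s. complex_of_real (\<phi> j (\<xi> $ j + s) * ?c)) has_vector_derivative of_real (\<psi> (\<xi> $ j) * ?c)) (at 0)"
    by (intro bounded_linear.has_vector_derivative[OF bounded_linear_of_real])
      (simp add: has_real_derivative_iff_has_vector_derivative)
  then show ?thesis unfolding eq prod_fun_upd by simp
qed

lemma hermite_basis_prod_fun: "hermite_basis lam m = prod_fun (\<lambda>j. shermite lam (m $ j))"
  by (simp add: fun_eq_iff hermite_basis_eq prod_fun_def)

section \<open>The representation and its diagonal matrix entries\<close>

definition rep_phase :: "('p::finite, 'q::finite) heis \<Rightarrow> real ^ ('p + 'q) \<Rightarrow> real" where
  "rep_phase g \<xi> = snd g + (\<Sum>j\<in>UNIV. eps j * (Im (fst g $ j) * \<xi> $ j + Re (fst g $ j) * Im (fst g $ j) / 2))"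

definition re_vec :: "('p::finite, 'q::finite) heis \<Rightarrow> real ^ ('p + 'q)" where
  "re_vec g = (\<chi> j. Re (fst g $ j))"

lemma schroedinger_rep_eq: "schroedinger_rep lam g h \<xi> = cis (- lam * rep_phase g \<xi>) * h (\<xi> + re_vec g)"
  by (simp add: schroedinger_rep_def rep_phase_def re_vec_def)

lemma re_vec_mult: "re_vec (heis_mult g g') = re_vec g + re_vec g'"
  by (simp add: re_vec_def heis_mult_eq vec_eq_iff)

text \<open>Cocycle identity behind the multiplicativity of \<open>schroedinger_rep\<close>: the
  cross terms of \<open>Re * Im / 2\<close> exceed the contribution of the shift by
  \<open>re_vec g\<close> by \<open>om / 2\<close>, which the twist in the group law
  removes.\<close>

lemma rep_phase_mult: "rep_phase (heis_mult g g') \<xi> = rep_phase g \<xi> + rep_phase g' (\<xi> + re_vec g)"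
proof -
  let ?S = "\<lambda>v (\<xi>::real ^ ('a + 'b)). \<Sum>j\<in>UNIV. eps j * (Im (v $ j) * \<xi> $ j + Re (v $ j) * Im (v $ j) / 2)"
  have "?S (fst g + fst g') \<xi> = ?S (fst g) \<xi> + ?S (fst g') (\<xi> + re_vec g) + om (fst g) (fst g') / 2"
    unfolding om_eq sum_divide_distrib sum.distrib[symmetric]
    by (intro sum.cong) (auto simp: re_vec_def field_simps)
  then show ?thesis by (simp add: rep_phase_def heis_mult_eq)
qed

lemma schroedinger_rep_mult:
  "schroedinger_rep lam (heis_mult g g') h \<xi> = schroedinger_rep lam g (schroedinger_rep lam g' h) \<xi>"
  by (simp add: schroedinger_rep_eq rep_phase_mult re_vec_mult cis_mult algebra_simps)

lemma continuous_rep_phase: "continuous_on UNIV (\<lambda>p. rep_phase (fst p) (snd p))"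
  unfolding rep_phase_def by (intro continuous_intros) auto

lemma continuous_re_vec: "continuous_on UNIV re_vec"
  unfolding re_vec_def[abs_def] by (intro continuous_intros)

lemma continuous_schroedinger_rep:
  assumes "continuous_on UNIV h"
  shows "continuous_on UNIV (\<lambda>p. schroedinger_rep lam (fst p) h (snd p))"
  unfolding schroedinger_rep_eq cis_conv_exp
  by (intro continuous_intros continuous_rep_phase continuous_on_compose2[OF assms]
      continuous_on_compose2[OF continuous_re_vec]) auto

lemma continuous_schroedinger_rep_group:
  assumes "continuous_on UNIV h"
  shows "continuous_on UNIV (\<lambda>g. schroedinger_rep lam g h \<xi>)"
proof -
  have "continuous_on UNIV (\<lambda>g. schroedinger_rep lam (fst (g, \<xi>)) h (snd (g, \<xi>)))"
    by (rule continuous_on_compose2[OF continuous_schroedinger_rep[OF assms]]) (auto intro: continuous_intros)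
  then show ?thesis by simp
qed

lemma norm_schroedinger_rep: "norm (schroedinger_rep lam g h \<xi>) = norm (h (\<xi> + re_vec g))"
  by (simp add: schroedinger_rep_eq norm_mult)

lemma schwartz_times_bcont:
  assumes "F \<in> schwartz_space" "bcont \<phi>"
  shows "integrable lborel (\<lambda>g. F g * \<phi> g)"
proof -
  obtain B where B: "\<And>x. norm (\<phi> x) \<le> B" using assms(2) unfolding bcont_def by blast
  have B0: "0 \<le> B" using B norm_ge_zero by (rule order_trans[rotated])
  have [measurable]: "\<phi> \<in> borel_measurable borel"
    using assms(2) by (auto simp: bcont_def intro: borel_measurable_continuous_onI)
  have [measurable]: "F \<in> borel_measurable borel" by (rule schwartz_measurable[OF assms(1)])
  show ?thesis
  proof (rule Bochner_Integration.integrable_bound)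
    show "integrable lborel (\<lambda>g. B * norm (F g))"
      by (intro integrable_mult_right integrable_norm schwartz_integrable assms)
    show "AE g in lborel. norm (F g * \<phi> g) \<le> norm (B * norm (F g))"
      using B B0 by (intro always_eventually allI) (simp add: norm_mult abs_mult mult.commute[of _ "norm (\<phi> _)"] mult_right_mono)
  qed measurable
qed

lemma bcont_schroedinger_rep:
  assumes "bcont h" shows "bcont (\<lambda>g. schroedinger_rep lam g h \<xi>)"
  using assms unfolding bcont_def norm_schroedinger_rep
  by (auto intro: continuous_schroedinger_rep_group)

lemma integral_pull: "(LINT g|M. F g * (c * R g)) = c * (LINT g|M. F g * R g)"
  for F :: "'b \<Rightarrow> complex"
proof -
  have "F g * (c * R g) = c * (F g * R g)" for g by simp
  then show ?thesis by (simp only: integral_mult_right_zero)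
qed

text \<open>Integration by parts at a fixed point \<open>\<xi>\<close>. The representation at
  \<open>g (s u)\<close> is the one at \<open>g\<close> after the one at \<open>s u\<close>, so the
  flow acts on \<open>h\<close> alone and the derivative of \<open>F\<close> is traded for the
  infinitesimal action \<open>h'\<close>.\<close>

lemma integral_lvf_rep:
  assumes F: "F \<in> schwartz_space" and h: "bcont h" and h': "bcont h'"
    and deriv: "\<And>\<eta>. ((\<lambda>s. schroedinger_rep lam (s *\<^sub>R u) h \<eta>) has_vector_derivative h' \<eta>) (at 0)"
  shows "(LINT g|lborel. lvf u F g * schroedinger_rep lam g h \<xi>) = - (LINT g|lborel. F g * schroedinger_rep lam g h' \<xi>)"
proof -
  let ?R = "\<lambda>h g. schroedinger_rep lam g h \<xi>"
  let ?G = "\<lambda>g. F g * ?R h g" and ?G' = "\<lambda>g. lvf u F g * ?R h g + F g * ?R h' g"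
  note int = schwartz_times_bcont[OF F bcont_schroedinger_rep[OF h]]
    schwartz_times_bcont[OF F bcont_schroedinger_rep[OF h']]
    schwartz_times_bcont[OF schwartz_lvf[OF F] bcont_schroedinger_rep[OF h]]
  have "((\<lambda>s. ?R h (heis_mult g (s *\<^sub>R u))) has_vector_derivative ?R h' g) (at 0)" for g
    unfolding schroedinger_rep_mult unfolding schroedinger_rep_eq[of lam g]
    by (intro has_vector_derivative_mult_right deriv)
  from has_vector_derivative_mult[OF lvf_flow_0[OF schwartz_differentiable[OF F]] this]
  have d0: "((\<lambda>s. ?G (heis_mult g (s *\<^sub>R u))) has_vector_derivative ?G' g) (at 0)" for g
    by (simp add: add.commute)
  have cont: "continuous_on UNIV ?G'"
    using h h' unfolding bcont_def
    by (intro continuous_on_add[OF continuous_on_mult[OF schwartz_continuous[OF schwartz_lvf[OF F]] continuous_schroedinger_rep_group]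
        continuous_on_mult[OF schwartz_continuous[OF F] continuous_schroedinger_rep_group]]) auto
  have "(LINT g|lborel. ?G' g) = 0"
  proof (rule flow_integral_derivative[where \<theta> = "\<lambda>s g. heis_mult g (s *\<^sub>R u)" and f = ?G])
    show "((\<lambda>s. ?G (heis_mult g (s *\<^sub>R u))) has_vector_derivative ?G' (heis_mult g (s *\<^sub>R u))) (at s)" for s g
      by (rule lvf_flow[of ?G u ?G', OF d0])
    show "continuous_on UNIV (\<lambda>s. ?G' (heis_mult g (s *\<^sub>R u)))" for g
      by (rule continuous_on_compose2[OF cont]) (auto simp: heis_mult_ldir intro!: continuous_intros)
    show "(\<lambda>(s, y). heis_mult y (s *\<^sub>R u)) \<in> borel_measurable (borel \<Otimes>\<^sub>M borel)"
      unfolding split_beta' by measurable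
  qed (auto intro: distr_heis_mult_right int Bochner_Integration.integrable_add)
  then show ?thesis
    by (subst (asm) Bochner_Integration.integral_add[OF int(3) int(2)]) (simp add: eq_neg_iff_add_eq_0)
qed

lemma rep_X_deriv:
  fixes \<eta> :: "real ^ ('p::finite + 'q::finite)"
  assumes "((\<lambda>s. h (\<eta> + s *\<^sub>R axis j 1)) has_vector_derivative h' \<eta>) (at 0)"
  shows "((\<lambda>s. schroedinger_rep lam (s *\<^sub>R (axis j 1, 0) :: ('p, 'q) heis) h \<eta>) has_vector_derivative h' \<eta>) (at 0)"
proof -
  have "rep_phase (s *\<^sub>R (axis j 1, 0) :: ('p, 'q) heis) \<eta> = 0" for s
    unfolding rep_phase_def by (auto intro!: sum.neutral simp: axis_def)
  moreover have "re_vec (s *\<^sub>R (axis j 1, 0) :: ('p, 'q) heis) = s *\<^sub>R axis j 1" for s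
    unfolding re_vec_def by (auto simp: vec_eq_iff axis_def)
  ultimately show ?thesis using assms by (simp add: schroedinger_rep_eq)
qed

lemma has_vector_derivative_cis: "((\<lambda>s. cis (a * s)) has_vector_derivative \<i> * of_real a) (at 0)"
proof -
  have "((\<lambda>s. exp (\<i> * of_real a * complex_of_real s)) has_vector_derivative \<i> * of_real a * exp (\<i> * of_real a * of_real 0)) (at 0)"
    by (rule has_vector_derivative_real_field) (auto intro!: derivative_eq_intros)
  then show ?thesis by (simp add: cis_conv_exp mult.assoc)
qed

lemma rep_Y_deriv:
  fixes \<eta> :: "real ^ ('p::finite + 'q::finite)"
  shows "((\<lambda>s. schroedinger_rep lam (s *\<^sub>R (axis j \<i>, 0) :: ('p, 'q) heis) h \<eta>) has_vector_derivative
    - \<i> * of_real (lam * eps j) * (of_real (\<eta> $ j) * h \<eta>)) (at 0)"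
proof -
  have "rep_phase (s *\<^sub>R (axis j \<i>, 0) :: ('p, 'q) heis) \<eta> = eps j * s * \<eta> $ j" for s
  proof -
    have "rep_phase (s *\<^sub>R (axis j \<i>, 0) :: ('p, 'q) heis) \<eta> = (\<Sum>i\<in>UNIV. if i = j then eps j * s * \<eta> $ j else 0)"
    proof -
      have "(\<Sum>i\<in>UNIV. eps i * (Im (fst (s *\<^sub>R (axis j \<i>, 0) :: ('p, 'q) heis) $ i) * \<eta> $ i
          + Re (fst (s *\<^sub>R (axis j \<i>, 0) :: ('p, 'q) heis) $ i) * Im (fst (s *\<^sub>R (axis j \<i>, 0) :: ('p, 'q) heis) $ i) / 2))
        = (\<Sum>i\<in>UNIV. if i = j then eps j * s * \<eta> $ j else 0)"
        by (intro sum.cong refl) (auto simp: axis_def)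
      then show ?thesis by (simp only: rep_phase_def snd_scaleR snd_conv scaleR_zero_right add_0)
    qed
    then show ?thesis by simp
  qed
  moreover have "re_vec (s *\<^sub>R (axis j \<i>, 0) :: ('p, 'q) heis) = 0" for s
    unfolding re_vec_def by (auto simp: vec_eq_iff axis_def)
  ultimately have "schroedinger_rep lam (s *\<^sub>R (axis j \<i>, 0) :: ('p, 'q) heis) h \<eta> = cis ((- lam * eps j * \<eta> $ j) * s) * h \<eta>" for s
    by (simp add: schroedinger_rep_eq mult_ac)
  then show ?thesis
    using has_vector_derivative_mult_left[OF has_vector_derivative_cis[of "- lam * eps j * \<eta> $ j"], of "h \<eta>"]
    by (simp add: mult.assoc)
qed

lemma rep_U_deriv:
  "((\<lambda>s. schroedinger_rep lam (s *\<^sub>R (0, 1) :: ('p::finite, 'q::finite) heis) h \<eta>) has_vector_derivative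
    - \<i> * of_real lam * h \<eta>) (at 0)"
proof -
  have "rep_phase (s *\<^sub>R (0, 1) :: ('p, 'q) heis) \<eta> = s" "re_vec (s *\<^sub>R (0, 1) :: ('p, 'q) heis) = 0" for s
    unfolding rep_phase_def re_vec_def by (auto simp: vec_eq_iff)
  then have "schroedinger_rep lam (s *\<^sub>R (0, 1) :: ('p, 'q) heis) h \<eta> = cis ((- lam) * s) * h \<eta>" for s
    by (simp add: schroedinger_rep_eq)
  then show ?thesis
    using has_vector_derivative_mult_left[OF has_vector_derivative_cis[of "- lam"], of "h \<eta>"] by simp
qed

definition lap :: "'p + 'q \<Rightarrow> (('p::finite, 'q::finite) heis \<Rightarrow> complex) \<Rightarrow> ('p, 'q) heis \<Rightarrow> complex" where
  "lap j f g = lvf (axis j 1, 0) (lvf (axis j 1, 0) f) g + lvf (axis j \<i>, 0) (lvf (axis j \<i>, 0) f) g"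

lemma cont_op_lap: "cont_op (lap j)"
  unfolding lap_def[abs_def] by (intro cont_op_add cont_op_comp[OF cont_op_lvf] cont_op_lvf)

lemmas schwartz_lap = cont_opD[OF cont_op_lap]

lemma schroedinger_rep_cmult: "schroedinger_rep lam g (\<lambda>\<eta>. c * h \<eta>) \<xi> = c * schroedinger_rep lam g h \<xi>"
  by (simp add: schroedinger_rep_eq)

text \<open>Moving each field twice onto the vector leaves the second derivative minus
  \<open>lam\<^sup>2 s\<^sup>2\<close> times the function in the j-th variable, which is the
  rescaled oscillator.\<close>

lemma integral_lap_rep:
  fixes F :: "('p::finite, 'q::finite) heis \<Rightarrow> complex"
  assumes F: "F \<in> schwartz_space"
  shows "(LINT g|lborel. lap j F g * schroedinger_rep lam g (hermite_basis lam m) \<xi>)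
    = - of_real (\<bar>lam\<bar> * (2 * real (m $ j) + 1)) * (LINT g|lborel. F g * schroedinger_rep lam g (hermite_basis lam m) \<xi>)"
proof -
  define \<phi> where "\<phi> = (\<lambda>j. shermite lam (m $ j))"
  define h where "h = prod_fun \<phi>"
  have h: "hermite_basis lam m = h" by (simp add: h_def \<phi>_def hermite_basis_prod_fun)
  have t\<phi>: "tame (\<phi> i)" for i by (simp add: \<phi>_def tame_shermite)
  obtain \<phi>1 \<phi>2 where \<phi>12: "tame \<phi>1" "tame \<phi>2" "\<And>s. (\<phi> j has_real_derivative \<phi>1 s) (at s)"
    "\<And>s. (\<phi>1 has_real_derivative \<phi>2 s) (at s)"
    "\<And>s. \<phi>2 s = (lam\<^sup>2 * s\<^sup>2 - \<bar>lam\<bar> * (2 * real (m $ j) + 1)) * \<phi> j s"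
    unfolding \<phi>_def using shermite_ode[of lam "m $ j"] by blast
  define h1 h2 k1 k2 where "h1 = prod_fun (\<phi>(j := \<phi>1))" and "h2 = prod_fun (\<phi>(j := \<phi>2))"
    and "k1 = prod_fun (\<phi>(j := (\<lambda>s. s * \<phi> j s)))" and "k2 = prod_fun (\<phi>(j := (\<lambda>s. s * (s * \<phi> j s))))"
  have bc: "bcont h" "bcont h1" "bcont h2" "bcont k1" "bcont k2"
    unfolding h_def h1_def h2_def k1_def k2_def
    using t\<phi> \<phi>12(1,2) tame_mult_shermite tame_mult2_shermite by (auto intro!: bcont_prod_fun simp: \<phi>_def)
  have hd: "((\<lambda>s. h (\<eta> + s *\<^sub>R axis j 1)) has_vector_derivative h1 \<eta>) (at 0)" for \<eta>
    unfolding h_def h1_def by (rule prod_fun_deriv[of \<phi> j, OF \<phi>12(3)])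
  have h1d: "((\<lambda>s. h1 (\<eta> + s *\<^sub>R axis j 1)) has_vector_derivative h2 \<eta>) (at 0)" for \<eta>
    using prod_fun_deriv[of "\<phi>(j := \<phi>1)" j \<phi>2 \<eta>] \<phi>12(4) by (simp add: h1_def h2_def)
  have k1: "of_real (\<eta> $ j) * h \<eta> = k1 \<eta>" and k2: "of_real (\<eta> $ j) * k1 \<eta> = k2 \<eta>" for \<eta>
    unfolding h_def k1_def k2_def prod_fun_upd prod_fun_same[of \<phi> _ j] by simp_all
  let ?c = "- \<i> * of_real (lam * eps j)"
  \<comment> \<open>The sign of the j-th block drops out here, so the eigenvalue of
    \<open>lap j\<close> has the same sign for both kinds of coordinates.\<close>
  have eps2: "eps j * eps j = 1" by (cases j) auto
  have c2: "?c * ?c = - of_real (lam\<^sup>2)"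
    using eps2 by (simp add: power2_eq_square mult_ac flip: of_real_mult)
  let ?X = "lvf (axis j 1, 0)" and ?Y = "lvf (axis j \<i>, 0)"
  let ?R = "\<lambda>h g. schroedinger_rep lam g h \<xi>"
  have X: "(LINT g|lborel. ?X (?X F) g * ?R h g) = (LINT g|lborel. F g * ?R h2 g)"
    using integral_lvf_rep[OF schwartz_lvf[OF F] bc(1,2) rep_X_deriv[where h = h and h' = h1, OF hd]]
      integral_lvf_rep[OF F bc(2,3) rep_X_deriv[where h = h1 and h' = h2, OF h1d]] by simp
  have Y: "(LINT g|lborel. ?Y (?Y F) g * ?R h g) = ?c * ?c * (LINT g|lborel. F g * ?R k2 g)"
  proof -
    have 1: "(LINT g|lborel. ?Y (?Y F) g * ?R h g) = - (?c * (LINT g|lborel. ?Y F g * ?R k1 g))"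
      using integral_lvf_rep[OF schwartz_lvf[OF F] bc(1) bcont_cmult[OF bc(4), of ?c] rep_Y_deriv[where lam = lam and j = j and h = h, unfolded k1], where \<xi> = \<xi>]
      unfolding schroedinger_rep_cmult integral_pull by simp
    have 2: "(LINT g|lborel. ?Y F g * ?R k1 g) = - (?c * (LINT g|lborel. F g * ?R k2 g))"
      using integral_lvf_rep[OF F bc(4) bcont_cmult[OF bc(5), of ?c] rep_Y_deriv[where lam = lam and j = j and h = k1, unfolded k2], where \<xi> = \<xi>]
      unfolding schroedinger_rep_cmult integral_pull by simp
    show ?thesis unfolding 1 2 by simp
  qed
  have pt: "?R h2 g + ?c * ?c * ?R k2 g = - of_real (\<bar>lam\<bar> * (2 * real (m $ j) + 1)) * ?R h g" for g
  proof -
    have "h2 \<eta> - of_real (lam\<^sup>2) * k2 \<eta> = - of_real (\<bar>lam\<bar> * (2 * real (m $ j) + 1)) * h \<eta>" for \<eta>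
      unfolding h2_def h_def k2_def prod_fun_upd prod_fun_same[of \<phi> _ j] \<phi>12(5)
      by (simp add: algebra_simps power2_eq_square)
    note this[of "\<xi> + re_vec g"]
    moreover have "?R h2 g + ?c * ?c * ?R k2 g
        = cis (- lam * rep_phase g \<xi>) * (h2 (\<xi> + re_vec g) - of_real (lam\<^sup>2) * k2 (\<xi> + re_vec g))"
      unfolding c2 schroedinger_rep_eq by (simp add: right_diff_distrib)
    ultimately show ?thesis
      unfolding schroedinger_rep_eq[of lam g h] by (simp only: mult.left_commute)
  qed
  note int = schwartz_times_bcont[OF F bcont_schroedinger_rep[OF bc(3)], of lam \<xi>]
    schwartz_times_bcont[OF F bcont_schroedinger_rep[OF bc(5)], of lam \<xi>]
    schwartz_times_bcont[OF schwartz_lvf[OF schwartz_lvf[OF F]] bcont_schroedinger_rep[OF bc(1)], of _ _ lam \<xi>]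
  have "(LINT g|lborel. lap j F g * ?R h g) = (LINT g|lborel. ?X (?X F) g * ?R h g) + (LINT g|lborel. ?Y (?Y F) g * ?R h g)"
    unfolding lap_def distrib_right by (intro Bochner_Integration.integral_add int)
  also have "\<dots> = (LINT g|lborel. F g * ?R h2 g) + (LINT g|lborel. ?c * ?c * (F g * ?R k2 g))"
    unfolding X Y by (simp only: integral_mult_right_zero)
  also have "\<dots> = (LINT g|lborel. F g * ?R h2 g + ?c * ?c * (F g * ?R k2 g))"
    by (intro Bochner_Integration.integral_add[symmetric] int integrable_mult_right)
  also have "\<dots> = (LINT g|lborel. - of_real (\<bar>lam\<bar> * (2 * real (m $ j) + 1)) * (F g * ?R h g))"
  proof (intro Bochner_Integration.integral_cong refl)
    fix g
    have "F g * ?R h2 g + ?c * ?c * (F g * ?R k2 g) = F g * (?R h2 g + ?c * ?c * ?R k2 g)"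
      by (simp only: distrib_left mult_ac)
    then show "F g * ?R h2 g + ?c * ?c * (F g * ?R k2 g) = - of_real (\<bar>lam\<bar> * (2 * real (m $ j) + 1)) * (F g * ?R h g)"
      unfolding pt by (simp only: mult.left_commute)
  qed
  finally show ?thesis unfolding h by (simp only: integral_mult_right_zero)
qed

lemma integral_U_rep:
  fixes F :: "('p::finite, 'q::finite) heis \<Rightarrow> complex"
  assumes F: "F \<in> schwartz_space"
  shows "(LINT g|lborel. heis_U F g * schroedinger_rep lam g (hermite_basis lam m) \<xi>)
    = \<i> * of_real lam * (LINT g|lborel. F g * schroedinger_rep lam g (hermite_basis lam m) \<xi>)"
proof -
  have bc: "bcont (hermite_basis lam m)"
    unfolding hermite_basis_prod_fun by (intro bcont_prod_fun tame_shermite)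
  show ?thesis
    using integral_lvf_rep[OF F bc bcont_cmult[OF bc, of "- \<i> * of_real lam"] rep_U_deriv, where \<xi> = \<xi>]
    unfolding schroedinger_rep_cmult heis_U_lvf integral_pull by simp
qed

section \<open>Diagonal matrix entries: measurability, boundedness, symmetry\<close>

definition ent :: "real \<Rightarrow> nat ^ ('p::finite + 'q::finite) \<Rightarrow> ('p, 'q) heis \<Rightarrow> complex" where
  "ent lam m g = matrix_entry lam (hermite_basis lam m) (hermite_basis lam m) g"

lemma continuous_hermite_basis: "continuous_on UNIV (hermite_basis lam m)"
  using bcont_prod_fun[of "\<lambda>j. shermite lam (m $ j)"] tame_shermite
  by (auto simp: hermite_basis_prod_fun bcont_def)

lemma measurable_hermite_basis [measurable]: "hermite_basis lam m \<in> borel_measurable borel"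
  by (rule borel_measurable_continuous_onI[OF continuous_hermite_basis])

lemma measurable_rep_phase [measurable (raw)]:
  "f \<in> borel_measurable M \<Longrightarrow> g \<in> borel_measurable M \<Longrightarrow> (\<lambda>x. rep_phase (f x) (g x)) \<in> borel_measurable M"
  using borel_measurable_continuous_Pair[OF _ _ continuous_rep_phase] .

lemma measurable_re_vec [measurable]: "re_vec \<in> borel_measurable borel"
  by (rule borel_measurable_continuous_onI[OF continuous_re_vec])

lemma measurable_cnj [measurable]: "cnj \<in> borel_measurable borel"
  by (intro borel_measurable_continuous_onI continuous_intros)

lemma measurable_cis [measurable]: "cis \<in> borel_measurable borel"
  by (intro borel_measurable_continuous_onI continuous_intros)

lemma measurable_hermite_fun [measurable]: "hermite_fun n \<in> borel_measurable borel"
  unfolding hermite_fun_eq[abs_def] by measurable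

text \<open>Joint measurability in \<open>lam\<close> and the group element, because the pairings
  are integrated over both in turn.\<close>

lemma measurable_ent [measurable]:
  "(\<lambda>p. ent (fst p) m (snd p)) \<in> borel_measurable (borel \<Otimes>\<^sub>M borel)"
proof -
  have "(\<lambda>p. LINT \<xi>|lborel. schroedinger_rep (fst p) (snd p) (hermite_basis (fst p) m) \<xi> * cnj (hermite_basis (fst p) m \<xi>))
    \<in> borel_measurable (borel \<Otimes>\<^sub>M borel)"
  proof (rule lborel.borel_measurable_lebesgue_integral)
    have vec: "(\<lambda>\<xi>::real^('a+'b). \<xi> $ j) \<in> borel_measurable borel" for j by measurable
    have hb: "(\<lambda>p. hermite_basis (f p) m (g p)) \<in> borel_measurable M"
      if [measurable]: "f \<in> borel_measurable M" "g \<in> borel_measurable M" for f g and M :: "((real \<times> ('a, 'b) heis) \<times> (real^('a+'b))) measure"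
      unfolding hermite_basis_def
      using measurable_compose[OF that(2) vec] by measurable
    show "(\<lambda>(p, \<xi>). schroedinger_rep (fst p) (snd p) (hermite_basis (fst p) m) \<xi> * cnj (hermite_basis (fst p) m \<xi>))
       \<in> borel_measurable ((borel \<Otimes>\<^sub>M borel) \<Otimes>\<^sub>M lborel)"
      unfolding split_beta' schroedinger_rep_eq
      by (intro borel_measurable_times measurable_compose[OF hb measurable_cnj] hb) measurable
  qed
  then show ?thesis unfolding ent_def matrix_entry_def .
qed

lemma measurable_ent_group [measurable]: "ent lam m \<in> borel_measurable borel"
  using measurable_compose[OF measurable_Pair1'[of lam borel borel] measurable_ent[of m]] by simp

lemma lborel_translation:
  fixes f :: "'a::euclidean_space \<Rightarrow> 'b::{banach, second_countable_topology}"
  assumes "f \<in> borel_measurable borel"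
  shows "(LINT x|lborel. f (x + a)) = (LINT x|lborel. f x)" "integrable lborel (\<lambda>x. f (x + a)) \<longleftrightarrow> integrable lborel f"
  using lborel_transform[OF lborel_distr_plus[of a], of f] assms by (simp_all add: add.commute)

text \<open>The inequality of the arithmetic and geometric means together with translation
  invariance takes the place of Cauchy-Schwarz. The bound is uniform in the shift, in
  \<open>lam\<close> and in \<open>m\<close>.\<close>

lemma ent_bound_aux:
  fixes m :: "nat ^ ('p::finite + 'q::finite)"
  assumes "lam \<noteq> 0"
  shows "integrable lborel (\<lambda>\<xi>. norm (hermite_basis lam m (\<xi> + a)) * norm (hermite_basis lam m \<xi>))"
    and "(LINT \<xi>|lborel. norm (hermite_basis lam m (\<xi> + a)) * norm (hermite_basis lam m \<xi>)) \<le> gauss_const ^ CARD('p + 'q)"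
proof -
  let ?h = "hermite_basis lam m"
  let ?s = "\<lambda>\<xi>. (norm (?h \<xi>))\<^sup>2"
  have m: "?s \<in> borel_measurable borel" by measurable
  note sq = hermite_basis_square[OF assms, of m]
  have int: "integrable lborel (\<lambda>\<xi>. ?s (\<xi> + a))" using sq(1) unfolding lborel_translation(2)[OF m] .
  have le: "norm (?h (\<xi> + a)) * norm (?h \<xi>) \<le> ?s (\<xi> + a) / 2 + ?s \<xi> / 2" for \<xi>
    using sum_squares_bound[of "norm (?h (\<xi> + a))" "norm (?h \<xi>)"] by simp
  have int2: "integrable lborel (\<lambda>\<xi>. ?s (\<xi> + a) / 2 + ?s \<xi> / 2)"
    using int sq(1) by (intro Bochner_Integration.integrable_add integrable_divide) auto
  show int1: "integrable lborel (\<lambda>\<xi>. norm (?h (\<xi> + a)) * norm (?h \<xi>))"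
    by (rule Bochner_Integration.integrable_bound[OF int2]) (use le in \<open>auto intro: order_trans\<close>)
  have "(LINT \<xi>|lborel. norm (?h (\<xi> + a)) * norm (?h \<xi>)) \<le> (LINT \<xi>|lborel. ?s (\<xi> + a) / 2 + ?s \<xi> / 2)"
    by (intro Bochner_Integration.integral_mono int1 int2 le)
  also have "\<dots> = (LINT \<xi>|lborel. ?s \<xi>)"
    using int sq(1) by (subst Bochner_Integration.integral_add) (auto simp: lborel_translation(1)[OF m])
  finally show "(LINT \<xi>|lborel. norm (?h (\<xi> + a)) * norm (?h \<xi>)) \<le> gauss_const ^ CARD('p + 'q)"
    unfolding sq(2) .
qed

lemma norm_ent:
  fixes m :: "nat ^ ('p::finite + 'q::finite)"
  assumes "lam \<noteq> 0"
  shows "norm (ent lam m g) \<le> gauss_const ^ CARD('p + 'q)"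
proof -
  have "norm (ent lam m g) \<le> (LINT \<xi>|lborel. norm (hermite_basis lam m (\<xi> + re_vec g)) * norm (hermite_basis lam m \<xi>))"
    unfolding ent_def matrix_entry_def
    by (rule order_trans[OF integral_norm_bound]) (simp add: norm_mult norm_schroedinger_rep)
  also have "\<dots> \<le> gauss_const ^ CARD('p + 'q)" by (rule ent_bound_aux(2)[OF assms])
  finally show ?thesis .
qed

text \<open>Inversion reverses phase and shift. As the basis is real and depends on
  \<open>lam\<close> only through \<open>\<bar>lam\<bar>\<close>, the substitution
  \<open>\<xi> + re_vec g\<close> exchanges the two factors. This symmetry supplies the eigenvalue
  equations from the other side.\<close>

lemma ent_uminus:
  shows "ent lam m (- g) = ent (- lam) m g"
proof -
  let ?h = "hermite_basis lam m"
  have h: "hermite_basis (- lam) m = ?h" by (simp add: hermite_basis_def fun_eq_iff)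
  have cnj: "cnj (?h \<xi>) = ?h \<xi>" for \<xi> by (simp add: hermite_basis_def)
  have ph: "rep_phase (- g) (\<xi> + re_vec g) = - rep_phase g \<xi>" for \<xi>
    using rep_phase_mult[of g "- g" \<xi>] by (simp add: rep_phase_def)
  have re: "re_vec (- g) = - re_vec g" by (simp add: re_vec_def vec_eq_iff)
  let ?f = "\<lambda>\<xi>. schroedinger_rep lam (- g) ?h \<xi> * cnj (?h \<xi>)"
  have "?f \<in> borel_measurable borel"
    unfolding schroedinger_rep_eq by measurable
  from lborel_translation(1)[OF this, of "re_vec g"]
  have "ent lam m (- g) = (LINT \<xi>|lborel. ?f (\<xi> + re_vec g))"
    by (simp add: ent_def matrix_entry_def)
  also have "\<dots> = ent (- lam) m g"
    unfolding ent_def matrix_entry_def h schroedinger_rep_eq ph re cnj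
    by (intro Bochner_Integration.integral_cong) (auto simp: mult_ac)
  finally show ?thesis .
qed

text \<open>With the group integral innermost, equations for \<open>schroedinger_rep\<close> at
  fixed \<open>\<xi>\<close> pass to the entries.\<close>

lemma integral_ent:
  fixes F :: "('p::finite, 'q::finite) heis \<Rightarrow> complex"
  assumes F: "F \<in> schwartz_space" and lam: "lam \<noteq> 0"
  shows "(LINT g|lborel. ent lam m g * F g)
    = (LINT \<xi>|lborel. cnj (hermite_basis lam m \<xi>) * (LINT g|lborel. F g * schroedinger_rep lam g (hermite_basis lam m) \<xi>))"
proof -
  let ?h = "hermite_basis lam m"
  have [measurable]: "F \<in> borel_measurable borel" by (rule schwartz_measurable[OF F])
  have m: "(\<lambda>(g, \<xi>). F g * schroedinger_rep lam g ?h \<xi> * cnj (?h \<xi>)) \<in> borel_measurable (lborel \<Otimes>\<^sub>M lborel)"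
    unfolding schroedinger_rep_eq split_beta' by measurable
  have nrm: "norm (F g * schroedinger_rep lam g ?h \<xi> * cnj (?h \<xi>)) = norm (F g) * (norm (?h (\<xi> + re_vec g)) * norm (?h \<xi>))" for g \<xi>
    by (simp add: norm_mult norm_schroedinger_rep)
  have "(LINT g|lborel. ent lam m g * F g) = (LINT g|lborel. LINT \<xi>|lborel. F g * schroedinger_rep lam g ?h \<xi> * cnj (?h \<xi>))"
    by (simp add: ent_def matrix_entry_def mult.assoc) (simp only: mult.commute)
  also have "\<dots> = (LINT \<xi>|lborel. LINT g|lborel. F g * schroedinger_rep lam g ?h \<xi> * cnj (?h \<xi>))"
  proof (rule lborel_pair.Fubini_integral[symmetric], rule lborel_pair.Fubini_integrable[OF m])
    show "AE g in lborel. integrable lborel (\<lambda>\<xi>. case (g, \<xi>) of (g, \<xi>) \<Rightarrow> F g * schroedinger_rep lam g ?h \<xi> * cnj (?h \<xi>))"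
    proof (intro always_eventually allI)
      fix g
      have "integrable lborel (\<lambda>\<xi>. norm (F g * schroedinger_rep lam g ?h \<xi> * cnj (?h \<xi>)))"
        unfolding nrm by (intro integrable_mult_right ent_bound_aux lam)
      moreover have "(\<lambda>\<xi>. F g * schroedinger_rep lam g ?h \<xi> * cnj (?h \<xi>)) \<in> borel_measurable lborel"
        unfolding schroedinger_rep_eq by measurable
      ultimately show "integrable lborel (\<lambda>\<xi>. case (g, \<xi>) of (g, \<xi>) \<Rightarrow> F g * schroedinger_rep lam g ?h \<xi> * cnj (?h \<xi>))"
        by (simp add: integrable_norm_iff)
    qed
    show "integrable lborel (\<lambda>g. LINT \<xi>|lborel. norm (case (g, \<xi>) of (g, \<xi>) \<Rightarrow> F g * schroedinger_rep lam g ?h \<xi> * cnj (?h \<xi>)))"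
    proof (rule Bochner_Integration.integrable_bound)
      show "integrable lborel (\<lambda>g. gauss_const ^ CARD('p + 'q) * norm (F g))"
        by (intro integrable_mult_right integrable_norm schwartz_integrable F)
      show "(\<lambda>g. LINT \<xi>|lborel. norm (case (g, \<xi>) of (g, \<xi>) \<Rightarrow> F g * schroedinger_rep lam g ?h \<xi> * cnj (?h \<xi>))) \<in> borel_measurable lborel"
        using measurable_compose[OF m borel_measurable_norm]
        by (intro lborel.borel_measurable_lebesgue_integral) (simp add: split_beta')
      show "AE g in lborel. norm (LINT \<xi>|lborel. norm (case (g, \<xi>) of (g, \<xi>) \<Rightarrow> F g * schroedinger_rep lam g ?h \<xi> * cnj (?h \<xi>)))
          \<le> norm (gauss_const ^ CARD('p + 'q) * norm (F g))"
      proof (intro always_eventually allI)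
        fix g
        have "(LINT \<xi>|lborel. norm (F g * schroedinger_rep lam g ?h \<xi> * cnj (?h \<xi>)))
           = norm (F g) * (LINT \<xi>|lborel. norm (?h (\<xi> + re_vec g)) * norm (?h \<xi>))"
          unfolding nrm by (rule integral_mult_right_zero)
        also have "\<dots> \<le> norm (F g) * gauss_const ^ CARD('p + 'q)"
          by (intro mult_left_mono ent_bound_aux lam) simp
        finally have "(LINT \<xi>|lborel. norm (F g * schroedinger_rep lam g ?h \<xi> * cnj (?h \<xi>))) \<le> norm (F g) * gauss_const ^ CARD('p + 'q)" .
        moreover have "0 \<le> (LINT \<xi>|lborel. norm (F g * schroedinger_rep lam g ?h \<xi> * cnj (?h \<xi>)))" by simp
        ultimately show "norm (LINT \<xi>|lborel. norm (case (g, \<xi>) of (g, \<xi>) \<Rightarrow> F g * schroedinger_rep lam g ?h \<xi> * cnj (?h \<xi>)))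
          \<le> norm (gauss_const ^ CARD('p + 'q) * norm (F g))"
          using gauss_const_nonneg by (simp add: abs_mult mult.commute)
      qed
    qed
  qed
  also have "\<dots> = (LINT \<xi>|lborel. cnj (?h \<xi>) * (LINT g|lborel. F g * schroedinger_rep lam g ?h \<xi>))"
    by (simp add: mult.commute)
  finally show ?thesis .
qed

lemma integral_ent_lap:
  assumes F: "F \<in> schwartz_space" and lam: "lam \<noteq> 0"
  shows "(LINT g|lborel. ent lam m g * lap j F g) = - of_real (\<bar>lam\<bar> * (2 * real (m $ j) + 1)) * (LINT g|lborel. ent lam m g * F g)"
  unfolding integral_ent[OF F lam] integral_ent[OF schwartz_lap[OF F] lam] integral_lap_rep[OF F] mult.left_commute[of "cnj _"]
  by (rule integral_mult_right_zero)

lemma integral_ent_U: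
  assumes F: "F \<in> schwartz_space" and lam: "lam \<noteq> 0"
  shows "(LINT g|lborel. ent lam m g * heis_U F g) = \<i> * of_real lam * (LINT g|lborel. ent lam m g * F g)"
  unfolding integral_ent[OF F lam] integral_ent[OF schwartz_heis_U[OF F] lam] integral_U_rep[OF F] mult.left_commute[of "cnj _"]
  by (rule integral_mult_right_zero)

section \<open>Decay of the matrix entries and summation over the lattice\<close>

lemma E_pairing_eq:
  assumes "0 \<le> c" "F \<in> schwartz_space"
  shows "E_pairing c lam m F = of_real c * (LINT g|lborel. ent lam m g * F g)"
proof -
  have [measurable]: "F \<in> borel_measurable borel" by (rule schwartz_measurable[OF assms(2)])
  have "E_pairing c lam m F = (LINT g|lborel. c *\<^sub>R (ent lam m g * F g))"
    unfolding E_pairing_def heis_haar_def ent_def[symmetric] using assms(1)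
    by (intro integral_density) auto
  then show ?thesis by (simp add: scaleR_conv_of_real)
qed

text \<open>The number \<open>2 \<bar>m\<bar> + n\<close>; the sum of all \<open>lap j\<close> has
  eigenvalue \<open>- \<bar>lam\<bar> * hdeg m\<close>.\<close>

definition hdeg :: "nat ^ 'n::finite \<Rightarrow> real" where
  "hdeg m = (\<Sum>j\<in>UNIV. 2 * real (m $ j) + 1)"

lemma hdeg_nonneg: "0 \<le> hdeg m"
  unfolding hdeg_def by (intro sum_nonneg) auto

lemma ent_times_integrable:
  fixes F :: "('p::finite, 'q::finite) heis \<Rightarrow> complex"
  assumes "F \<in> schwartz_space" "lam \<noteq> 0"
  shows "integrable lborel (\<lambda>g. ent lam m g * F g)"
proof (rule Bochner_Integration.integrable_bound)
  have [measurable]: "F \<in> borel_measurable borel" by (rule schwartz_measurable[OF assms(1)])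
  show "integrable lborel (\<lambda>g. gauss_const ^ CARD('p + 'q) * norm (F g))"
    by (intro integrable_mult_right integrable_norm schwartz_integrable assms)
  show "AE g in lborel. norm (ent lam m g * F g) \<le> norm (gauss_const ^ CARD('p + 'q) * norm (F g))"
    unfolding norm_mult[of "ent _ _ _"] real_norm_def
    by (intro always_eventually allI order_trans[OF _ abs_ge_self] mult_right_mono norm_ent assms(2) norm_ge_zero)
  show "(\<lambda>g. ent lam m g * F g) \<in> borel_measurable lborel" by measurable
qed

lemma E_pairing_add:
  assumes "0 \<le> c" "F \<in> schwartz_space" "G \<in> schwartz_space" "lam \<noteq> 0"
  shows "E_pairing c lam m (\<lambda>g. F g + G g) = E_pairing c lam m F + E_pairing c lam m G"
  unfolding E_pairing_eq[OF assms(1,2)] E_pairing_eq[OF assms(1,3)] E_pairing_eq[OF assms(1) schwartz_add[OF assms(2,3)]] distrib_left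
  by (simp only: distrib_left Bochner_Integration.integral_add[OF ent_times_integrable[OF assms(2,4)] ent_times_integrable[OF assms(3,4)]])

lemma E_pairing_cmult:
  assumes "0 \<le> c" "F \<in> schwartz_space"
  shows "E_pairing c lam m (\<lambda>g. a * F g) = a * E_pairing c lam m F"
  unfolding E_pairing_eq[OF assms] E_pairing_eq[OF assms(1) schwartz_cmult[OF assms(2)]] integral_pull
  by simp

lemma E_pairing_diff:
  assumes "0 \<le> c" "F \<in> schwartz_space" "G \<in> schwartz_space" "lam \<noteq> 0"
  shows "E_pairing c lam m (\<lambda>g. F g - G g) = E_pairing c lam m F - E_pairing c lam m G"
  using E_pairing_add[OF assms(1,2) schwartz_cmult[OF assms(3), of "-1"] assms(4), of m]
  by (simp add: E_pairing_cmult[OF assms(1,3), of lam m "-1", simplified])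

lemma E_pairing_zero: "E_pairing c lam m (\<lambda>g. 0) = 0"
  by (simp add: E_pairing_def)

lemma E_pairing_sum:
  assumes "0 \<le> c" "\<And>i. i \<in> I \<Longrightarrow> F i \<in> schwartz_space" "lam \<noteq> 0"
  shows "E_pairing c lam m (\<lambda>g. \<Sum>i\<in>I. F i g) = (\<Sum>i\<in>I. E_pairing c lam m (F i))"
  using assms(2)
  by (induction I rule: infinite_finite_induct) (auto simp: E_pairing_zero E_pairing_add[OF assms(1) _ schwartz_sum assms(3)])

lemma E_pairing_lap:
  assumes "0 \<le> c" "F \<in> schwartz_space" "lam \<noteq> 0"
  shows "E_pairing c lam m (lap j F) = - of_real (\<bar>lam\<bar> * (2 * real (m $ j) + 1)) * E_pairing c lam m F"
  unfolding E_pairing_eq[OF assms(1,2)] E_pairing_eq[OF assms(1) schwartz_lap[OF assms(2)]] integral_ent_lap[OF assms(2,3)]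
  by (rule mult.left_commute)

lemma E_pairing_U:
  assumes "0 \<le> c" "F \<in> schwartz_space" "lam \<noteq> 0"
  shows "E_pairing c lam m (heis_U F) = \<i> * of_real lam * E_pairing c lam m F"
  unfolding E_pairing_eq[OF assms(1,2)] E_pairing_eq[OF assms(1) schwartz_heis_U[OF assms(2)]] integral_ent_U[OF assms(2,3)]
  by (rule mult.left_commute)

lemma E_pairing_reflect:
  assumes "0 \<le> c" "F \<in> schwartz_space"
  shows "E_pairing c lam m (reflect F) = E_pairing c (- lam) m F"
proof -
  have [measurable]: "F \<in> borel_measurable borel" by (rule schwartz_measurable[OF assms(2)])
  have "(LINT g|lborel. ent lam m (- g) * F (- (- g))) = (LINT g|lborel. ent lam m g * F (- g))"
    by (rule lborel_transform(1)[OF distr_lborel_uminus, where f = "\<lambda>g. ent lam m g * F (- g)"]) measurable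
  then show ?thesis
    unfolding E_pairing_eq[OF assms(1) schwartz_reflect[OF assms(2)]] E_pairing_eq[OF assms] reflect_def
    by (simp add: ent_uminus)
qed

text \<open>All squares enter with the same sign, so the eigenvalue grows in every coordinate of
  \<open>m\<close>. That of \<open>L\<close> depends on the signed degree only and is constant on
  the infinite sets to be summed over.\<close>

definition damp :: "(('p::finite, 'q::finite) heis \<Rightarrow> complex) \<Rightarrow> ('p, 'q) heis \<Rightarrow> complex" where
  "damp f g = f g - (\<Sum>j\<in>UNIV. lap j f g)"

lemma cont_op_damp: "cont_op damp"
  unfolding damp_def[abs_def] by (intro cont_op_diff cont_op_id cont_op_sum cont_op_lap)

lemmas cont_op_damp_pow = cont_op_funpow[OF cont_op_damp]
lemmas schwartz_damp_pow = cont_opD[OF cont_op_damp_pow]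

lemma E_pairing_damp:
  assumes "0 \<le> c" "F \<in> schwartz_space" "lam \<noteq> 0"
  shows "E_pairing c lam m (damp F) = of_real (1 + \<bar>lam\<bar> * hdeg m) * E_pairing c lam m F"
proof -
  have "E_pairing c lam m (damp F) = E_pairing c lam m F - (\<Sum>j\<in>UNIV. E_pairing c lam m (lap j F))"
    unfolding damp_def
    by (simp only: E_pairing_diff[OF assms(1,2) schwartz_sum[OF schwartz_lap[OF assms(2)]] assms(3)]
        E_pairing_sum[OF assms(1) schwartz_lap[OF assms(2)] assms(3)])
  also have "(\<Sum>j\<in>UNIV. E_pairing c lam m (lap j F)) = - of_real (\<bar>lam\<bar> * hdeg m) * E_pairing c lam m F"
    unfolding E_pairing_lap[OF assms] hdeg_def sum_distrib_left of_real_sum sum_negf[symmetric] sum_distrib_right ..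
  finally show ?thesis by (simp add: algebra_simps)
qed

lemma E_pairing_damp_pow:
  assumes "0 \<le> c" "F \<in> schwartz_space" "lam \<noteq> 0"
  shows "E_pairing c lam m ((damp ^^ N) F) = of_real ((1 + \<bar>lam\<bar> * hdeg m) ^ N) * E_pairing c lam m F"
  by (induction N) (simp_all add: E_pairing_damp schwartz_damp_pow assms)

text \<open>Two powers for each of the free coordinates on a hyperplane \<open>signed_degree m = k\<close> make the sum
  over it converge; the other three provide decay in \<open>\<bar>lam\<bar> (1 + \<bar>k\<bar>)\<close>.\<close>

definition decay_order :: "('p::finite, 'q::finite) heis itself \<Rightarrow> nat" where
  "decay_order _ = 2 * (CARD('p + 'q) - 1) + 3"

text \<open>Kept apart from \<open>damp_norm\<close> because the remainder of a translation will
  satisfy this estimate with a constant read off from second derivatives instead of its own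
  \<open>damp_norm\<close>.\<close>

definition decays :: "real \<Rightarrow> (('p::finite, 'q::finite) heis \<Rightarrow> complex) \<Rightarrow> real \<Rightarrow> bool" where
  "decays c f A \<longleftrightarrow> 0 \<le> A \<and> (\<forall>lam m. lam \<noteq> 0 \<longrightarrow>
     norm (E_pairing c lam m f) \<le> A / (1 + \<bar>lam\<bar> * hdeg m) ^ decay_order TYPE(('p, 'q) heis))"

definition damp_norm :: "(('p::finite, 'q::finite) heis \<Rightarrow> complex) \<Rightarrow> real" where
  "damp_norm f = L1 ((damp ^^ decay_order TYPE(('p, 'q) heis)) f)"

definition entry_const :: "real \<Rightarrow> ('p::finite, 'q::finite) heis itself \<Rightarrow> real" where
  "entry_const c _ = c * gauss_const ^ CARD('p + 'q)"

lemma entry_const_nonneg: "0 \<le> c \<Longrightarrow> 0 \<le> entry_const c T"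
  by (simp add: entry_const_def gauss_const_nonneg)

lemma norm_E_pairing_L1:
  fixes F :: "('p::finite, 'q::finite) heis \<Rightarrow> complex"
  assumes "0 \<le> c" "F \<in> schwartz_space" "lam \<noteq> 0"
  shows "norm (E_pairing c lam m F) \<le> entry_const c TYPE(('p, 'q) heis) * L1 F"
proof -
  have "norm (LINT g|lborel. ent lam m g * F g) \<le> (LINT g|lborel. norm (ent lam m g * F g))"
    by (rule integral_norm_bound)
  also have "\<dots> \<le> (LINT g|lborel. gauss_const ^ CARD('p + 'q) * norm (F g))"
    using assms
    unfolding norm_mult
    by (intro Bochner_Integration.integral_mono integrable_norm[OF ent_times_integrable, unfolded norm_mult]
        integrable_norm integrable_mult_right schwartz_integrable mult_right_mono norm_ent norm_ge_zero)
  also have "\<dots> = gauss_const ^ CARD('p + 'q) * L1 F" by (simp add: L1_def)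
  finally show ?thesis
    unfolding E_pairing_eq[OF assms(1,2)] entry_const_def using assms(1)
    by (simp add: norm_mult mult_left_mono mult.assoc)
qed

text \<open>Pairing with a power of \<open>damp\<close> applied to \<open>F\<close> multiplies by
  that power of the eigenvalue, while the result is still bounded by an L1 norm; dividing gives the
  decay.\<close>

lemma schwartz_decays:
  fixes F :: "('p::finite, 'q::finite) heis \<Rightarrow> complex"
  assumes "0 \<le> c" "F \<in> schwartz_space"
  shows "decays c F (entry_const c TYPE(('p, 'q) heis) * damp_norm F)"
  unfolding decays_def
proof (intro conjI allI impI)
  let ?N = "decay_order TYPE(('p, 'q) heis)"
  fix lam :: real and m :: "nat ^ ('p + 'q)" assume lam: "lam \<noteq> 0"
  have pos: "0 < 1 + \<bar>lam\<bar> * hdeg m" using hdeg_nonneg[of m] by (simp add: add_pos_nonneg)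
  have "norm (E_pairing c lam m F) * (1 + \<bar>lam\<bar> * hdeg m) ^ ?N = norm (E_pairing c lam m ((damp ^^ ?N) F))"
    unfolding E_pairing_damp_pow[OF assms lam] norm_mult norm_of_real using pos by simp
  also have "\<dots> \<le> entry_const c TYPE(('p, 'q) heis) * damp_norm F"
    unfolding damp_norm_def by (intro norm_E_pairing_L1 assms lam schwartz_damp_pow)
  finally show "norm (E_pairing c lam m F) \<le> entry_const c TYPE(('p, 'q) heis) * damp_norm F / (1 + \<bar>lam\<bar> * hdeg m) ^ ?N"
    using pos by (simp add: pos_le_divide_eq)
qed (use assms in \<open>simp add: entry_const_nonneg damp_norm_def L1_nonneg\<close>)

section \<open>Summation over the hyperplanes of constant signed degree\<close>

lemma sum_inverse_squares_bound:
  assumes "0 < (a::real)"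
  shows "(\<Sum>i<K. 1 / (1 + a * (2 * real i + 1))\<^sup>2) \<le> 1 / (2 * a)"
proof -
  \<comment> \<open>The subtracted term makes the induction telescope: with
    \<open>x = 1 + 2 a K\<close> the new summand is \<open>1 / (x + a)\<^sup>2\<close>, which is at
    most \<open>1 / (x (x + 2 a))\<close>.\<close>
  have "(\<Sum>i<K. 1 / (1 + a * (2 * real i + 1))\<^sup>2) \<le> 1 / (2 * a) * (1 - 1 / (1 + 2 * a * real K))"
  proof (induction K)
    case (Suc K)
    let ?x = "1 + 2 * a * real K"
    have x: "0 < ?x" using assms by (simp add: add_pos_nonneg)
    have "1 / (1 + a * (2 * real K + 1))\<^sup>2 \<le> 1 / (?x * (?x + 2 * a))"
    proof (rule divide_left_mono)
      show "?x * (?x + 2 * a) \<le> (1 + a * (2 * real K + 1))\<^sup>2"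
        by (simp add: power2_eq_square algebra_simps)
      show "0 < (1 + a * (2 * real K + 1))\<^sup>2 * (?x * (?x + 2 * a))"
        using x assms by (intro mult_pos_pos zero_less_power) (auto intro: add_pos_nonneg)
    qed simp
    also have "\<dots> = 1 / (2 * a) * (1 / ?x - 1 / (?x + 2 * a))"
      using x assms by (simp add: field_simps)
    finally show ?case using Suc.IH by (simp add: algebra_simps)
  qed simp
  also have "\<dots> \<le> 1 / (2 * a) * 1"
    using assms by (intro mult_left_mono) (auto simp: add_pos_nonneg)
  finally show ?thesis by simp
qed

lemma signed_degree_eps: "real_of_int (signed_degree m) = (\<Sum>j\<in>UNIV. eps j * real (m $ j))"
  unfolding signed_degree_def sum_UNIV_Plus by (simp add: sum_negf)

lemma abs_eps: "\<bar>eps j\<bar> = 1" "eps j \<noteq> 0"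
  by (cases j; simp)+

lemma hdeg_ge_signed_degree:
  fixes m :: "nat ^ ('p::finite + 'q::finite)"
  shows "1 + \<bar>real_of_int (signed_degree m)\<bar> \<le> hdeg m"
proof -
  have "\<bar>real_of_int (signed_degree m)\<bar> \<le> (\<Sum>j\<in>UNIV. real (m $ j))"
    unfolding signed_degree_eps by (rule order_trans[OF sum_abs]) (simp add: abs_mult abs_eps)
  moreover have "hdeg m = (\<Sum>j\<in>UNIV. real (m $ j)) + (\<Sum>j\<in>UNIV. real (m $ j)) + real CARD('p + 'q)"
    unfolding hdeg_def by (simp add: sum.distrib sum_distrib_left[symmetric])
  moreover have "0 \<le> (\<Sum>j\<in>UNIV. real (m $ j))" by (simp add: sum_nonneg)
  moreover have "1 \<le> real CARD('p + 'q)" using zero_less_card_finite[where 'a = "'p + 'q"] by linarith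
  ultimately show ?thesis by linarith
qed

text \<open>On the hyperplane \<open>signed_degree m = k\<close> one coordinate is determined by the others,
  which saves one factor \<open>1 / a\<close> in comparison with the sum over the whole lattice.\<close>

lemma sum_hyperplane_bound:
  fixes M :: "(nat ^ ('p::finite + 'q::finite)) set"
  assumes a: "0 < a" and M: "finite M" "M \<subseteq> {m. signed_degree m = k}"
  shows "(\<Sum>m\<in>M. 1 / (1 + a * hdeg m) ^ decay_order TYPE(('p, 'q) heis))
    \<le> 1 / (1 + a * (1 + \<bar>real_of_int k\<bar>)) ^ 3 * (1 / (2 * a)) ^ (CARD('p + 'q) - 1)"
proof -
  \<comment> \<open>Any fixed coordinate can serve as the dependent one.\<close>
  define j0 :: "'p + 'q" where "j0 = undefined"
  let ?J = "UNIV - {j0}"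
  define b where "b i = 1 / (1 + a * (2 * real i + 1))\<^sup>2" for i
  have card: "card ?J = CARD('p + 'q) - 1" by (simp add: card_Diff_singleton)
  have b0: "0 \<le> b i" for i by (simp add: b_def)
  have pt: "1 / (1 + a * hdeg m) ^ decay_order TYPE(('p, 'q) heis) \<le> 1 / (1 + a * (1 + \<bar>real_of_int k\<bar>)) ^ 3 * (\<Prod>j\<in>?J. b (m $ j))"
    if "m \<in> M" for m
  proof -
    have pos: "0 < 1 + a * hdeg m" using a hdeg_nonneg[of m] by (simp add: add_pos_nonneg)
    have "signed_degree m = k" using that M by auto
    then have k: "1 + a * (1 + \<bar>real_of_int k\<bar>) \<le> 1 + a * hdeg m"
      using hdeg_ge_signed_degree[of m] a by (auto intro: mult_left_mono)
    have "1 / (1 + a * hdeg m) ^ decay_order TYPE(('p, 'q) heis) = 1 / (1 + a * hdeg m) ^ 3 * (\<Prod>j\<in>?J. 1 / (1 + a * hdeg m)\<^sup>2)"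
      unfolding decay_order_def prod_constant card by (simp add: power_add power_mult power_divide)
    also have "\<dots> \<le> 1 / (1 + a * (1 + \<bar>real_of_int k\<bar>)) ^ 3 * (\<Prod>j\<in>?J. b (m $ j))"
    proof (intro mult_mono prod_mono conjI)
      have "0 < 1 + a * (1 + \<bar>real_of_int k\<bar>)" using a by (simp add: add_pos_nonneg)
      then show "1 / (1 + a * hdeg m) ^ 3 \<le> 1 / (1 + a * (1 + \<bar>real_of_int k\<bar>)) ^ 3"
        using pos k by (intro divide_left_mono power_mono mult_pos_pos zero_less_power) auto
      show "0 \<le> 1 / (1 + a * (1 + \<bar>real_of_int k\<bar>)) ^ 3" using a by simp
      fix j :: "'p + 'q"
      have "2 * real (m $ j) + 1 \<le> hdeg m"
        unfolding hdeg_def by (rule member_le_sum) auto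
      then have le: "1 + a * (2 * real (m $ j) + 1) \<le> 1 + a * hdeg m" using a by simp
      have "0 < 1 + a * (2 * real (m $ j) + 1)" using a by (simp add: add_pos_nonneg)
      then show "1 / (1 + a * hdeg m)\<^sup>2 \<le> b (m $ j)"
        unfolding b_def using pos le by (intro divide_left_mono power_mono mult_pos_pos zero_less_power) auto
    qed (auto intro!: prod_nonneg)
    finally show ?thesis .
  qed
  \<comment> \<open>All of \<open>M\<close> has signed degree \<open>k\<close> and
    \<open>eps j0\<close> is nonzero, so the free coordinates determine
    \<open>m $ j0\<close>.\<close>
  have inj: "inj_on (\<lambda>m. restrict (($) m) ?J) M"
  proof (rule inj_onI)
    fix m m' assume mM: "m \<in> M" "m' \<in> M" and eq: "restrict (($) m) ?J = restrict (($) m') ?J"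
    have off: "m $ j = m' $ j" if "j \<noteq> j0" for j
      using fun_cong[OF eq, of j] that by simp
    have "(\<Sum>j\<in>UNIV. eps j * real (m $ j)) = (\<Sum>j\<in>UNIV. eps j * real (m' $ j))"
      using mM M unfolding signed_degree_eps[symmetric] by auto
    then have "eps j0 * real (m $ j0) + (\<Sum>j\<in>?J. eps j * real (m $ j)) = eps j0 * real (m' $ j0) + (\<Sum>j\<in>?J. eps j * real (m' $ j))"
      by (simp add: sum.remove[of UNIV j0])
    moreover have "(\<Sum>j\<in>?J. eps j * real (m $ j)) = (\<Sum>j\<in>?J. eps j * real (m' $ j))"
      using off by (intro sum.cong) auto
    ultimately have "m $ j0 = m' $ j0" using abs_eps(2)[of j0] by simp
    then show "m = m'" using off by (metis vec_eq_iff)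
  qed
  \<comment> \<open>A box around the finite set \<open>M\<close>, over which the sum of products
    factors into a product of sums.\<close>
  define K where "K = Suc (\<Sum>m\<in>M. \<Sum>j\<in>UNIV. m $ j)"
  have K: "m $ j < K" if "m \<in> M" for m j
  proof -
    have "m $ j \<le> (\<Sum>j\<in>UNIV. m $ j)" by (rule member_le_sum) auto
    also have "\<dots> \<le> (\<Sum>m\<in>M. \<Sum>j\<in>UNIV. m $ j)" using that M by (intro member_le_sum) auto
    finally show ?thesis by (simp add: K_def)
  qed
  have "(\<Sum>m\<in>M. \<Prod>j\<in>?J. b (m $ j)) = (\<Sum>x\<in>(\<lambda>m. restrict (($) m) ?J) ` M. \<Prod>j\<in>?J. b (x j))"
    by (subst sum.reindex[OF inj]) (auto intro!: sum.cong prod.cong)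
  also have "\<dots> \<le> (\<Sum>x\<in>PiE ?J (\<lambda>_. {..<K}). \<Prod>j\<in>?J. b (x j))"
  proof (rule sum_mono2)
    show "(\<lambda>m. restrict (($) m) ?J) ` M \<subseteq> PiE ?J (\<lambda>_. {..<K})"
      by (intro image_subsetI PiE_I) (simp_all add: K)
  qed (auto intro!: prod_nonneg finite_PiE b0)
  also have "\<dots> = (\<Prod>j\<in>?J. \<Sum>i<K. b i)"
    by (rule prod_sum_PiE[symmetric]) auto
  also have "\<dots> \<le> (\<Prod>j\<in>?J. 1 / (2 * a))"
    using sum_inverse_squares_bound[OF a, of K] b0 by (intro prod_mono) (auto simp: b_def intro!: sum_nonneg)
  also have "\<dots> = (1 / (2 * a)) ^ (CARD('p + 'q) - 1)" unfolding prod_constant card ..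
  finally have *: "(\<Sum>m\<in>M. \<Prod>j\<in>?J. b (m $ j)) \<le> (1 / (2 * a)) ^ (CARD('p + 'q) - 1)" .
  have "(\<Sum>m\<in>M. 1 / (1 + a * hdeg m) ^ decay_order TYPE(('p, 'q) heis)) \<le> (\<Sum>m\<in>M. 1 / (1 + a * (1 + \<bar>real_of_int k\<bar>)) ^ 3 * (\<Prod>j\<in>?J. b (m $ j)))"
    by (rule sum_mono[OF pt])
  also have "\<dots> = 1 / (1 + a * (1 + \<bar>real_of_int k\<bar>)) ^ 3 * (\<Sum>m\<in>M. \<Prod>j\<in>?J. b (m $ j))"
    by (simp only: sum_distrib_left)
  also have "\<dots> \<le> 1 / (1 + a * (1 + \<bar>real_of_int k\<bar>)) ^ 3 * (1 / (2 * a)) ^ (CARD('p + 'q) - 1)"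
    using a by (intro mult_left_mono[OF *]) auto
  finally show ?thesis .
qed

text \<open>The uniform bound on finite partial sums gives both summability and the estimate.
  Multiplication by \<open>\<bar>lam\<bar> ^ (n - 1)\<close> absorbs the factor
  \<open>(1 / (2 \<bar>lam\<bar>)) ^ (n - 1)\<close> lost in summing over the hyperplane.\<close>

lemma decays_S_dist:
  fixes f :: "('p::finite, 'q::finite) heis \<Rightarrow> complex"
  assumes f: "decays c f A" and lam: "lam \<noteq> 0"
  shows "(\<lambda>m. norm (E_pairing c lam m f)) summable_on {m. signed_degree m = k}"
    and "norm (S_dist c lam k f) * \<bar>lam\<bar> ^ (CARD('p + 'q) - 1) \<le> A / (1 + \<bar>lam\<bar> * (1 + \<bar>real_of_int k\<bar>)) ^ 3"
proof -
  let ?a = "\<bar>lam\<bar>" and ?N = "decay_order TYPE(('p, 'q) heis)" and ?n = "CARD('p + 'q) - 1"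
  let ?B = "1 / (1 + ?a * (1 + \<bar>real_of_int k\<bar>)) ^ 3"
  let ?w = "\<lambda>m :: nat ^ ('p + 'q). A * (1 / (1 + ?a * hdeg m) ^ ?N)"
  have a: "0 < ?a" using lam by simp
  have A: "0 \<le> A" using f by (simp add: decays_def)
  have le: "norm (E_pairing c lam m f) \<le> ?w m" for m
    using f lam by (simp add: decays_def)
  have fin: "sum ?w M \<le> A * (?B * (1 / (2 * ?a)) ^ ?n)" if "finite M" "M \<subseteq> {m. signed_degree m = k}" for M
    unfolding sum_distrib_left[symmetric] by (rule mult_left_mono[OF sum_hyperplane_bound[OF a that] A])
  have w0: "0 \<le> ?w m" for m using le[of m] norm_ge_zero by (rule order_trans[rotated])
  have sw: "?w summable_on {m. signed_degree m = k}"
    by (rule nonneg_bdd_above_summable_on) (use fin w0 in \<open>auto simp: bdd_above_def\<close>)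
  show s: "(\<lambda>m. norm (E_pairing c lam m f)) summable_on {m. signed_degree m = k}"
    by (rule Infinite_Sum.abs_summable_on_comparison_test'[OF sw le])
  have "norm (S_dist c lam k f) \<le> infsum ?w {m. signed_degree m = k}"
    unfolding S_dist_def
    by (rule norm_infsum_le[OF has_sum_infsum[OF abs_summable_summable[OF s]] has_sum_infsum[OF sw] le])
  also have "\<dots> \<le> A * (?B * (1 / (2 * ?a)) ^ ?n)"
    by (rule infsum_le_finite_sums[OF sw fin])
  finally have "norm (S_dist c lam k f) * ?a ^ ?n \<le> A * (?B * (1 / (2 * ?a)) ^ ?n) * ?a ^ ?n"
    by (rule mult_right_mono) simp
  also have "\<dots> = A * ?B * (1 / 2) ^ ?n"
    using a by (simp add: power_mult_distrib power_divide)
  also have "\<dots> \<le> A * ?B * 1"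
    using A by (intro mult_left_mono power_le_one) auto
  finally show "norm (S_dist c lam k f) * ?a ^ ?n \<le> A / (1 + ?a * (1 + \<bar>real_of_int k\<bar>)) ^ 3" by simp
qed

lemma E_pairing_measurable:
  assumes "0 \<le> c" "F \<in> schwartz_space"
  shows "(\<lambda>lam. E_pairing c lam m F) \<in> borel_measurable borel"
proof -
  have [measurable]: "F \<in> borel_measurable borel" by (rule schwartz_measurable[OF assms(2)])
  have "(\<lambda>(lam, g). ent lam m g * F g) \<in> borel_measurable (borel \<Otimes>\<^sub>M lborel)"
  proof -
    have [measurable]: "(\<lambda>p. ent (fst p) m (snd p)) \<in> borel_measurable (borel \<Otimes>\<^sub>M lborel)"
      using measurable_ent[of m] by simp
    show ?thesis unfolding split_beta' by measurable
  qed
  then have "(\<lambda>lam. LINT g|lborel. ent lam m g * F g) \<in> borel_measurable borel"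
    by (rule lborel.borel_measurable_lebesgue_integral)
  then show ?thesis unfolding E_pairing_eq[OF assms] by measurable
qed

text \<open>For \<open>lam \<noteq> 0\<close> the sum converges absolutely and is an integral over
  counting measure, hence measurable as a parameter integral. The two may differ at
  \<open>lam = 0\<close>, which is why a separate function \<open>s\<close> is returned.\<close>

lemma S_dist_measurable:
  fixes f :: "('p::finite, 'q::finite) heis \<Rightarrow> complex"
  assumes "0 \<le> c" "f \<in> schwartz_space"
  obtains s where "s \<in> borel_measurable borel" "\<And>lam. lam \<noteq> 0 \<Longrightarrow> S_dist c lam k f = s lam"
proof
  let ?A = "{m :: nat ^ ('p + 'q). signed_degree m = k}"
  interpret A: sigma_finite_measure "count_space ?A"
    by (intro sigma_finite_measure_count_space_countable) simp
  have "(\<lambda>p. E_pairing c (snd p) (fst p) f) \<in> borel_measurable (count_space ?A \<Otimes>\<^sub>M borel)"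
    by (rule measurable_pair_measure_countable1) (auto intro: E_pairing_measurable assms)
  from measurable_pair_swap[OF this]
  have "(\<lambda>(lam, m). E_pairing c lam m f) \<in> borel_measurable (borel \<Otimes>\<^sub>M count_space ?A)"
    by (simp add: split_beta')
  then show "(\<lambda>lam. LINT m|count_space ?A. E_pairing c lam m f) \<in> borel_measurable borel"
    by (rule A.borel_measurable_lebesgue_integral)
  fix lam :: real assume "lam \<noteq> 0"
  from decays_S_dist(1)[OF schwartz_decays[OF assms] this]
  show "S_dist c lam k f = (LINT m|count_space ?A. E_pairing c lam m f)"
    unfolding S_dist_def infsetsum_def[symmetric]
    by (intro infsetsum_infsum[symmetric]) (simp add: abs_summable_equivalent[symmetric])
qed

section \<open>Convergence of the series defining the fundamental solution\<close>

text \<open>For \<open>\<bar>k\<bar>\<close> beyond the norm of \<open>\<beta>\<close> the term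
  \<open>2 k\<close> dominates and slope 1/2 suffices; the finitely many remaining quotients are
  nonzero and have a positive minimum.\<close>

lemma int_affine_lower_bound:
  fixes \<beta> :: complex
  assumes "\<And>k::int. 2 * of_int k + \<beta> \<noteq> 0"
  obtains \<delta> where "0 < \<delta>" "\<And>k::int. \<delta> * (1 + \<bar>real_of_int k\<bar>) \<le> norm (2 * of_int k + \<beta>)"
proof -
  define K where "K = \<lceil>norm \<beta>\<rceil> + 1"
  let ?q = "\<lambda>k::int. norm (2 * of_int k + \<beta>) / (1 + \<bar>real_of_int k\<bar>)"
  have K: "norm \<beta> \<le> real_of_int K" "1 \<le> K"
    using norm_ge_zero[of \<beta>] unfolding K_def by linarith+
  define \<delta> where "\<delta> = min (1/2) (Min (?q ` {-K..K}))"
  have ne: "?q ` {-K..K} \<noteq> {}" using K(2) by auto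
  have fin: "finite (?q ` {-K..K})" by simp
  have "0 < Min (?q ` {-K..K})"
    using assms by (subst Min_gr_iff[OF fin ne]) (auto intro!: divide_pos_pos)
  then have pos: "0 < \<delta>" by (simp add: \<delta>_def)
  have "\<delta> * (1 + \<bar>real_of_int k\<bar>) \<le> norm (2 * of_int k + \<beta>)" for k
  proof (cases "k \<in> {-K..K}")
    case True
    then have "\<delta> \<le> ?q k" unfolding \<delta>_def using fin by (intro min.coboundedI2 Min_le) auto
    then show ?thesis by (simp add: pos_le_divide_eq add_pos_nonneg)
  next
    case False
    then have "K < \<bar>k\<bar>" by auto
    then have k: "real_of_int K + 1 \<le> \<bar>real_of_int k\<bar>" by linarith
    have "norm (2 * complex_of_int k) = 2 * \<bar>real_of_int k\<bar>" by (simp add: norm_mult)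
    then have "2 * \<bar>real_of_int k\<bar> \<le> norm (2 * of_int k + \<beta>) + norm \<beta>"
      using norm_triangle_ineq4[of "2 * of_int k + \<beta>" \<beta>] by simp
    then have e: "1/2 * (1 + \<bar>real_of_int k\<bar>) \<le> norm (2 * of_int k + \<beta>)"
      using k K(1) by (simp add: field_simps)
    have d: "\<delta> * (1 + \<bar>real_of_int k\<bar>) \<le> 1/2 * (1 + \<bar>real_of_int k\<bar>)"
      by (intro mult_right_mono) (auto simp: \<delta>_def)
    show ?thesis by (rule order_trans[OF d e])
  qed
  then show ?thesis using pos that by blast
qed

lemma summable_int_inverse_squares: "(\<lambda>k::int. 1 / (1 + \<bar>real_of_int k\<bar>)\<^sup>2) summable_on UNIV"
proof -
  let ?f = "\<lambda>k::int. 1 / (1 + \<bar>real_of_int k\<bar>)\<^sup>2"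
  have "summable (\<lambda>n. 1 / (1 + real n)\<^sup>2)"
    using inverse_power_summable[of 2, where 'a = real] summable_Suc_iff[of "\<lambda>n. inverse (real n ^ 2)"]
    by (simp add: field_simps)
  then have s: "(\<lambda>n. 1 / (1 + real n)\<^sup>2) summable_on UNIV"
    by (subst summable_on_UNIV_nonneg_real_iff) auto
  then have "(?f \<circ> int) summable_on UNIV" by (simp add: o_def)
  then have 1: "?f summable_on range int"
    by (subst summable_on_reindex) (auto simp: inj_on_def)
  have "(?f \<circ> (\<lambda>n. - int n)) summable_on UNIV" using s by (simp add: o_def)
  then have 2: "?f summable_on range (\<lambda>n. - int n)"
    by (subst summable_on_reindex) (auto simp: inj_on_def)
  have "UNIV = range int \<union> (range (\<lambda>n. - int n) - range int)"
    by auto (metis int_cases2 rangeI)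
  moreover have "?f summable_on (range (\<lambda>n. - int n) - range int)"
    by (rule summable_on_subset_banach[OF 2]) auto
  ultimately show ?thesis using 1 by (metis (no_types, lifting) Diff_disjoint summable_on_Un_disjoint)
qed

definition cube_const :: real where
  "cube_const = (LINT s::real|lborel. 1 / (1 + \<bar>s\<bar>) ^ 3)"

lemma cube_integral:
  assumes "0 < b"
  shows "integrable lborel (\<lambda>s::real. 1 / (1 + \<bar>s\<bar> * b) ^ 3)" "(LINT s::real|lborel. 1 / (1 + \<bar>s\<bar> * b) ^ 3) = cube_const / b"
proof -
  have i: "integrable lborel (\<lambda>s::real. 1 / (1 + \<bar>s\<bar>) ^ 3)"
    using integrable_inverse_power_norm[where 'a = real] by (simp add: numeral_3_eq_3)
  show "integrable lborel (\<lambda>s::real. 1 / (1 + \<bar>s\<bar> * b) ^ 3)"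
    using lborel_integrable_real_affine[OF i, of b 0] assms by (simp add: abs_mult mult.commute)
  show "(LINT s::real|lborel. 1 / (1 + \<bar>s\<bar> * b) ^ 3) = cube_const / b"
    using lborel_integral_real_affine[of b "\<lambda>s::real. 1 / (1 + \<bar>s\<bar>) ^ 3" 0] assms
    by (simp add: cube_const_def abs_mult mult.commute field_simps)
qed

lemma cube_const_nonneg: "0 \<le> cube_const"
  unfolding cube_const_def by simp

text \<open>For \<open>lam \<noteq> 0\<close>, \<open>- \<bar>lam\<bar>\<close> times this is the
  eigenvalue of \<open>dist_L_alpha \<alpha>\<close> on \<open>S_dist c lam k\<close>.\<close>

definition denom :: "complex \<Rightarrow> ('p::finite, 'q::finite) heis itself \<Rightarrow> int \<Rightarrow> real \<Rightarrow> complex" where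
  "denom \<alpha> _ k lam = 2 * of_int k + of_nat CARD('p) - of_nat CARD('q) - \<alpha> * of_real (sgn lam)"

lemma Phi_integrand_eq:
  fixes f :: "('p::finite, 'q::finite) heis \<Rightarrow> complex"
  shows "Phi_integrand c \<alpha> k f lam = 1 / (- of_real \<bar>lam\<bar> * denom \<alpha> TYPE(('p, 'q) heis) k lam) * S_dist c lam k f * of_real (\<bar>lam\<bar> ^ CARD('p + 'q))"
  by (simp add: Phi_integrand_def denom_def)

text \<open>The sign of \<open>lam\<close> selects one of the two families in the hypothesis; the
  smaller of the two gaps serves both.\<close>

lemma denom_lower_bound:
  assumes "\<forall>k::int. 2 * of_int k + of_nat CARD('p::finite) - of_nat CARD('q::finite) + \<alpha> \<noteq> 0
                 \<and> 2 * of_int k + of_nat CARD('p) - of_nat CARD('q) - \<alpha> \<noteq> 0"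
  obtains \<delta> where "0 < \<delta>"
    "\<And>k lam. lam \<noteq> 0 \<Longrightarrow> \<delta> * (1 + \<bar>real_of_int k\<bar>) \<le> norm (denom \<alpha> TYPE(('p, 'q) heis) k lam)"
proof -
  let ?\<beta> = "of_nat CARD('p) - of_nat CARD('q) :: complex"
  have nz: "2 * of_int k + (?\<beta> + \<alpha>) \<noteq> 0" "2 * of_int k + (?\<beta> - \<alpha>) \<noteq> 0" for k :: int
    using spec[OF assms, of k] by (simp_all add: algebra_simps)
  obtain \<delta>1 where 1: "0 < \<delta>1" "\<And>k::int. \<delta>1 * (1 + \<bar>real_of_int k\<bar>) \<le> norm (2 * of_int k + (?\<beta> + \<alpha>))"
    by (rule int_affine_lower_bound[OF nz(1)]) blast
  obtain \<delta>2 where 2: "0 < \<delta>2" "\<And>k::int. \<delta>2 * (1 + \<bar>real_of_int k\<bar>) \<le> norm (2 * of_int k + (?\<beta> - \<alpha>))"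
    by (rule int_affine_lower_bound[OF nz(2)]) blast
  have "min \<delta>1 \<delta>2 * (1 + \<bar>real_of_int k\<bar>) \<le> norm (denom \<alpha> TYPE(('p, 'q) heis) k lam)" if "lam \<noteq> 0" for k lam
  proof (cases "lam > 0")
    case True
    then have "denom \<alpha> TYPE(('p, 'q) heis) k lam = 2 * of_int k + (?\<beta> - \<alpha>)" by (simp add: denom_def)
    moreover have "min \<delta>1 \<delta>2 * (1 + \<bar>real_of_int k\<bar>) \<le> \<delta>2 * (1 + \<bar>real_of_int k\<bar>)" by (intro mult_right_mono) auto
    ultimately show ?thesis using 2(2)[of k] by simp
  next
    case False
    then have "denom \<alpha> TYPE(('p, 'q) heis) k lam = 2 * of_int k + (?\<beta> + \<alpha>)" using that by (simp add: denom_def)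
    moreover have "min \<delta>1 \<delta>2 * (1 + \<bar>real_of_int k\<bar>) \<le> \<delta>1 * (1 + \<bar>real_of_int k\<bar>)" by (intro mult_right_mono) auto
    ultimately show ?thesis using 1(2)[of k] by simp
  qed
  then show ?thesis using that[of "min \<delta>1 \<delta>2"] 1(1) 2(1) by simp
qed

text \<open>The constant \<open>C\<close> is independent of \<open>f\<close>, and \<open>A\<close>
  may be any constant from \<open>decays\<close>. The same estimate later gives temperedness and
  bounds the remainder of the derivative.\<close>

lemma Phi_bound:
  assumes nz: "\<forall>k::int. 2 * of_int k + of_nat CARD('p::finite) - of_nat CARD('q::finite) + \<alpha> \<noteq> 0
                 \<and> 2 * of_int k + of_nat CARD('p) - of_nat CARD('q) - \<alpha> \<noteq> 0"
    and c: "0 \<le> c"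
  obtains C where "0 \<le> C"
    "\<And>(f :: ('p, 'q) heis \<Rightarrow> complex) A. f \<in> schwartz_space \<Longrightarrow> decays c f A \<Longrightarrow> Phi_converges c \<alpha> f \<and> norm (Phi c \<alpha> f) \<le> C * A"
proof -
  obtain \<delta> where \<delta>: "0 < \<delta>"
    "\<And>k lam. lam \<noteq> 0 \<Longrightarrow> \<delta> * (1 + \<bar>real_of_int k\<bar>) \<le> norm (denom \<alpha> TYPE(('p, 'q) heis) k lam)"
    by (rule denom_lower_bound[OF nz]) blast
  define Z where "Z = infsum (\<lambda>k::int. 1 / (1 + \<bar>real_of_int k\<bar>)\<^sup>2) UNIV"
  have Z: "0 \<le> Z" unfolding Z_def by (rule infsum_nonneg) simp
  have main: "Phi_converges c \<alpha> f \<and> norm (Phi c \<alpha> f) \<le> cube_const / \<delta> * Z * A"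
    if f: "f \<in> schwartz_space" and d: "decays c f A" for f :: "('p, 'q) heis \<Rightarrow> complex" and A
  proof -
    have A: "0 \<le> A" using d by (simp add: decays_def)
    let ?b = "\<lambda>k::int. 1 + \<bar>real_of_int k\<bar>"
    let ?I = "\<lambda>k lam. indicator (-{0}) lam *\<^sub>R Phi_integrand c \<alpha> k f lam"
    let ?w = "\<lambda>k lam. A / (\<delta> * ?b k) * (1 / (1 + \<bar>lam\<bar> * ?b k) ^ 3)"
    have b: "0 < ?b k" for k by (simp add: add_pos_nonneg)
    have pt: "norm (?I k lam) \<le> ?w k lam" for k lam
    proof (cases "lam = 0")
      case True then show ?thesis using A \<delta>(1) b[of k] by simp
    next
      case False
      let ?d = "denom \<alpha> TYPE(('p, 'q) heis) k lam" and ?n = "CARD('p + 'q)"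
      \<comment> \<open>One of the \<open>n\<close> factors \<open>\<bar>lam\<bar>\<close> cancels
        the one in the eigenvalue; the other \<open>n - 1\<close> are those of
        \<open>decays_S_dist\<close>.\<close>
      have "0 < ?n" by simp
      then have "\<bar>lam\<bar> ^ ?n = \<bar>lam\<bar> * \<bar>lam\<bar> ^ (?n - 1)"
        by (metis power_Suc Suc_pred')
      then have "norm (?I k lam) = 1 / norm ?d * (norm (S_dist c lam k f) * \<bar>lam\<bar> ^ (?n - 1))"
        using False by (simp add: Phi_integrand_eq norm_mult norm_divide del: of_real_power)
      also have "\<dots> \<le> 1 / (\<delta> * ?b k) * (A / (1 + \<bar>lam\<bar> * ?b k) ^ 3)"
      proof (rule mult_mono)
        show "1 / norm ?d \<le> 1 / (\<delta> * ?b k)"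
          by (intro divide_left_mono mult_pos_pos[OF less_le_trans[OF mult_pos_pos[OF \<delta>(1) b[of k]] \<delta>(2)[OF False]]]
              \<delta>(2)[OF False] mult_pos_pos[OF \<delta>(1) b[of k]] zero_le_one)
      qed (use decays_S_dist(2)[OF d False, of k] \<delta>(1) b[of k] in auto)
      finally show ?thesis by simp
    qed
    have wint: "integrable lborel (?w k)" "(LINT lam|lborel. ?w k lam) = A * cube_const / \<delta> * (1 / (?b k)\<^sup>2)" for k
    proof -
      show "integrable lborel (?w k)" by (rule integrable_mult_right[OF cube_integral(1)[OF b]])
      have "(LINT lam|lborel. ?w k lam) = A / (\<delta> * ?b k) * (cube_const / ?b k)"
        by (simp only: integral_mult_right_zero cube_integral(2)[OF b])
      then show "(LINT lam|lborel. ?w k lam) = A * cube_const / \<delta> * (1 / (?b k)\<^sup>2)"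
        by (simp add: power2_eq_square)
    qed
    have meas: "?I k \<in> borel_measurable lborel" for k
    proof -
      obtain s where s: "s \<in> borel_measurable borel" "\<And>lam. lam \<noteq> 0 \<Longrightarrow> S_dist c lam k f = s lam"
        by (rule S_dist_measurable[OF c f, of k]) blast
      have eq: "?I k = (\<lambda>lam. indicator (-{0}) lam *\<^sub>R (1 / (- of_real \<bar>lam\<bar> * denom \<alpha> TYPE(('p, 'q) heis) k lam) * s lam * of_real (\<bar>lam\<bar> ^ CARD('p + 'q))))"
        by (auto simp: fun_eq_iff Phi_integrand_eq s(2) indicator_def)
      show ?thesis unfolding eq denom_def using s(1) by measurable
    qed
    have int: "integrable lborel (?I k)" for k
      by (rule Bochner_Integration.integrable_bound[OF wint(1)[of k] meas])
        (unfold real_norm_def, intro always_eventually allI order_trans[OF pt abs_ge_self])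
    have le: "norm (LINT lam:-{0}|lborel. Phi_integrand c \<alpha> k f lam) \<le> A * cube_const / \<delta> * (1 / (?b k)\<^sup>2)" for k
    proof -
      have "norm (LINT lam|lborel. ?I k lam) \<le> (LINT lam|lborel. norm (?I k lam))" by (rule integral_norm_bound)
      also have "\<dots> \<le> (LINT lam|lborel. ?w k lam)"
        by (intro Bochner_Integration.integral_mono integrable_norm int wint pt)
      finally show ?thesis unfolding wint(2) set_lebesgue_integral_def .
    qed
    have sw: "(\<lambda>k. A * cube_const / \<delta> * (1 / (?b k)\<^sup>2)) summable_on UNIV"
      by (intro summable_on_cmult_right summable_int_inverse_squares)
    have abs: "(\<lambda>k. norm (LINT lam:-{0}|lborel. Phi_integrand c \<alpha> k f lam)) summable_on UNIV"
      by (rule Infinite_Sum.abs_summable_on_comparison_test'[OF sw le])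
    have "norm (Phi c \<alpha> f) \<le> infsum (\<lambda>k. A * cube_const / \<delta> * (1 / (?b k)\<^sup>2)) UNIV"
      unfolding Phi_def
      by (rule norm_infsum_le[OF has_sum_infsum[OF abs_summable_summable[OF abs]] has_sum_infsum[OF sw] le])
    also have "\<dots> = cube_const / \<delta> * Z * A"
      unfolding Z_def by (subst infsum_cmult_right') simp
    finally show ?thesis
      using abs_summable_summable[OF abs] abs_summable_summable[OF decays_S_dist(1)[OF d]] int
      by (auto simp: Phi_converges_def set_integrable_def)
  qed
  show ?thesis
    using main that[of "cube_const / \<delta> * Z"] \<delta>(1) Z cube_const_nonneg by auto
qed

section \<open>Linear operators\<close>

definition lin_op :: "(('a::euclidean_space \<Rightarrow> complex) \<Rightarrow> 'a \<Rightarrow> complex) \<Rightarrow> bool" where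
  "lin_op A \<longleftrightarrow> (\<forall>f\<in>schwartz_space. A f \<in> schwartz_space) \<and>
     (\<forall>f\<in>schwartz_space. \<forall>g\<in>schwartz_space. A (\<lambda>x. f x + g x) = (\<lambda>x. A f x + A g x)) \<and>
     (\<forall>a. \<forall>f\<in>schwartz_space. A (\<lambda>x. a * f x) = (\<lambda>x. a * A f x))"

lemma lin_op_schwartz: "lin_op A \<Longrightarrow> f \<in> schwartz_space \<Longrightarrow> A f \<in> schwartz_space"
  by (simp add: lin_op_def)

lemma lin_op_add_apply:
  "lin_op A \<Longrightarrow> f \<in> schwartz_space \<Longrightarrow> g \<in> schwartz_space \<Longrightarrow> A (\<lambda>x. f x + g x) = (\<lambda>x. A f x + A g x)"
  by (simp add: lin_op_def)

lemma lin_op_cmult_apply: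
  "lin_op A \<Longrightarrow> f \<in> schwartz_space \<Longrightarrow> A (\<lambda>x. a * f x) = (\<lambda>x. a * A f x)"
  by (simp add: lin_op_def)

lemma lin_op_sum_apply:
  assumes "lin_op A" "\<And>i. i \<in> I \<Longrightarrow> f i \<in> schwartz_space"
  shows "A (\<lambda>x. \<Sum>i\<in>I. f i x) = (\<lambda>x. \<Sum>i\<in>I. A (f i) x)"
proof -
  have 0: "A (\<lambda>x. 0) = (\<lambda>x. 0)"
    using lin_op_cmult_apply[OF assms(1) schwartz_zero, of 0] by simp
  show ?thesis using assms(2)
    by (induction I rule: infinite_finite_induct)
      (auto simp: 0 lin_op_add_apply[OF assms(1) _ schwartz_sum])
qed

lemma lin_op_id: "lin_op (\<lambda>f. f)"
  by (simp add: lin_op_def)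

lemma lin_op_comp: "lin_op A \<Longrightarrow> lin_op B \<Longrightarrow> lin_op (\<lambda>f. A (B f))"
  by (simp add: lin_op_def)

lemma lin_op_add: "lin_op A \<Longrightarrow> lin_op B \<Longrightarrow> lin_op (\<lambda>f x. A f x + B f x)"
  by (simp add: lin_op_def schwartz_add algebra_simps)

lemma lin_op_scale: "lin_op A \<Longrightarrow> lin_op (\<lambda>f x. a * A f x)"
  by (simp add: lin_op_def schwartz_cmult algebra_simps)

lemma lin_op_diff: "lin_op A \<Longrightarrow> lin_op B \<Longrightarrow> lin_op (\<lambda>f x. A f x - B f x)"
  using lin_op_add[of A "\<lambda>f x. (-1) * B f x"] lin_op_scale[of B "-1"] by simp

lemma lin_op_zero: "lin_op (\<lambda>f x. 0)"
  by (simp add: lin_op_def schwartz_zero)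

lemma lin_op_sum: "(\<And>i. i \<in> I \<Longrightarrow> lin_op (A i)) \<Longrightarrow> lin_op (\<lambda>f x. \<Sum>i\<in>I. A i f x)"
  by (induction I rule: infinite_finite_induct) (auto intro: lin_op_add lin_op_zero)

lemma lin_op_funpow: "lin_op A \<Longrightarrow> lin_op (A ^^ n)"
proof (induction n)
  case 0 then show ?case using lin_op_id by (simp add: id_def)
next
  case (Suc n) then show ?case using lin_op_comp[of A "A ^^ n"] by (simp add: o_def)
qed

lemma lin_op_lvf: "lin_op (lvf u)"
  unfolding lin_op_def lvf_def[abs_def]
  by (auto simp: fun_eq_iff schwartz_lvf[unfolded lvf_def[abs_def]]
      intro!: ddir_eq has_derivative_add has_derivative_mult_right schwartz_has_derivative)

lemma lin_op_rvf: "lin_op (rvf u)"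
  unfolding lin_op_def rvf_def[abs_def]
  by (auto simp: fun_eq_iff schwartz_rvf[unfolded rvf_def[abs_def]]
      intro!: ddir_eq has_derivative_add has_derivative_mult_right schwartz_has_derivative)

lemma lin_op_lap: "lin_op (lap j)"
  unfolding lap_def[abs_def] by (intro lin_op_add lin_op_comp[OF lin_op_lvf] lin_op_lvf)

lemma lin_op_damp_pow: "lin_op (damp ^^ n)"
  unfolding damp_def[abs_def] by (intro lin_op_funpow lin_op_diff lin_op_id lin_op_sum lin_op_lap)

lemma damp_norm_nonneg: "0 \<le> damp_norm f"
  by (simp add: damp_norm_def L1_nonneg)

lemma damp_norm_cmult: "f \<in> schwartz_space \<Longrightarrow> damp_norm (\<lambda>x. a * f x) = norm a * damp_norm f"
  unfolding damp_norm_def by (simp add: lin_op_cmult_apply[OF lin_op_damp_pow] L1_cmult)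

lemma damp_norm_sum:
  "(\<And>i. i \<in> I \<Longrightarrow> f i \<in> schwartz_space) \<Longrightarrow> damp_norm (\<lambda>x. \<Sum>i\<in>I. f i x) \<le> (\<Sum>i\<in>I. damp_norm (f i))"
  unfolding damp_norm_def by (simp add: lin_op_sum_apply[OF lin_op_damp_pow] L1_sum[OF schwartz_damp_pow])

lemma lap_ltrans:
  assumes "f \<in> schwartz_space" shows "lap j (ltrans x f) = ltrans x (lap j f)"
proof -
  have "lap j (ltrans x f) y = lap j f (heis_mult x y)" for y
    by (simp only: lap_def lvf_ltrans assms schwartz_lvf) (simp only: ltrans_def)
  then show ?thesis by (simp add: fun_eq_iff ltrans_def[of x "lap j f"])
qed

lemma damp_ltrans:
  assumes "f \<in> schwartz_space" shows "damp (ltrans x f) = ltrans x (damp f)"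
proof -
  have "damp (ltrans x f) y = damp f (heis_mult x y)" for y
    by (simp only: damp_def lap_ltrans assms) (simp only: ltrans_def)
  then show ?thesis by (simp add: fun_eq_iff ltrans_def[of x "damp f"])
qed

lemma damp_norm_ltrans:
  assumes "f \<in> schwartz_space" shows "damp_norm (ltrans x f) = damp_norm f"
proof -
  have "(damp ^^ n) (ltrans x f) = ltrans x ((damp ^^ n) f)" for n
    by (induction n) (simp_all add: damp_ltrans schwartz_damp_pow assms)
  then show ?thesis by (simp add: damp_norm_def L1_ltrans schwartz_damp_pow assms)
qed

lemma rdir_expand: "rdir u g = (\<Sum>b\<in>Basis. (u \<bullet> b) *\<^sub>R rdir b g)"
proof -
  interpret linear "\<lambda>u. rdir u g"
    by (rule linearI) (simp_all add: rdir_def om_simps prod_eq_iff field_simps)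
  have "rdir u g = rdir (\<Sum>b\<in>Basis. (u \<bullet> b) *\<^sub>R b) g"
    by (simp only: euclidean_representation)
  then show ?thesis by (simp only: sum scaleR)
qed

lemma rvf_expand_basis:
  assumes "f \<in> schwartz_space"
  shows "rvf u f = (\<lambda>g. \<Sum>b\<in>Basis. of_real (u \<bullet> b) * rvf b f g)"
proof
  fix g
  interpret linear "frechet_derivative f (at g)"
    by (rule linear_frechet_derivative[OF schwartz_differentiable[OF assms]])
  show "rvf u f g = (\<Sum>b\<in>Basis. of_real (u \<bullet> b) * rvf b f g)"
    unfolding rvf_def by (subst rdir_expand) (simp add: sum scaleR scaleR_conv_of_real)
qed

lemma rvf_scaleR:
  assumes "f \<in> schwartz_space"
  shows "rvf (s *\<^sub>R u) f = (\<lambda>g. of_real s * rvf u f g)"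
proof
  fix g
  interpret linear "frechet_derivative f (at g)"
    by (rule linear_frechet_derivative[OF schwartz_differentiable[OF assms]])
  have "rdir (s *\<^sub>R u) g = s *\<^sub>R rdir u g" by (simp add: rdir_def om_simps prod_eq_iff field_simps)
  then show "rvf (s *\<^sub>R u) f g = of_real s * rvf u f g"
    unfolding rvf_def by (simp add: scaleR scaleR_conv_of_real)
qed

lemma rvf_central_shift:
  assumes "f \<in> schwartz_space"
  shows "rvf (fst u, snd u - r) f = (\<lambda>g. rvf u f g - of_real r * heis_U f g)"
proof
  fix g
  interpret linear "frechet_derivative f (at g)"
    by (rule linear_frechet_derivative[OF schwartz_differentiable[OF assms]])
  have "rdir (fst u, snd u - r) g = rdir u g - r *\<^sub>R (0, 1)" by (simp add: rdir_def prod_eq_iff)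
  then show "rvf (fst u, snd u - r) f g = rvf u f g - of_real r * heis_U f g"
    unfolding rvf_def heis_U_def by (simp only: diff scaleR scaleR_conv_of_real)
qed

text \<open>\<open>rvf\<close> is linear in its direction, so the second derivative is a quadratic
  form in \<open>u\<close> with one coefficient function for each pair of basis vectors.\<close>

lemma damp_norm_rvf_rvf:
  assumes f: "f \<in> schwartz_space"
  obtains M where "0 \<le> M" "\<And>u. damp_norm (rvf u (rvf u f)) \<le> M * (norm u)\<^sup>2"
proof
  let ?M = "\<Sum>b\<in>Basis. \<Sum>b'\<in>Basis. damp_norm (rvf b (rvf b' f))"
  show "0 \<le> ?M" by (intro sum_nonneg damp_norm_nonneg)
  fix u
  let ?q = "\<lambda>b b' g. of_real (u \<bullet> b) * (of_real (u \<bullet> b') * rvf b (rvf b' f) g)"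
  have S: "?q b b' \<in> schwartz_space" for b b'
    by (intro schwartz_cmult schwartz_rvf f)
  have "rvf u (rvf u f) = (\<lambda>g. \<Sum>b\<in>Basis. of_real (u \<bullet> b) * rvf b (rvf u f) g)"
    by (rule rvf_expand_basis[OF schwartz_rvf[OF f]])
  also have "\<dots> = (\<lambda>g. \<Sum>b\<in>Basis. \<Sum>b'\<in>Basis. ?q b b' g)"
  proof -
    have "rvf b (rvf u f) = (\<lambda>g. \<Sum>b'\<in>Basis. of_real (u \<bullet> b') * rvf b (rvf b' f) g)" for b
      by (subst rvf_expand_basis[OF f, of u])
        (simp add: lin_op_sum_apply[OF lin_op_rvf schwartz_cmult[OF schwartz_rvf[OF f]]] lin_op_cmult_apply[OF lin_op_rvf schwartz_rvf[OF f]])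
    then show ?thesis by (simp add: sum_distrib_left)
  qed
  finally have "damp_norm (rvf u (rvf u f)) \<le> (\<Sum>b\<in>Basis. damp_norm (\<lambda>g. \<Sum>b'\<in>Basis. ?q b b' g))"
    using S by (simp add: damp_norm_sum schwartz_sum)
  also have "\<dots> \<le> (\<Sum>b\<in>Basis. \<Sum>b'\<in>Basis. damp_norm (?q b b'))"
    by (intro sum_mono damp_norm_sum S)
  also have "\<dots> \<le> (\<Sum>b\<in>Basis. \<Sum>b'\<in>Basis. (norm u)\<^sup>2 * damp_norm (rvf b (rvf b' f)))"
  proof (intro sum_mono)
    fix b b' :: "('a, 'b) heis" assume b: "b \<in> Basis" "b' \<in> Basis"
    have "damp_norm (?q b b') = \<bar>u \<bullet> b\<bar> * \<bar>u \<bullet> b'\<bar> * damp_norm (rvf b (rvf b' f))"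
      by (simp add: damp_norm_cmult schwartz_cmult schwartz_rvf f mult.assoc)
    also have "\<dots> \<le> norm u * norm u * damp_norm (rvf b (rvf b' f))"
      using b by (intro mult_right_mono mult_mono Basis_le_norm damp_norm_nonneg) auto
    finally show "damp_norm (?q b b') \<le> (norm u)\<^sup>2 * damp_norm (rvf b (rvf b' f))" by (simp add: power2_eq_square)
  qed
  also have "\<dots> = ?M * (norm u)\<^sup>2" by (simp add: sum_distrib_left sum_distrib_right mult.commute)
  finally show "damp_norm (rvf u (rvf u f)) \<le> ?M * (norm u)\<^sup>2" .
qed

section \<open>Second order expansion of translations\<close>

lemma norm_integral_unit_interval_le:
  fixes f :: "real \<Rightarrow> complex"
  assumes "\<And>s. s \<in> {0..1} \<Longrightarrow> norm (f s) \<le> B" "0 \<le> B"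
  shows "norm (LINT s|lborel. indicator {0..1} s *\<^sub>R f s) \<le> B"
proof (cases "integrable lborel (\<lambda>s. indicator {0..1} s *\<^sub>R f s)")
  case True
  have "norm (LINT s|lborel. indicator {0..1} s *\<^sub>R f s) \<le> (LINT s|lborel. norm (indicator {0..1} s *\<^sub>R f s))"
    by (rule integral_norm_bound)
  also have "\<dots> \<le> (LINT s::real|lborel. indicator {0..1} s *\<^sub>R B)"
  proof (rule Bochner_Integration.integral_mono[OF integrable_norm[OF True]])
    show "integrable lborel (\<lambda>s::real. indicator {0..1} s *\<^sub>R B)"
      by (intro integrable_scaleR_left integrable_real_indicator) auto
  qed (auto simp: indicator_def assms)
  also have "\<dots> = (LINT s::real|lborel. indicator {0..1} s) *\<^sub>R B"
    by (rule integral_scaleR_left) (rule integrable_real_indicator, auto)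
  also have "\<dots> = B"
    by (subst Bochner_Integration.integral_indicator) simp
  finally show ?thesis .
next
  case False
  \<comment> \<open>The integral of a non-integrable function is 0 by convention, which is at most
    \<open>B\<close>.\<close>
  then show ?thesis using assms(2) by (simp add: not_integrable_integral_eq)
qed

text \<open>First order Taylor formula along the line \<open>s u\<close>, from
  \<open>flow_integral\<close> with the entry as kernel. The flow multiplies on the left, so the
  derivative is \<open>rvf u f\<close>.\<close>

lemma E_pairing_ltrans_integral:
  fixes f :: "('p::finite, 'q::finite) heis \<Rightarrow> complex"
  assumes c: "0 \<le> c" and f: "f \<in> schwartz_space" and lam: "lam \<noteq> 0"
  shows "E_pairing c lam m (ltrans u f) - E_pairing c lam m f
    = (LINT s|lborel. indicator {0..1} s *\<^sub>R E_pairing c lam m (ltrans (s *\<^sub>R u) (rvf u f)))"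
proof -
  have "E_pairing c lam m (ltrans u f) - E_pairing c lam m f = E_pairing c lam m (\<lambda>y. ltrans u f y - f y)"
    by (simp add: E_pairing_diff c f lam schwartz_ltrans)
  also have "\<dots> = of_real c * (LINT y|lborel. ent lam m y * (f (heis_mult (1 *\<^sub>R u) y) - f y))"
    by (subst E_pairing_eq[OF c schwartz_diff[OF schwartz_ltrans[OF f] f]]) (simp add: ltrans_def)
  also have "(LINT y|lborel. ent lam m y * (f (heis_mult (1 *\<^sub>R u) y) - f y))
    = (LINT s|lborel. indicator {0..1} s *\<^sub>R (LINT y|lborel. ent lam m y * rvf u f (heis_mult (s *\<^sub>R u) y)))"
  proof (rule flow_integral[where \<theta> = "\<lambda>s. heis_mult (s *\<^sub>R u)"])
    show "(\<lambda>(s, y). heis_mult (s *\<^sub>R u) y) \<in> borel_measurable (borel \<Otimes>\<^sub>M borel)"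
      unfolding split_beta' by measurable
    show "((\<lambda>s. f (heis_mult (s *\<^sub>R u) y)) has_vector_derivative rvf u f (heis_mult (s *\<^sub>R u) y)) (at s)" for s y
      by (rule rvf_flow[OF rvf_flow_0[OF schwartz_differentiable[OF f]]])
    show "continuous_on UNIV (\<lambda>s. rvf u f (heis_mult (s *\<^sub>R u) y))" for y
      by (rule continuous_on_compose2[OF schwartz_continuous[OF schwartz_rvf[OF f], of UNIV]])
        (auto simp: heis_mult_rdir intro!: continuous_intros)
    show "norm (ent lam m y) \<le> gauss_const ^ CARD('p + 'q)" for y by (rule norm_ent[OF lam])
  qed (auto intro: distr_heis_mult_left schwartz_integrable schwartz_rvf f)
  also have "of_real c * \<dots> = (LINT s|lborel. indicator {0..1} s *\<^sub>R (of_real c * (LINT y|lborel. ent lam m y * rvf u f (heis_mult (s *\<^sub>R u) y))))"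
    by (subst integral_mult_right_zero[symmetric]) (simp add: mult_scaleR_right)
  finally show ?thesis
    unfolding E_pairing_eq[OF c schwartz_ltrans[OF schwartz_rvf[OF f]]] ltrans_def[of _ "rvf u f"] .
qed

lemma norm_E_pairing_ltrans:
  fixes f :: "('p::finite, 'q::finite) heis \<Rightarrow> complex"
  assumes c: "0 \<le> c" and f: "f \<in> schwartz_space" and lam: "lam \<noteq> 0"
  shows "norm (E_pairing c lam m (ltrans x f))
    \<le> entry_const c TYPE(('p, 'q) heis) * damp_norm f / (1 + \<bar>lam\<bar> * hdeg m) ^ decay_order TYPE(('p, 'q) heis)"
  using schwartz_decays[OF c schwartz_ltrans[OF f, of x]] lam
  by (simp add: decays_def damp_norm_ltrans f)

lemma decays_nonneg_bound:
  "0 \<le> A \<Longrightarrow> 0 \<le> A / (1 + \<bar>lam\<bar> * hdeg m) ^ N"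
  using hdeg_nonneg[of m] by simp

lemma norm_E_pairing_ltrans_diff:
  fixes f :: "('p::finite, 'q::finite) heis \<Rightarrow> complex"
  assumes c: "0 \<le> c" and f: "f \<in> schwartz_space" and lam: "lam \<noteq> 0"
  shows "norm (E_pairing c lam m (ltrans u f) - E_pairing c lam m f)
    \<le> entry_const c TYPE(('p, 'q) heis) * damp_norm (rvf u f) / (1 + \<bar>lam\<bar> * hdeg m) ^ decay_order TYPE(('p, 'q) heis)"
  unfolding E_pairing_ltrans_integral[OF assms]
  by (intro norm_integral_unit_interval_le norm_E_pairing_ltrans schwartz_rvf decays_nonneg_bound
      mult_nonneg_nonneg entry_const_nonneg damp_norm_nonneg assms)

text \<open>As \<^const>\<open>damp\<close> is left invariant and Lebesgue measure is translation invariant, \<^const>\<open>damp_norm\<close>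
  does not see left translations; this makes the remainder estimate uniform.\<close>

lemma decays_second_order:
  fixes f :: "('p::finite, 'q::finite) heis \<Rightarrow> complex"
  assumes c: "0 \<le> c" and f: "f \<in> schwartz_space"
  shows "decays c (\<lambda>y. ltrans u f y - f y - rvf u f y) (entry_const c TYPE(('p, 'q) heis) * damp_norm (rvf u (rvf u f)))"
  unfolding decays_def
proof (intro conjI allI impI)
  let ?N = "decay_order TYPE(('p, 'q) heis)" and ?A = "entry_const c TYPE(('p, 'q) heis) * damp_norm (rvf u (rvf u f))"
  show A: "0 \<le> ?A" by (intro mult_nonneg_nonneg entry_const_nonneg damp_norm_nonneg c)
  fix lam :: real and m :: "nat ^ ('p + 'q)" assume lam: "lam \<noteq> 0"
  let ?B = "?A / (1 + \<bar>lam\<bar> * hdeg m) ^ ?N"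
  let ?E = "E_pairing c lam m" and ?h = "rvf u f"
  note h = schwartz_rvf[OF f, of u]
  have B: "0 \<le> ?B" by (rule decays_nonneg_bound[OF A])
  have pt: "norm (?E (ltrans (s *\<^sub>R u) ?h) - ?E ?h) \<le> ?B" if s: "s \<in> {0..1}" for s
  proof -
    \<comment> \<open>The increment is \<open>s u\<close> while the differentiated function is
      \<open>rvf u f\<close>; homogeneity and \<open>s \<le> 1\<close> reduce to the second
      derivative along \<open>u\<close>.\<close>
    have "damp_norm (rvf (s *\<^sub>R u) ?h) = s * damp_norm (rvf u ?h)"
      unfolding rvf_scaleR[OF h] using s by (simp add: damp_norm_cmult schwartz_rvf h)
    also have "\<dots> \<le> 1 * damp_norm (rvf u ?h)" using s by (intro mult_right_mono damp_norm_nonneg) auto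
    finally have "entry_const c TYPE(('p, 'q) heis) * damp_norm (rvf (s *\<^sub>R u) ?h) \<le> ?A"
      by (intro mult_left_mono entry_const_nonneg c) simp
    then have "entry_const c TYPE(('p, 'q) heis) * damp_norm (rvf (s *\<^sub>R u) ?h) / (1 + \<bar>lam\<bar> * hdeg m) ^ ?N \<le> ?B"
      using hdeg_nonneg[of m] by (intro divide_right_mono) auto
    then show ?thesis using norm_E_pairing_ltrans_diff[OF c h lam, of m "s *\<^sub>R u"] by linarith
  qed
  have meas: "(\<lambda>s. ?E (ltrans (s *\<^sub>R u) ?h)) \<in> borel_measurable borel"
  proof -
    have [measurable]: "?h \<in> borel_measurable borel" by (rule schwartz_measurable[OF h])
    have "(\<lambda>(s, y). ent lam m y * ?h (heis_mult (s *\<^sub>R u) y)) \<in> borel_measurable (borel \<Otimes>\<^sub>M lborel)"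
      unfolding split_beta' by measurable
    then have "(\<lambda>s. LINT y|lborel. ent lam m y * ?h (heis_mult (s *\<^sub>R u) y)) \<in> borel_measurable borel"
      by (rule lborel.borel_measurable_lebesgue_integral)
    then show ?thesis unfolding E_pairing_eq[OF c schwartz_ltrans[OF h]] ltrans_def by measurable
  qed
  have int: "integrable lborel (\<lambda>s. indicator {0..1} s *\<^sub>R ?E (ltrans (s *\<^sub>R u) ?h))"
  proof (rule Bochner_Integration.integrable_bound)
    show "integrable lborel (\<lambda>s::real. indicator {0..1} s *\<^sub>R (?B + norm (?E ?h)))" by simp
    show "(\<lambda>s. indicator {0..1} s *\<^sub>R ?E (ltrans (s *\<^sub>R u) ?h)) \<in> borel_measurable lborel"
      using meas by measurable
    have "norm (?E (ltrans (s *\<^sub>R u) ?h)) \<le> ?B + norm (?E ?h)" if "s \<in> {0..1}" for s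
      using pt[OF that] norm_triangle_ineq2[of "?E (ltrans (s *\<^sub>R u) ?h)" "?E ?h"] by linarith
    then show "AE s in lborel. norm (indicator {0..1} s *\<^sub>R ?E (ltrans (s *\<^sub>R u) ?h)) \<le> norm (indicator {0..1} s *\<^sub>R (?B + norm (?E ?h)))"
      using B by (intro always_eventually allI) (simp add: indicator_def)
  qed
  have "?E (\<lambda>y. ltrans u f y - f y - ?h y) = (?E (ltrans u f) - ?E f) - ?E ?h"
    by (simp add: E_pairing_diff c f h lam schwartz_ltrans schwartz_diff)
  \<comment> \<open>The constant \<open>?E ?h\<close> is its own mean over the unit interval, so the
    remainder becomes a mean of first order differences of \<open>rvf u f\<close>.\<close>
  also have "\<dots> = (LINT s|lborel. indicator {0..1} s *\<^sub>R ?E (ltrans (s *\<^sub>R u) ?h)) - (LINT s::real|lborel. indicator {0..1} s *\<^sub>R ?E ?h)"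
    unfolding E_pairing_ltrans_integral[OF c f lam] by simp
  also have "\<dots> = (LINT s|lborel. indicator {0..1} s *\<^sub>R ?E (ltrans (s *\<^sub>R u) ?h) - indicator {0..1} s *\<^sub>R ?E ?h)"
    by (rule Bochner_Integration.integral_diff[OF int, symmetric]) simp
  also have "\<dots> = (LINT s|lborel. indicator {0..1} s *\<^sub>R (?E (ltrans (s *\<^sub>R u) ?h) - ?E ?h))"
    by (simp only: scaleR_diff_right)
  finally show "norm (?E (\<lambda>y. ltrans u f y - f y - ?h y)) \<le> ?B"
    using norm_integral_unit_interval_le[OF pt B] by simp
qed

text \<open>Reflection exchanges \<open>lam\<close> and \<open>- lam\<close>, and the bound in
  \<open>decays\<close> depends on \<open>\<bar>lam\<bar>\<close> only.\<close>

lemma decays_reflect: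
  fixes f :: "('p::finite, 'q::finite) heis \<Rightarrow> complex"
  assumes "0 \<le> c" "f \<in> schwartz_space" "decays c f A"
  shows "decays c (reflect f) A"
  unfolding decays_def
proof (intro conjI allI impI)
  fix lam :: real and m :: "nat ^ ('p + 'q)" assume "lam \<noteq> 0"
  then show "norm (E_pairing c lam m (reflect f)) \<le> A / (1 + \<bar>lam\<bar> * hdeg m) ^ decay_order TYPE(('p, 'q) heis)"
    using assms(3) unfolding E_pairing_reflect[OF assms(1,2)] decays_def
    by (metis abs_minus_cancel neg_equal_0_iff_equal)
qed (use assms(3) in \<open>simp add: decays_def\<close>)

section \<open>The sub-Laplacian\<close>

definition invar_op :: "complex \<Rightarrow> (('p::finite, 'q::finite) heis \<Rightarrow> complex) \<Rightarrow> ('p, 'q) heis \<Rightarrow> complex" where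
  "invar_op \<beta> f g = (\<Sum>j\<in>UNIV. of_real (eps j) * lap j f g) + \<i> * \<beta> * heis_U f g"

lemma lin_op_invar_op: "lin_op (invar_op \<beta>)"
  unfolding invar_op_def[abs_def] heis_U_lvf
  by (intro lin_op_add lin_op_scale lin_op_sum lin_op_lap lin_op_lvf)

lemmas schwartz_invar_op = lin_op_schwartz[OF lin_op_invar_op]

lemma heis_XY_lap:
  assumes "f \<in> schwartz_space"
  shows "heis_X j (heis_X j f) g + heis_Y j (heis_Y j f) g = lap j f g"
  by (simp add: heis_X_lvf heis_Y_lvf schwartz_lvf assms lap_def)

lemma heis_L_alpha_eq:
  assumes "f \<in> schwartz_space"
  shows "heis_L_alpha \<beta> f = invar_op \<beta> f"
  by (simp add: fun_eq_iff heis_L_alpha_def heis_L_def invar_op_def heis_XY_lap[OF assms] sum_UNIV_Plus sum_negf)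

lemma invar_op_ltrans:
  assumes "f \<in> schwartz_space" shows "invar_op \<beta> (ltrans x f) = ltrans x (invar_op \<beta> f)"
proof -
  have "invar_op \<beta> (ltrans x f) y = invar_op \<beta> f (heis_mult x y)" for y
    by (simp only: invar_op_def heis_U_lvf lap_ltrans lvf_ltrans assms) (simp only: ltrans_def)
  then show ?thesis by (simp add: fun_eq_iff ltrans_def[of x "invar_op \<beta> f"])
qed

text \<open>Weighted by \<open>eps\<close>, the numbers \<open>2 m_j + 1\<close> add up to
  \<open>2 B(m) + p - q\<close>, and U contributes \<open>- \<beta> lam\<close>. The sign in
  \<open>denom (- \<beta>)\<close> reflects that the operator acts on the test function, that is,
  transposed.\<close>

lemma E_pairing_invar_op:
  fixes F :: "('p::finite, 'q::finite) heis \<Rightarrow> complex"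
  assumes c: "0 \<le> c" and F: "F \<in> schwartz_space" and lam: "lam \<noteq> 0"
  shows "E_pairing c lam m (invar_op \<beta> F)
    = - of_real \<bar>lam\<bar> * denom (- \<beta>) TYPE(('p, 'q) heis) (signed_degree m) lam * E_pairing c lam m F"
proof -
  have "E_pairing c lam m (invar_op \<beta> F)
      = (\<Sum>j\<in>UNIV. of_real (eps j) * E_pairing c lam m (lap j F)) + \<i> * \<beta> * E_pairing c lam m (heis_U F)"
    unfolding invar_op_def
    by (simp only: E_pairing_add[OF c schwartz_sum[OF schwartz_cmult[OF schwartz_lap[OF F]]] schwartz_cmult[OF schwartz_heis_U[OF F]] lam]
        E_pairing_sum[OF c schwartz_cmult[OF schwartz_lap[OF F]] lam] E_pairing_cmult[OF c schwartz_lap[OF F]]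
        E_pairing_cmult[OF c schwartz_heis_U[OF F]])
  also have "(\<Sum>j\<in>UNIV. of_real (eps j) * E_pairing c lam m (lap j F))
      = (\<Sum>j\<in>UNIV. of_real (- \<bar>lam\<bar> * (eps j * (2 * real (m $ j) + 1))) * E_pairing c lam m F)"
    unfolding E_pairing_lap[OF c F lam] by (intro sum.cong refl) (simp add: algebra_simps)
  also have "\<dots> = of_real (- \<bar>lam\<bar> * (\<Sum>j\<in>UNIV. eps j * (2 * real (m $ j) + 1))) * E_pairing c lam m F"
    by (simp only: sum_distrib_right sum_distrib_left of_real_sum)
  also have "(\<Sum>j\<in>UNIV. eps j * (2 * real (m $ j) + 1)) = 2 * real_of_int (signed_degree m) + real CARD('p) - real CARD('q)"
  proof -
    have "(\<Sum>j\<in>UNIV. eps j * (2 * real (m $ j) + 1)) = 2 * (\<Sum>j\<in>UNIV. eps j * real (m $ j)) + (\<Sum>j::'p + 'q\<in>UNIV. eps j)"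
      by (simp add: algebra_simps sum.distrib sum_distrib_left)
    moreover have "(\<Sum>j::'p + 'q\<in>UNIV. eps j) = real CARD('p) - real CARD('q)"
      unfolding sum_UNIV_Plus by simp
    ultimately show ?thesis by (simp only: signed_degree_eps)
  qed
  finally have 1: "E_pairing c lam m (invar_op \<beta> F)
      = of_real (- \<bar>lam\<bar> * (2 * real_of_int (signed_degree m) + real CARD('p) - real CARD('q))) * E_pairing c lam m F
        + \<i> * \<beta> * (\<i> * of_real lam * E_pairing c lam m F)"
    unfolding E_pairing_U[OF c F lam] .
  have lamsgn: "complex_of_real \<bar>lam\<bar> * complex_of_real (sgn lam) = of_real lam"
    by (simp only: of_real_mult[symmetric] abs_mult_sgn)
  have "of_real (- \<bar>lam\<bar> * (2 * real_of_int (signed_degree m) + real CARD('p) - real CARD('q))) + \<i> * \<beta> * (\<i> * of_real lam)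
      = - of_real \<bar>lam\<bar> * denom (- \<beta>) TYPE(('p, 'q) heis) (signed_degree m) lam"
    unfolding denom_def lamsgn[symmetric] by (simp add: algebra_simps)
  then show ?thesis unfolding 1 by (simp only: distrib_right[symmetric] mult.assoc[symmetric])
qed

section \<open>The fundamental solution\<close>

text \<open>Partial derivatives of a convolution with \<open>\<Phi>\<close> are again combinations of such convolutions, but
  with coefficients that are linear in the coordinates.\<close>

inductive_set poly_span :: "('a::euclidean_space \<Rightarrow> complex) set \<Rightarrow> ('a \<Rightarrow> complex) set" for B where
  base: "F \<in> B \<Longrightarrow> F \<in> poly_span B"
| add: "F \<in> poly_span B \<Longrightarrow> G \<in> poly_span B \<Longrightarrow> (\<lambda>x. F x + G x) \<in> poly_span B"
| cmult: "F \<in> poly_span B \<Longrightarrow> (\<lambda>x. a * F x) \<in> poly_span B"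
| linear_mult: "linear (l :: 'a \<Rightarrow> real) \<Longrightarrow> F \<in> poly_span B \<Longrightarrow> (\<lambda>x. of_real (l x) * F x) \<in> poly_span B"

lemma smooth_poly_span:
  fixes B :: "('a::euclidean_space \<Rightarrow> complex) set"
  assumes diff: "\<And>F x. F \<in> B \<Longrightarrow> F differentiable (at x)"
    and deriv: "\<And>F b. F \<in> B \<Longrightarrow> ddir b F \<in> poly_span B"
    and F: "F \<in> poly_span B"
  shows "smooth F"
proof (rule smooth_coinduct[of F "poly_span B", OF F])
  have l: "((\<lambda>x. complex_of_real (l x)) has_derivative (\<lambda>v. of_real (l v))) (at x)" if "linear l" for l :: "'a \<Rightarrow> real" and x
    using that by (intro has_derivative_of_real bounded_linear_imp_has_derivative) (simp add: linear_conv_bounded_linear)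
  show d: "F differentiable (at x)" if "F \<in> poly_span B" for F x
    using that
  proof induction
    case (linear_mult l F)
    then show ?case using l[OF linear_mult(1)] by (intro differentiable_mult) (auto simp: differentiable_def)
  qed (auto intro: diff differentiable_add differentiable_mult[OF differentiable_const])
  have D: "(F has_derivative (\<lambda>v. ddir v F x)) (at x)" if "F \<in> poly_span B" for F x
    using d[OF that] frechet_derivative_works by blast
  show "ddir b F \<in> poly_span B" if "F \<in> poly_span B" for F b
    using that
  proof induction
    case (base F) then show ?case by (rule deriv)
  next
    case (add F G)
    have "ddir b (\<lambda>x. F x + G x) = (\<lambda>x. ddir b F x + ddir b G x)"
      by (intro ext ddir_eq has_derivative_add D add.hyps)
    then show ?case using poly_span.add[OF add.IH] by simp
  next
    case (cmult F a)
    have "ddir b (\<lambda>x. a * F x) = (\<lambda>x. a * ddir b F x)"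
      by (intro ext ddir_eq has_derivative_mult_right D cmult.hyps)
    then show ?case using poly_span.cmult[OF cmult.IH] by simp
  next
    case (linear_mult l F)
    have "ddir b (\<lambda>x. of_real (l x) * F x) x = of_real (l x) * ddir b F x + of_real (l b) * F x" for x
      by (rule ddir_eq[OF has_derivative_mult[OF l[OF linear_mult.hyps(1)] D[OF linear_mult.hyps(2)]]])
    then show ?case
      using poly_span.add[OF poly_span.linear_mult[OF linear_mult.hyps(1) linear_mult.IH]
          poly_span.cmult[OF linear_mult.hyps(2), of "of_real (l b)"]] by simp
  qed
qed

lemma has_derivative_quadratic:
  fixes F :: "'a::real_normed_vector \<Rightarrow> 'b::real_normed_vector"
  assumes D: "bounded_linear D" and le: "\<And>h. norm (F (x + h) - F x - D h) \<le> M * (norm h)\<^sup>2"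
  shows "(F has_derivative D) (at x)"
  unfolding has_derivative_at
proof
  show "(\<lambda>h. norm (F (x + h) - F x - D h) / norm h) \<midarrow>0\<rightarrow> 0"
  proof (rule Lim_null_comparison)
    show "\<forall>\<^sub>F h in at 0. norm (norm (F (x + h) - F x - D h) / norm h) \<le> M * norm h"
    proof (intro always_eventually allI)
      fix h :: 'a
      show "norm (norm (F (x + h) - F x - D h) / norm h) \<le> M * norm h"
      proof (cases "h = 0")
        case False
        then show ?thesis using le[of h] by (simp add: divide_le_eq power2_eq_square mult.assoc)
      qed simp
    qed
    show "((\<lambda>h. M * norm h) \<longlongrightarrow> 0) (at 0)"
      by (auto intro!: tendsto_eq_intros)
  qed
qed (rule D)

context
  fixes \<alpha> :: complex and c :: real
  assumes nz: "\<forall>k::int. 2 * of_int k + of_nat CARD('p::finite) - of_nat CARD('q::finite) + \<alpha> \<noteq> 0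
                 \<and> 2 * of_int k + of_nat CARD('p) - of_nat CARD('q) - \<alpha> \<noteq> 0"
    and c: "0 \<le> c" and inversion: "inversion_formula c TYPE('p) TYPE('q)"
begin

section \<open>Linearity, continuity and inversion for fixed parameters\<close>

lemma Phi_converges_schwartz:
  fixes f :: "('p, 'q) heis \<Rightarrow> complex"
  assumes "f \<in> schwartz_space" shows "Phi_converges c \<alpha> f"
  using Phi_bound[OF nz c] schwartz_decays[OF c assms] assms by metis

lemma S_dist_add:
  fixes f g :: "('p, 'q) heis \<Rightarrow> complex"
  assumes f: "f \<in> schwartz_space" and g: "g \<in> schwartz_space" and lam: "lam \<noteq> 0"
  shows "S_dist c lam k (\<lambda>x. f x + g x) = S_dist c lam k f + S_dist c lam k g"
  using Phi_converges_schwartz[OF f] Phi_converges_schwartz[OF g] lam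
  unfolding S_dist_def E_pairing_add[OF c f g lam] Phi_converges_def by (intro infsum_add) auto

lemma Phi_add:
  fixes f g :: "('p, 'q) heis \<Rightarrow> complex"
  assumes f: "f \<in> schwartz_space" and g: "g \<in> schwartz_space"
  shows "Phi c \<alpha> (\<lambda>x. f x + g x) = Phi c \<alpha> f + Phi c \<alpha> g"
proof -
  note conv = Phi_converges_schwartz[OF f] Phi_converges_schwartz[OF g]
  have "(LINT lam:-{0}|lborel. Phi_integrand c \<alpha> k (\<lambda>x. f x + g x) lam)
      = (LINT lam:-{0}|lborel. Phi_integrand c \<alpha> k f lam) + (LINT lam:-{0}|lborel. Phi_integrand c \<alpha> k g lam)" for k
  proof -
    have "(LINT lam:-{0}|lborel. Phi_integrand c \<alpha> k (\<lambda>x. f x + g x) lam)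
        = (LINT lam:-{0}|lborel. Phi_integrand c \<alpha> k f lam + Phi_integrand c \<alpha> k g lam)"
    proof (intro set_lebesgue_integral_cong allI impI)
      fix lam :: real assume "lam \<in> -{0}"
      then have lam: "lam \<noteq> 0" by simp
      show "Phi_integrand c \<alpha> k (\<lambda>x. f x + g x) lam = Phi_integrand c \<alpha> k f lam + Phi_integrand c \<alpha> k g lam"
        by (simp only: Phi_integrand_eq S_dist_add[OF f g lam] distrib_left distrib_right)
    qed simp
    also have "\<dots> = (LINT lam:-{0}|lborel. Phi_integrand c \<alpha> k f lam) + (LINT lam:-{0}|lborel. Phi_integrand c \<alpha> k g lam)"
      using conv unfolding Phi_converges_def by (intro set_integral_add) auto
    finally show ?thesis .
  qed
  then show ?thesis
    using conv unfolding Phi_def Phi_converges_def by (subst infsum_add[symmetric]) auto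
qed

lemma Phi_cmult:
  fixes f :: "('p, 'q) heis \<Rightarrow> complex"
  assumes f: "f \<in> schwartz_space"
  shows "Phi c \<alpha> (\<lambda>x. a * f x) = a * Phi c \<alpha> f"
proof -
  have "Phi_integrand c \<alpha> k (\<lambda>x. a * f x) = (\<lambda>lam. a * Phi_integrand c \<alpha> k f lam)" for k
    by (simp add: fun_eq_iff Phi_integrand_def S_dist_def E_pairing_cmult[OF c f] infsum_cmult_right')
  then show ?thesis unfolding Phi_def by (simp add: infsum_cmult_right')
qed

lemma Phi_sum:
  fixes f :: "'i \<Rightarrow> ('p, 'q) heis \<Rightarrow> complex"
  assumes "\<And>i. i \<in> I \<Longrightarrow> f i \<in> schwartz_space"
  shows "Phi c \<alpha> (\<lambda>x. \<Sum>i\<in>I. f i x) = (\<Sum>i\<in>I. Phi c \<alpha> (f i))"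
proof -
  have 0: "Phi c \<alpha> (\<lambda>x::('p, 'q) heis. 0) = 0"
    using Phi_cmult[OF schwartz_zero, of 0] by simp
  show ?thesis using assms
    by (induction I rule: infinite_finite_induct) (auto simp: 0 Phi_add schwartz_sum)
qed

lemma Phi_diff:
  fixes f g :: "('p, 'q) heis \<Rightarrow> complex"
  assumes "f \<in> schwartz_space" "g \<in> schwartz_space"
  shows "Phi c \<alpha> (\<lambda>x. f x - g x) = Phi c \<alpha> f - Phi c \<alpha> g"
  using Phi_add[OF assms(1) schwartz_cmult[OF assms(2), of "-1"]] Phi_cmult[OF assms(2), of "-1"] by simp

lemma Phi_tempered: "tempered_distribution (Phi c \<alpha> :: ('p, 'q) heis_dist)"
proof -
  let ?T = "TYPE(('p, 'q) heis)"
  obtain C where C: "0 \<le> C"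
    "\<And>(f :: ('p, 'q) heis \<Rightarrow> complex) A. f \<in> schwartz_space \<Longrightarrow> decays c f A \<Longrightarrow> Phi_converges c \<alpha> f \<and> norm (Phi c \<alpha> f) \<le> C * A"
    by (rule Phi_bound[OF nz c]) blast
  obtain K N where K: "0 \<le> K" "\<And>f :: ('p, 'q) heis \<Rightarrow> complex. f \<in> schwartz_space \<Longrightarrow> L1 ((damp ^^ decay_order ?T) f) \<le> K * schwartz_norm N f"
    by (rule cont_op_L1[OF cont_op_damp_pow]) blast
  have "norm (Phi c \<alpha> f) \<le> (C * entry_const c ?T * K) * schwartz_norm N f"
    if f: "f \<in> schwartz_space" for f :: "('p, 'q) heis \<Rightarrow> complex"
  proof -
    have "norm (Phi c \<alpha> f) \<le> C * (entry_const c ?T * damp_norm f)"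
      using C(2)[OF f schwartz_decays[OF c f]] by blast
    also have "\<dots> \<le> C * (entry_const c ?T * (K * schwartz_norm N f))"
      unfolding damp_norm_def by (intro mult_left_mono K(2) f C(1) entry_const_nonneg c)
    finally show ?thesis by (simp add: mult.assoc)
  qed
  then show ?thesis
    unfolding tempered_distribution_def schwartz_norm_def using Phi_add Phi_cmult by blast
qed

text \<open>The eigenvalue of the operator cancels the denominator, and what remains is the inversion
  formula at the identity.\<close>

lemma Phi_inversion:
  fixes F G :: "('p, 'q) heis \<Rightarrow> complex"
  assumes F: "F \<in> schwartz_space"
    and G: "\<And>lam m. lam \<noteq> 0 \<Longrightarrow> E_pairing c lam m G
      = - of_real \<bar>lam\<bar> * denom \<alpha> TYPE(('p, 'q) heis) (signed_degree m) lam * E_pairing c lam m F"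
  shows "Phi c \<alpha> G = F 0"
proof -
  let ?d = "denom \<alpha> TYPE(('p, 'q) heis)"
  have nzd: "?d k lam \<noteq> 0" if "lam \<noteq> 0" for k lam
  proof -
    obtain \<delta> where \<delta>: "0 < \<delta>" "\<And>k lam. lam \<noteq> 0 \<Longrightarrow> \<delta> * (1 + \<bar>real_of_int k\<bar>) \<le> norm (?d k lam)"
      by (rule denom_lower_bound[OF nz]) blast
    have "0 < \<delta> * (1 + \<bar>real_of_int k\<bar>)" using \<delta>(1) by (intro mult_pos_pos) auto
    then show ?thesis using \<delta>(2)[OF that, of k] by auto
  qed
  have "Phi_integrand c \<alpha> k G lam = S_dist c lam k F * of_real (\<bar>lam\<bar> ^ CARD('p + 'q))" if lam: "lam \<noteq> 0" for k lam
  proof -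
    have "S_dist c lam k G = (\<Sum>\<^sub>\<infinity>m | signed_degree m = k. - of_real \<bar>lam\<bar> * ?d k lam * E_pairing c lam m F)"
      unfolding S_dist_def by (intro infsum_cong) (simp add: G[OF lam])
    also have "\<dots> = - of_real \<bar>lam\<bar> * ?d k lam * S_dist c lam k F"
      unfolding S_dist_def by (rule infsum_cmult_right')
    finally show ?thesis using nzd[OF lam, of k] lam by (simp add: Phi_integrand_eq)
  qed
  then have "(LINT lam:-{0}|lborel. Phi_integrand c \<alpha> k G lam)
      = (LINT lam:-{0}|lborel. S_dist c lam k F * of_real (\<bar>lam\<bar> ^ CARD('p + 'q)))" for k
    by (intro set_lebesgue_integral_cong) auto
  \<comment> \<open>A convolution at the identity evaluates its function at inverses, so the
    inversion formula is applied to \<open>reflect F\<close> in order to pair with \<open>F\<close>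
    itself.\<close>
  moreover have "heis_conv (reflect F) (S_dist c lam k) 0 = S_dist c lam k F" for lam k
    by (simp add: heis_conv_def heis_inv_eq reflect_def)
  moreover have "((\<lambda>k. LINT lam:-{0}|lborel. heis_conv (reflect F) (S_dist c lam k) 0 * of_real (\<bar>lam\<bar> ^ CARD('p + 'q)))
      has_sum reflect F 0) (UNIV :: int set)"
    using inversion schwartz_reflect[OF F] unfolding inversion_formula_def by blast
  ultimately show ?thesis
    unfolding Phi_def by (simp add: infsumI reflect_def)
qed

text \<open>\<open>invar_op (- \<alpha>)\<close> is the transpose of the operator: the squares are
  symmetric and U is skew.\<close>

lemma Phi_invar_op:
  fixes F :: "('p, 'q) heis \<Rightarrow> complex"
  assumes "F \<in> schwartz_space"
  shows "Phi c \<alpha> (invar_op (- \<alpha>) F) = F 0"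
  by (rule Phi_inversion[OF assms]) (simp add: E_pairing_invar_op[OF c assms])

text \<open>Reflection replaces \<open>lam\<close> by \<open>- lam\<close>. In \<open>denom\<close>
  this cancels the change of sign of \<open>\<alpha>\<close>, so the untransposed operator meets the
  same denominators.\<close>

lemma Phi_reflect_invar_op:
  fixes F :: "('p, 'q) heis \<Rightarrow> complex"
  assumes F: "F \<in> schwartz_space"
  shows "Phi c \<alpha> (reflect (invar_op \<alpha> F)) = F 0"
proof -
  have "Phi c \<alpha> (reflect (invar_op \<alpha> F)) = reflect F 0"
  proof (rule Phi_inversion[OF schwartz_reflect[OF F]])
    fix lam :: real and m :: "nat ^ ('p + 'q)" assume lam: "lam \<noteq> 0"
    have "denom (- \<alpha>) TYPE(('p, 'q) heis) k (- lam) = denom \<alpha> TYPE(('p, 'q) heis) k lam" for k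
      by (simp add: denom_def sgn_minus)
    then show "E_pairing c lam m (reflect (invar_op \<alpha> F))
      = - of_real \<bar>lam\<bar> * denom \<alpha> TYPE(('p, 'q) heis) (signed_degree m) lam * E_pairing c lam m (reflect F)"
      using E_pairing_invar_op[OF c F, of "- lam" m \<alpha>] lam
      by (simp add: E_pairing_reflect[OF c schwartz_invar_op[OF F]] E_pairing_reflect[OF c F])
  qed
  then show ?thesis by (simp add: reflect_def)
qed

section \<open>Differentiation of convolutions\<close>

definition conv_fun :: "(('p, 'q) heis \<Rightarrow> complex) \<Rightarrow> ('p, 'q) heis \<Rightarrow> complex" where
  "conv_fun f x = Phi c \<alpha> (reflect (ltrans x f))"

lemma heis_conv_eq: "heis_conv f T x = T (reflect (ltrans x f))"
  by (simp add: heis_conv_def heis_inv_eq reflect_def[abs_def] ltrans_def)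

lemma heis_conv_Phi: "heis_conv f (Phi c \<alpha>) = conv_fun f"
  by (simp add: fun_eq_iff heis_conv_eq conv_fun_def)

text \<open>The convolution with \<Phi> at the identity. As \<open>conv_fun f x\<close> is
  \<open>eval_refl (ltrans x f)\<close>, varying \<open>x\<close> amounts to translating the
  argument of one fixed functional.\<close>

definition eval_refl :: "(('p, 'q) heis \<Rightarrow> complex) \<Rightarrow> complex" where
  "eval_refl g = Phi c \<alpha> (reflect g)"

lemma reflect_add: "reflect (\<lambda>x. f x + g x) = (\<lambda>x. reflect f x + reflect g x)"
  by (simp add: reflect_def fun_eq_iff)

lemma reflect_diff: "reflect (\<lambda>x. f x - g x) = (\<lambda>x. reflect f x - reflect g x)"
  by (simp add: reflect_def fun_eq_iff)

lemma reflect_cmult: "reflect (\<lambda>x. a * f x) = (\<lambda>x. a * reflect f x)"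
  by (simp add: reflect_def fun_eq_iff)

lemma reflect_sum: "reflect (\<lambda>x. \<Sum>i\<in>I. f i x) = (\<lambda>x. \<Sum>i\<in>I. reflect (f i) x)"
  by (simp add: reflect_def fun_eq_iff)

lemma eval_refl_add: "f \<in> schwartz_space \<Longrightarrow> g \<in> schwartz_space \<Longrightarrow> eval_refl (\<lambda>x. f x + g x) = eval_refl f + eval_refl g"
  by (simp add: eval_refl_def reflect_add Phi_add schwartz_reflect)

lemma eval_refl_diff: "f \<in> schwartz_space \<Longrightarrow> g \<in> schwartz_space \<Longrightarrow> eval_refl (\<lambda>x. f x - g x) = eval_refl f - eval_refl g"
  by (simp add: eval_refl_def reflect_diff Phi_diff schwartz_reflect)

lemma eval_refl_cmult: "f \<in> schwartz_space \<Longrightarrow> eval_refl (\<lambda>x. a * f x) = a * eval_refl f"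
  by (simp add: eval_refl_def reflect_cmult Phi_cmult schwartz_reflect)

lemma eval_refl_sum: "(\<And>i. i \<in> I \<Longrightarrow> f i \<in> schwartz_space) \<Longrightarrow> eval_refl (\<lambda>x. \<Sum>i\<in>I. f i x) = (\<Sum>i\<in>I. eval_refl (f i))"
  by (simp add: eval_refl_def reflect_sum Phi_sum schwartz_reflect)

lemma eval_refl_second_order:
  fixes f :: "('p, 'q) heis \<Rightarrow> complex"
  assumes f: "f \<in> schwartz_space"
  obtains M where "0 \<le> M"
    "\<And>u. norm (eval_refl (ltrans u f) - eval_refl f - eval_refl (rvf u f)) \<le> M * (norm u)\<^sup>2"
proof -
  let ?T = "TYPE(('p, 'q) heis)"
  obtain C where C: "0 \<le> C"
    "\<And>(f :: ('p, 'q) heis \<Rightarrow> complex) A. f \<in> schwartz_space \<Longrightarrow> decays c f A \<Longrightarrow> Phi_converges c \<alpha> f \<and> norm (Phi c \<alpha> f) \<le> C * A"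
    by (rule Phi_bound[OF nz c]) blast
  obtain M where M: "0 \<le> M" "\<And>u. damp_norm (rvf u (rvf u f)) \<le> M * (norm u)\<^sup>2"
    by (rule damp_norm_rvf_rvf[OF f]) blast
  have "norm (eval_refl (ltrans u f) - eval_refl f - eval_refl (rvf u f)) \<le> (C * (entry_const c ?T * M)) * (norm u)\<^sup>2" for u
  proof -
    let ?g = "\<lambda>y. ltrans u f y - f y - rvf u f y"
    note S = schwartz_ltrans[OF f, of u] f schwartz_rvf[OF f, of u]
    have g: "?g \<in> schwartz_space" by (intro schwartz_diff S)
    have "eval_refl (ltrans u f) - eval_refl f - eval_refl (rvf u f) = Phi c \<alpha> (reflect ?g)"
      unfolding eval_refl_def[of ?g, symmetric]
      by (simp only: eval_refl_diff[OF schwartz_diff[OF S(1,2)] S(3)] eval_refl_diff[OF S(1,2)])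
    moreover have "norm (Phi c \<alpha> (reflect ?g)) \<le> C * (entry_const c ?T * damp_norm (rvf u (rvf u f)))"
      using C(2)[OF schwartz_reflect[OF g] decays_reflect[OF c g decays_second_order[OF c f]]] by blast
    moreover have "C * (entry_const c ?T * damp_norm (rvf u (rvf u f))) \<le> C * (entry_const c ?T * (M * (norm u)\<^sup>2))"
      by (intro mult_left_mono M C(1) entry_const_nonneg c)
    ultimately show ?thesis by (simp add: mult.assoc)
  qed
  then show ?thesis using that[of "C * (entry_const c ?T * M)"] C(1) M(1) entry_const_nonneg[OF c, of ?T] by simp
qed

lemma eval_refl_rvf_linear:
  fixes f :: "('p, 'q) heis \<Rightarrow> complex"
  assumes f: "f \<in> schwartz_space"
  shows "eval_refl (rvf u f) = (\<Sum>b\<in>Basis. of_real (u \<bullet> b) * eval_refl (rvf b f))"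
proof -
  have "eval_refl (rvf u f) = eval_refl (\<lambda>g. \<Sum>b\<in>Basis. of_real (u \<bullet> b) * rvf b f g)"
    by (simp only: rvf_expand_basis[OF f, of u])
  also have "\<dots> = (\<Sum>b\<in>Basis. of_real (u \<bullet> b) * eval_refl (rvf b f))"
    by (subst eval_refl_sum) (simp_all add: schwartz_cmult schwartz_rvf f eval_refl_cmult)
  finally show ?thesis .
qed

lemma conv_fun_has_derivative:
  fixes f :: "('p, 'q) heis \<Rightarrow> complex"
  assumes f: "f \<in> schwartz_space"
  shows "(conv_fun f has_derivative (\<lambda>h. eval_refl (rvf (fst h, snd h + om (fst x) (fst h) / 2) (ltrans x f)))) (at x)"
proof -
  let ?u = "\<lambda>h :: ('p, 'q) heis. (fst h, snd h + om (fst x) (fst h) / 2)"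
  let ?f = "ltrans x f"
  note fx = schwartz_ltrans[OF f, of x]
  have "linear ?u" by (rule linearI) (simp_all add: om_simps prod_eq_iff field_simps)
  then have u: "bounded_linear ?u" by (simp add: linear_conv_bounded_linear)
  then obtain K where K: "\<And>h. norm (?u h) \<le> norm h * K" "0 < K"
    using bounded_linear.pos_bounded by blast
  obtain M where M: "0 \<le> M" "\<And>u. norm (eval_refl (ltrans u ?f) - eval_refl ?f - eval_refl (rvf u ?f)) \<le> M * (norm u)\<^sup>2"
    by (rule eval_refl_second_order[OF fx]) blast
  \<comment> \<open>An additive increment \<open>h\<close> of \<open>x\<close> is a right
    multiplication by \<open>?u h\<close>, so the expansion at the identity applies to
    \<open>ltrans x f\<close>.\<close>
  have shift: "x + h = heis_mult x (?u h)" for h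
    by (simp add: heis_mult_eq prod_eq_iff)
  have expand: "(\<lambda>h. eval_refl (rvf (?u h) ?f)) = (\<lambda>h. \<Sum>b\<in>Basis. of_real (?u h \<bullet> b) * eval_refl (rvf b ?f))"
    by (rule ext) (rule eval_refl_rvf_linear[OF fx])
  show ?thesis
  proof (rule has_derivative_quadratic)
    show "bounded_linear (\<lambda>h. eval_refl (rvf (?u h) ?f))"
      unfolding expand
      by (rule bounded_linear_sum, rule bounded_linear_compose[OF bounded_linear_mult_left],
          rule bounded_linear_compose[OF bounded_linear_of_real bounded_linear_compose[OF bounded_linear_inner_left u]])
    fix h
    have "norm (conv_fun f (x + h) - conv_fun f x - eval_refl (rvf (?u h) ?f)) \<le> M * (norm (?u h))\<^sup>2"
      using M(2)[of "?u h"] by (simp only: conv_fun_def shift ltrans_ltrans eval_refl_def)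
    also have "\<dots> \<le> M * (norm h * K)\<^sup>2"
      by (intro mult_left_mono power_mono K M) simp
    finally show "norm (conv_fun f (x + h) - conv_fun f x - eval_refl (rvf (?u h) ?f)) \<le> (M * K\<^sup>2) * (norm h)\<^sup>2"
      by (simp add: power_mult_distrib mult_ac)
  qed
qed

lemma conv_fun_differentiable:
  "f \<in> schwartz_space \<Longrightarrow> conv_fun f differentiable (at x)"
  using conv_fun_has_derivative differentiable_def by blast

lemma rvf_ltrans_expand:
  fixes f :: "('p, 'q) heis \<Rightarrow> complex"
  assumes "f \<in> schwartz_space"
  shows "rvf u (ltrans x f) = (\<lambda>g. ltrans x (rvf u f) g - of_real (om (fst x) (fst u)) * ltrans x (heis_U f) g)"
  unfolding rvf_ltrans[OF assms] rvf_central_shift[OF assms] by (simp add: ltrans_def fun_eq_iff)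

text \<open>The increment stands between \<open>x\<close> and the inverse of the integration
  variable: it multiplies \<open>x\<close> on the right but the argument of
  \<open>ltrans x f\<close> on the left. A left invariant derivative outside thus becomes
  \<open>rvf\<close> inside.\<close>

lemma lvf_conv_fun:
  fixes f :: "('p, 'q) heis \<Rightarrow> complex"
  assumes f: "f \<in> schwartz_space"
  shows "lvf u (conv_fun f) x = eval_refl (rvf u (ltrans x f))"
  unfolding lvf_def
  by (subst ddir_eq[OF conv_fun_has_derivative[OF f]]) (simp add: ldir_def)

lemma eval_refl_rvf_ltrans:
  fixes f :: "('p, 'q) heis \<Rightarrow> complex"
  assumes f: "f \<in> schwartz_space"
  shows "eval_refl (rvf u (ltrans x f)) = conv_fun (rvf u f) x - of_real (om (fst x) (fst u)) * conv_fun (heis_U f) x"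
  unfolding rvf_ltrans_expand[OF f]
  by (simp add: eval_refl_diff eval_refl_cmult schwartz_cmult schwartz_ltrans schwartz_rvf schwartz_heis_U f)
    (simp add: conv_fun_def eval_refl_def)

text \<open>The point \<open>x\<close> sits inside the translation, so the first derivative is
  rewritten as a combination of convolutions at \<open>x\<close>, with a coefficient linear in
  \<open>x\<close>, before it is differentiated again.\<close>

lemma lvf_lvf_conv_fun:
  fixes f :: "('p, 'q) heis \<Rightarrow> complex"
  assumes f: "f \<in> schwartz_space"
  shows "lvf u (lvf u (conv_fun f)) x = eval_refl (rvf u (rvf u (ltrans x f)))"
    and "lvf u (conv_fun f) differentiable (at x)"
proof -
  note S = schwartz_rvf[OF f, of u] schwartz_heis_U[OF f]
  let ?r = "\<lambda>x :: ('p, 'q) heis. om (fst x) (fst u)"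
  have eq: "lvf u (conv_fun f) = (\<lambda>x. conv_fun (rvf u f) x - of_real (?r x) * conv_fun (heis_U f) x)"
    by (simp add: fun_eq_iff lvf_conv_fun[OF f] eval_refl_rvf_ltrans[OF f])
  have "linear ?r" by (rule linearI) (simp_all add: om_simps)
  then have r: "((\<lambda>x. complex_of_real (?r x)) has_derivative (\<lambda>v. of_real (?r v))) (at x)"
    by (intro has_derivative_of_real bounded_linear_imp_has_derivative) (simp add: linear_conv_bounded_linear)
  have d: "(conv_fun g has_derivative (\<lambda>v. ddir v (conv_fun g) x)) (at x)" if "g \<in> schwartz_space" for g
    using conv_fun_differentiable[OF that] frechet_derivative_works by blast
  note D = has_derivative_diff[OF d[OF S(1)] has_derivative_mult[OF r d[OF S(2)]]]
  show "lvf u (conv_fun f) differentiable (at x)"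
    unfolding eq using D differentiable_def by blast
  \<comment> \<open>The coefficient is constant along \<open>u\<close> because \<open>om\<close>
    vanishes on equal arguments, so the Leibniz rule adds no further term.\<close>
  have "lvf u (\<lambda>x. conv_fun (rvf u f) x - of_real (?r x) * conv_fun (heis_U f) x) x
      = lvf u (conv_fun (rvf u f)) x - of_real (?r x) * lvf u (conv_fun (heis_U f)) x"
    unfolding lvf_def by (subst ddir_eq[OF D]) (simp add: ldir_def om_simps)
  then have "lvf u (lvf u (conv_fun f)) x = lvf u (conv_fun (rvf u f)) x - of_real (?r x) * lvf u (conv_fun (heis_U f)) x"
    by (simp only: eq)
  also have "\<dots> = eval_refl (rvf u (ltrans x (rvf u f))) - of_real (?r x) * eval_refl (rvf u (ltrans x (heis_U f)))"
    by (simp only: lvf_conv_fun S)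
  also have "\<dots> = eval_refl (\<lambda>g. rvf u (ltrans x (rvf u f)) g - of_real (?r x) * rvf u (ltrans x (heis_U f)) g)"
    by (simp add: eval_refl_diff eval_refl_cmult schwartz_cmult schwartz_ltrans schwartz_rvf S)
  also have "(\<lambda>g. rvf u (ltrans x (rvf u f)) g - of_real (?r x) * rvf u (ltrans x (heis_U f)) g) = rvf u (rvf u (ltrans x f))"
  proof -
    have "rvf u (rvf u (ltrans x f)) = rvf u (\<lambda>g. ltrans x (rvf u f) g + (- of_real (?r x)) * ltrans x (heis_U f) g)"
      unfolding rvf_ltrans_expand[OF f] by simp
    also have "\<dots> = (\<lambda>g. rvf u (ltrans x (rvf u f)) g + (- of_real (?r x)) * rvf u (ltrans x (heis_U f)) g)"
      by (simp only: lin_op_add_apply[OF lin_op_rvf schwartz_ltrans[OF S(1)] schwartz_cmult[OF schwartz_ltrans[OF S(2)]]]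
          lin_op_cmult_apply[OF lin_op_rvf schwartz_ltrans[OF S(2)]])
    finally show ?thesis by simp
  qed
  finally show "lvf u (lvf u (conv_fun f)) x = eval_refl (rvf u (rvf u (ltrans x f)))" .
qed

lemma smooth_conv_fun:
  fixes f :: "('p, 'q) heis \<Rightarrow> complex"
  assumes f: "f \<in> schwartz_space"
  shows "smooth (conv_fun f)"
proof (rule smooth_poly_span[where B = "conv_fun ` schwartz_space"])
  let ?A = "poly_span (conv_fun ` schwartz_space)"
  show "conv_fun f \<in> ?A" using f by (intro poly_span.base imageI)
  fix F assume "F \<in> conv_fun ` schwartz_space"
  then obtain g where g: "F = conv_fun g" "g \<in> schwartz_space" by blast
  show "F differentiable (at x)" for x unfolding g(1) by (rule conv_fun_differentiable[OF g(2)])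
  fix b :: "('p, 'q) heis"
  let ?l = "\<lambda>x :: ('p, 'q) heis. - om (fst x) (fst b) / 2"
  have "ddir b F x = conv_fun (rvf b g) x + of_real (?l x) * conv_fun (heis_U g) x" for x
  proof -
    have "ddir b F x = eval_refl (rvf (fst b, snd b + om (fst x) (fst b) / 2) (ltrans x g))"
      unfolding g(1) by (rule ddir_eq[OF conv_fun_has_derivative[OF g(2)]])
    also have "\<dots> = conv_fun (rvf (fst b, snd b - (- om (fst x) (fst b) / 2)) g) x - of_real (om (fst x) (fst b)) * conv_fun (heis_U g) x"
      by (simp add: eval_refl_rvf_ltrans[OF g(2)])
    also have "conv_fun (rvf (fst b, snd b - (- om (fst x) (fst b) / 2)) g) x
        = conv_fun (rvf b g) x + of_real (om (fst x) (fst b) / 2) * conv_fun (heis_U g) x"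
    proof -
      have "ltrans x (rvf (fst b, snd b - (- om (fst x) (fst b) / 2)) g)
          = (\<lambda>y. ltrans x (rvf b g) y + of_real (om (fst x) (fst b) / 2) * ltrans x (heis_U g) y)"
        unfolding rvf_central_shift[OF g(2)] by (simp add: ltrans_def fun_eq_iff)
      then have "eval_refl (ltrans x (rvf (fst b, snd b - (- om (fst x) (fst b) / 2)) g))
          = eval_refl (ltrans x (rvf b g)) + of_real (om (fst x) (fst b) / 2) * eval_refl (ltrans x (heis_U g))"
        by (simp only: eval_refl_add[OF schwartz_ltrans[OF schwartz_rvf[OF g(2)]] schwartz_cmult[OF schwartz_ltrans[OF schwartz_heis_U[OF g(2)]]]]
            eval_refl_cmult[OF schwartz_ltrans[OF schwartz_heis_U[OF g(2)]]])
      then show ?thesis by (simp only: conv_fun_def eval_refl_def)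
    qed
    finally show ?thesis by (simp add: algebra_simps)
  qed
  then have eq: "ddir b F = (\<lambda>x. conv_fun (rvf b g) x + of_real (?l x) * conv_fun (heis_U g) x)"
    by (rule ext)
  have l: "linear ?l" by (rule linearI) (simp_all add: om_simps field_simps)
  show "ddir b F \<in> ?A"
    unfolding eq
    by (rule poly_span.add[OF poly_span.base[OF imageI[OF schwartz_rvf[OF g(2)]]]
          poly_span.linear_mult[OF l poly_span.base[OF imageI[OF schwartz_heis_U[OF g(2)]]]]])
qed

text \<open>Each exchange of \<open>rvf\<close> for \<open>lvf\<close> under reflection costs a
  sign, and the two signs cancel.\<close>

lemma reflect_rvf_rvf:
  fixes f :: "('p, 'q) heis \<Rightarrow> complex"
  assumes "f \<in> schwartz_space"
  shows "reflect (rvf u (rvf u f)) = lvf u (lvf u (reflect f))"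
proof -
  have r: "rvf u f = (\<lambda>g. (-1) * reflect (lvf u (reflect f)) g)"
    using rvf_reflect[OF schwartz_reflect[OF assms], of u] by simp
  have S: "lvf u (reflect f) \<in> schwartz_space" by (intro schwartz_lvf schwartz_reflect assms)
  have "rvf u (rvf u f) = (\<lambda>g. (-1) * rvf u (reflect (lvf u (reflect f))) g)"
    by (subst r) (rule lin_op_cmult_apply[OF lin_op_rvf schwartz_reflect[OF S]])
  also have "\<dots> = reflect (lvf u (lvf u (reflect f)))"
    by (simp add: rvf_reflect[OF S] fun_eq_iff)
  finally show ?thesis by simp
qed

text \<open>The derivatives fall on \<open>reflect (ltrans x f)\<close>. Squares keep their sign and
  U changes it, so \<Phi> is applied to the transposed operator
  \<open>invar_op (- \<alpha>)\<close>, and \<open>Phi_invar_op\<close> evaluates the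
  result.\<close>

lemma heis_L_alpha_conv_fun:
  fixes f :: "('p, 'q) heis \<Rightarrow> complex"
  assumes f: "f \<in> schwartz_space"
  shows "heis_L_alpha \<alpha> (conv_fun f) x = f x"
proof -
  let ?F = "conv_fun f" and ?g = "reflect (ltrans x f)"
  have gS: "?g \<in> schwartz_space" by (intro schwartz_reflect schwartz_ltrans f)
  note fx = schwartz_ltrans[OF f, of x]
  have X: "heis_X j (heis_X j ?F) x = eval_refl (rvf (axis j 1, 0) (rvf (axis j 1, 0) (ltrans x f)))" for j
  proof -
    have "heis_X j ?F = lvf (axis j 1, 0) ?F"
      by (rule ext) (rule heis_X_differentiable[OF conv_fun_differentiable[OF f]])
    then show ?thesis by (simp add: heis_X_differentiable[OF lvf_lvf_conv_fun(2)[OF f]] lvf_lvf_conv_fun(1)[OF f])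
  qed
  have Y: "heis_Y j (heis_Y j ?F) x = eval_refl (rvf (axis j \<i>, 0) (rvf (axis j \<i>, 0) (ltrans x f)))" for j
  proof -
    have "heis_Y j ?F = lvf (axis j \<i>, 0) ?F"
      by (rule ext) (rule heis_Y_differentiable[OF conv_fun_differentiable[OF f]])
    then show ?thesis by (simp add: heis_Y_differentiable[OF lvf_lvf_conv_fun(2)[OF f]] lvf_lvf_conv_fun(1)[OF f])
  qed
  have XY: "heis_X j (heis_X j ?F) x + heis_Y j (heis_Y j ?F) x = Phi c \<alpha> (lap j ?g)" for j
  proof -
    have "lap j ?g = (\<lambda>y. lvf (axis j 1, 0) (lvf (axis j 1, 0) ?g) y + lvf (axis j \<i>, 0) (lvf (axis j \<i>, 0) ?g) y)"
      by (simp add: fun_eq_iff lap_def)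
    then show ?thesis
      unfolding X Y eval_refl_def reflect_rvf_rvf[OF fx]
      by (simp add: Phi_add schwartz_lvf gS)
  qed
  have U: "heis_U ?F x = - Phi c \<alpha> (heis_U ?g)"
  proof -
    have "rvf (0, 1) (ltrans x f) = (\<lambda>y. (-1) * reflect (heis_U ?g) y)"
      using rvf_reflect[OF gS, of "(0, 1)"] by (simp add: heis_U_lvf)
    then have "eval_refl (rvf (0, 1) (ltrans x f)) = - eval_refl (reflect (heis_U ?g))"
      by (simp add: eval_refl_cmult[of "reflect (heis_U ?g)" "-1", simplified] schwartz_reflect schwartz_heis_U gS)
    then show ?thesis by (simp add: heis_U_lvf[of ?F] lvf_conv_fun[OF f] eval_refl_def[of "reflect _"])
  qed
  have "heis_L_alpha \<alpha> ?F x = (\<Sum>j\<in>UNIV. of_real (eps j) * Phi c \<alpha> (lap j ?g)) + \<i> * (- \<alpha>) * Phi c \<alpha> (heis_U ?g)"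
    unfolding heis_L_alpha_def heis_L_def XY U by (simp add: sum_UNIV_Plus sum_negf)
  also have "\<dots> = Phi c \<alpha> (invar_op (- \<alpha>) ?g)"
    unfolding invar_op_def[abs_def]
    by (simp only: Phi_add[OF schwartz_sum[OF schwartz_cmult[OF schwartz_lap[OF gS]]] schwartz_cmult[OF schwartz_heis_U[OF gS]]]
        Phi_sum[OF schwartz_cmult[OF schwartz_lap[OF gS]]] Phi_cmult[OF schwartz_lap[OF gS]] Phi_cmult[OF schwartz_heis_U[OF gS]])
  also have "\<dots> = f x" by (simp add: Phi_invar_op[OF gS]) (simp add: reflect_def ltrans_def)
  finally show ?thesis .
qed

text \<open>\<Phi> is mapped to the point mass at the identity: second order terms carry two
  transposition signs and U carries one, so \<open>invar_op (- \<alpha>)\<close> appears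
  again.\<close>

lemma dist_L_alpha_Phi:
  fixes g :: "('p, 'q) heis \<Rightarrow> complex"
  assumes g: "g \<in> schwartz_space"
  shows "dist_L_alpha \<alpha> (Phi c \<alpha>) g = g 0"
proof -
  have XY: "Phi c \<alpha> (heis_X j (heis_X j g)) + Phi c \<alpha> (heis_Y j (heis_Y j g)) = Phi c \<alpha> (lap j g)" for j
  proof -
    have "lap j g = (\<lambda>y. heis_X j (heis_X j g) y + heis_Y j (heis_Y j g) y)"
      by (simp add: fun_eq_iff heis_XY_lap[OF g])
    then show ?thesis by (simp add: Phi_add heis_X_lvf heis_Y_lvf schwartz_lvf g)
  qed
  have "dist_L_alpha \<alpha> (Phi c \<alpha>) g = (\<Sum>j\<in>UNIV. of_real (eps j) * Phi c \<alpha> (lap j g)) + \<i> * (- \<alpha>) * Phi c \<alpha> (heis_U g)"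
    by (simp add: dist_L_alpha_def dist_L_def dist_X_def dist_Y_def dist_U_def XY sum_UNIV_Plus sum_negf)
  also have "\<dots> = Phi c \<alpha> (invar_op (- \<alpha>) g)"
    unfolding invar_op_def[abs_def]
    by (simp only: Phi_add[OF schwartz_sum[OF schwartz_cmult[OF schwartz_lap[OF g]]] schwartz_cmult[OF schwartz_heis_U[OF g]]]
        Phi_sum[OF schwartz_cmult[OF schwartz_lap[OF g]]] Phi_cmult[OF schwartz_lap[OF g]] Phi_cmult[OF schwartz_heis_U[OF g]])
  also have "\<dots> = g 0" by (rule Phi_invar_op[OF g])
  finally show ?thesis .
qed

lemma Phi_fundamental_solution:
  "fundamental_solution (heis_L_alpha \<alpha>) (dist_L_alpha \<alpha>) (Phi c \<alpha> :: ('p, 'q) heis_dist)"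
  unfolding fundamental_solution_def
proof (intro conjI ballI Phi_tempered)
  fix f :: "('p, 'q) heis \<Rightarrow> complex" assume f: "f \<in> schwartz_space"
  have eval0: "ltrans x f 0 = f x" "reflect (ltrans x f) 0 = f x" for x
    by (simp_all add: ltrans_def reflect_def)
  show "smooth (heis_conv f (Phi c \<alpha>))" unfolding heis_conv_Phi by (rule smooth_conv_fun[OF f])
  show "heis_L_alpha \<alpha> (heis_conv f (Phi c \<alpha>)) = f"
    unfolding heis_conv_Phi by (rule ext) (rule heis_L_alpha_conv_fun[OF f])
  \<comment> \<open>Left invariance moves the operator past the translation, after which
    \<open>Phi_reflect_invar_op\<close> applies to \<open>ltrans x f\<close>.\<close>
  show "heis_conv (heis_L_alpha \<alpha> f) (Phi c \<alpha>) = f"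
    by (simp add: fun_eq_iff heis_conv_eq heis_L_alpha_eq[OF f] invar_op_ltrans[OF f, symmetric]
        Phi_reflect_invar_op[OF schwartz_ltrans[OF f]] eval0)
  show "heis_conv f (dist_L_alpha \<alpha> (Phi c \<alpha>)) = f"
    by (simp add: fun_eq_iff heis_conv_eq dist_L_alpha_Phi schwartz_reflect schwartz_ltrans f eval0)
qed

end

theorem theorem2p1:
  fixes \<alpha> :: complex and c :: real
  assumes "\<forall>k::int. 2 * of_int k + of_nat CARD('p::finite) - of_nat CARD('q::finite) + \<alpha> \<noteq> 0
                 \<and> 2 * of_int k + of_nat CARD('p) - of_nat CARD('q) - \<alpha> \<noteq> 0"
    and "c > 0" and "inversion_formula c TYPE('p) TYPE('q)"
  shows "(\<forall>f \<in> schwartz_space. Phi_converges c \<alpha> (f :: ('p, 'q) heis \<Rightarrow> complex))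
    \<and> tempered_distribution (Phi c \<alpha> :: ('p, 'q) heis_dist)
    \<and> fundamental_solution (heis_L_alpha \<alpha>) (dist_L_alpha \<alpha>) (Phi c \<alpha> :: ('p, 'q) heis_dist)"
proof -
  have c: "0 \<le> c" using assms(2) by simp
  show ?thesis
    using Phi_converges_schwartz[OF assms(1) c assms(3)] Phi_tempered[OF assms(1) c assms(3)]
      Phi_fundamental_solution[OF assms(1) c assms(3)] by blast
qed

end
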